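(* Let $\nu_1$ and $\nu_2$ be non-zero finite Borel measures on $(0,1)$. Then $\overline s_{\nu_1+\nu_2}=\max\{\overline s_{\nu_1},\overline s_{\nu_2}\}$. If additionally $\underline s_{\nu_1}=\overline s_{\nu_1}\ge\overline s_{\nu_2}$, then the spectral dimension of $\nu_1+\nu_2$ exists and equals $\overline s_{\nu_1}$. If $\underline s_{\nu_1}=\overline s_{\nu_1}\ge\overline s_{\nu_2}$ and $\nu_1$ is regular, then $\nu_1+\nu_2$ is regular.
   Context: $\Lambda$ is Lebesgue measure. Below, $\nu$ is a non-zero finite Borel measure on $(0,1)$, regarded as a measure on $[0,1]$. Spectral dimensions. $H^1_0(0,1)$ is the space of functions $f:[0,1]\to\mathbb R$ with $f(x)=\int_{[0,x]}g\,d\Lambda$ for some $g\in L^2_\Lambda([0,1])$ and $f(0)=f(1)=0$; $\nabla_\Lambda f:=g$. $C_\nu([0,1])$ is the set of continuous real functions on $[0,1]$ that are affine linear on every connected component of $[0,1]\setminus\operatorname{supp}\nu$. $\operatorname{dom}(\mathcal E_\nu):=H^1_0(0,1)\cap C_\nu([0,1])$, $\mathcal E_\nu(f,g):=\int_{(0,1)}\nabla_\Lambda f\,\nabla_\Lambda g\,d\Lambda$. A number $\lambda$ is an eigenvalue of $\mathcal E_\nu$ if there is $f\in\operatorname{dom}(\mathcal E_\nu)\setminus\{0\}$ with $\mathcal E_\nu(f,g)=\lambda\int fg\,d\nu$ for all $g\in\operatorname{dom}(\mathcal E_\nu)$. $N_\nu(x)$ is the number of eigenvalues $\le x$ (with multiplicity).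 $\underline{s}_\nu:=\liminf_{x\to\infty}\frac{\log N_\nu(x)}{\log x}$, $\overline{s}_\nu:=\limsup_{x\to\infty}\frac{\log N_\nu(x)}{\log x}$; if they coincide, the common value is the spectral dimension of $\nu$. Regularity. A $\nu$-partition is a finite family $\{(c_k,c_{k+1}]:k=1,\dots,n-1\}$, $n\ge2$, with $0=c_1<\dots<c_n=1$ and $\nu(\{c_k\})=0$ for all $k$; $\Pi$ is the set of all $\nu$-partitions. $\mathcal N^R(x):=\inf\{\operatorname{card}P:P\in\Pi,\ \max_{C\in P}\nu(C)\Lambda(C)<1/x\}$, $\overline h_\nu:=\limsup_{x\to\infty}\frac{\log\mathcal N^R(x)}{\log x}$. $\Pi_0$ is the set of finite families of pairwise disjoint subintervals of $[0,1]$ whose endpoints carry no $\nu$-atoms. For an interval $C$ and $m>1$, $\langle C\rangle_m\subset C$ is the interval of length $\Lambda(C)/m$ with the same midpoint as $C$ (and of the same open/closed type). $\mathcal N^L_m(x):=\sup\{\operatorname{card}P:P\in\Pi_0,\ \min_{C\in P}\nu(\langle C\rangle_m)\Lambda(\langle C\rangle_m)\ge\frac{4}{x(m-1)}\}$, $\underline h^m_\nu:=\liminf_{x\to\infty}\frac{\log\mathcal N^L_m(x)}{\log x}$. $\nu$ is called regular if $\sup_{m>1}\underline h_\nu^m=\overline h_\nu$. *)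

theory Defs
  imports "HOL-Analysis.Analysis" "HOL-Library.Function_Algebras"
begin

text \<open>
  A finite Borel measure on the open unit interval, regarded as a measure on the closed unit
  interval, is represented by a finite Borel measure on the real line that vanishes outside the
  open unit interval.
\<close>

definition nonzero_finite_borel :: "real measure \<Rightarrow> bool" where
  "nonzero_finite_borel \<nu> \<longleftrightarrow>
     sets \<nu> = sets borel \<and> finite_measure \<nu> \<and>
     emeasure \<nu> (- {0<..<1}) = 0 \<and> emeasure \<nu> {0<..<1} \<noteq> 0"

definition sum_measure :: "'a measure \<Rightarrow> 'a measure \<Rightarrow> 'a measure" where
  "sum_measure M N = measure_of (space M) (sets M) (\<lambda>A. emeasure M A + emeasure N A)"

lemma sets_sum_measure [simp]: "sets (sum_measure M N) = sets M"
  by (simp add: sum_measure_def)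

lemma space_sum_measure [simp]: "space (sum_measure M N) = space M"
  by (simp add: sum_measure_def)

lemma emeasure_sum_measure:
  assumes "sets M = sets N" "A \<in> sets M"
  shows "emeasure (sum_measure M N) A = emeasure M A + emeasure N A"
proof (rule emeasure_measure_of[OF sum_measure_def])
  show "sets M \<subseteq> Pow (space M)"
    by (rule sets.space_closed)
  show "A \<in> sets (sum_measure M N)"
    using assms by simp
  show "positive (sets (sum_measure M N)) (\<lambda>A. emeasure M A + emeasure N A)"
    by (simp add: positive_def)
  show "countably_additive (sets (sum_measure M N)) (\<lambda>A. emeasure M A + emeasure N A)"
    unfolding countably_additive_def
  proof (intro allI impI)
    fix F :: "nat \<Rightarrow> 'a set"
    assume "range F \<subseteq> sets (sum_measure M N)" "disjoint_family F"
    then have "(\<Sum>i. emeasure M (F i)) = emeasure M (\<Union>i. F i)"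
      "(\<Sum>i. emeasure N (F i)) = emeasure N (\<Union>i. F i)"
      using assms(1) by (auto intro!: suminf_emeasure)
    then show "(\<Sum>i. emeasure M (F i) + emeasure N (F i)) =
        emeasure M (\<Union>i. F i) + emeasure N (\<Union>i. F i)"
      by (simp add: suminf_add[symmetric])
  qed
qed

text \<open>The counting functions below are extended natural numbers, whence the extended logarithm.\<close>

definition eln :: "enat \<Rightarrow> ereal" where
  "eln n = (case n of enat k \<Rightarrow> if k = 0 then - \<infinity> else ereal (ln (real k)) | \<infinity> \<Rightarrow> \<infinity>)"

definition lower_exponent :: "(real \<Rightarrow> enat) \<Rightarrow> ereal" where
  "lower_exponent N = Liminf at_top (\<lambda>x. eln (N x) / ereal (ln x))"

definition upper_exponent :: "(real \<Rightarrow> enat) \<Rightarrow> ereal" where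
  "upper_exponent N = Limsup at_top (\<lambda>x. eln (N x) / ereal (ln x))"


section \<open>Spectral dimensions\<close>

definition square_integrable :: "(real \<Rightarrow> real) \<Rightarrow> bool" where
  "square_integrable g \<longleftrightarrow>
     set_borel_measurable lborel {0..1} g \<and> set_integrable lborel {0..1} (\<lambda>t. (g t)\<^sup>2)"

definition is_gradient :: "(real \<Rightarrow> real) \<Rightarrow> (real \<Rightarrow> real) \<Rightarrow> bool" where
  "is_gradient f g \<longleftrightarrow>
     square_integrable g \<and> (\<forall>x\<in>{0..1}. f x = (LINT t:{0..x}|lborel. g t))"

text \<open>
  A function on the closed unit interval is represented by its extension by zero to the real line,
  so that distinct representatives are distinct functions and the usual pointwise vector space
  structure can be used.
\<close>

definition H01 :: "(real \<Rightarrow> real) set" where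
  "H01 = {f. (\<exists>g. is_gradient f g) \<and> f 0 = 0 \<and> f 1 = 0 \<and> (\<forall>x. x \<notin> {0..1} \<longrightarrow> f x = 0)}"

text \<open>The gradient of an element of \<^term>\<open>H01\<close> is unique only almost everywhere.\<close>

definition gradient :: "(real \<Rightarrow> real) \<Rightarrow> real \<Rightarrow> real" where
  "gradient f = (SOME g. is_gradient f g)"

definition measure_supp :: "real measure \<Rightarrow> real set" where
  "measure_supp \<nu> = {x\<in>{0..1}. \<forall>U. open U \<and> x \<in> U \<longrightarrow> emeasure \<nu> U > 0}"

definition C_nu :: "real measure \<Rightarrow> (real \<Rightarrow> real) set" where
  "C_nu \<nu> = {f. continuous_on {0..1} f \<and>
     (\<forall>K\<in>components ({0..1} - measure_supp \<nu>). \<exists>a b. \<forall>x\<in>K. f x = a * x + b)}"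

definition dom_form :: "real measure \<Rightarrow> (real \<Rightarrow> real) set" where
  "dom_form \<nu> = H01 \<inter> C_nu \<nu>"

text \<open>The measure \<open>\<nu>\<close> enters the form only through its domain \<^term>\<open>dom_form \<nu>\<close>.\<close>

definition energy_form :: "(real \<Rightarrow> real) \<Rightarrow> (real \<Rightarrow> real) \<Rightarrow> real" where
  "energy_form f g = (LINT t:{0<..<1}|lborel. gradient f t * gradient g t)"

definition eigenspace :: "real measure \<Rightarrow> real \<Rightarrow> (real \<Rightarrow> real) set" where
  "eigenspace \<nu> \<mu> =
     {f \<in> dom_form \<nu>. \<forall>g\<in>dom_form \<nu>. energy_form f g = \<mu> * (LINT x:{0..1}|\<nu>. f x * g x)}"

definition is_eigenvalue :: "real measure \<Rightarrow> real \<Rightarrow> bool" where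
  "is_eigenvalue \<nu> \<mu> \<longleftrightarrow> (\<exists>f\<in>eigenspace \<nu> \<mu>. f \<noteq> 0)"

global_interpretation real_fun: vector_space "\<lambda>(c::real) (f::real \<Rightarrow> real) x. c * f x"
  by unfold_locales (auto simp: fun_eq_iff algebra_simps)

text \<open>
  The library dimension of an infinite-dimensional space is a conventional value, so that
  case is separated out.
\<close>

definition multiplicity_eigen :: "real measure \<Rightarrow> real \<Rightarrow> enat" where
  "multiplicity_eigen \<nu> \<mu> =
     (if \<exists>B. finite B \<and> eigenspace \<nu> \<mu> \<subseteq> real_fun.span B
      then enat (real_fun.dim (eigenspace \<nu> \<mu>)) else \<infinity>)"

definition eigenvalue_count :: "real measure \<Rightarrow> real \<Rightarrow> enat" where
  "eigenvalue_count \<nu> x = (\<Sum>\<^sub>\<infinity>\<mu>\<in>{\<mu>. is_eigenvalue \<nu> \<mu> \<and> \<mu> \<le> x}. multiplicity_eigen \<nu> \<mu>)"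

definition lower_spectral_dim :: "real measure \<Rightarrow> ereal" where
  "lower_spectral_dim \<nu> = lower_exponent (eigenvalue_count \<nu>)"

definition upper_spectral_dim :: "real measure \<Rightarrow> ereal" where
  "upper_spectral_dim \<nu> = upper_exponent (eigenvalue_count \<nu>)"

definition has_spectral_dim :: "real measure \<Rightarrow> ereal \<Rightarrow> bool" where
  "has_spectral_dim \<nu> s \<longleftrightarrow> lower_spectral_dim \<nu> = s \<and> upper_spectral_dim \<nu> = s"


section \<open>Regularity\<close>

definition nu_partitions :: "real measure \<Rightarrow> real set set set" where
  "nu_partitions \<nu> = {P. \<exists>(n::nat) c. n \<ge> 2 \<and> c 1 = 0 \<and> c n = 1 \<and>
     (\<forall>k\<in>{1..<n}. c k < c (k + 1)) \<and> (\<forall>k\<in>{1..n}. measure \<nu> {c k} = 0) \<and>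
     P = (\<lambda>k. {c k<..c (k + 1)}) ` {1..<n}}"

definition N_R :: "real measure \<Rightarrow> real \<Rightarrow> enat" where
  "N_R \<nu> x =
     (INF P\<in>{P\<in>nu_partitions \<nu>. \<forall>C\<in>P. measure \<nu> C * measure lborel C < 1 / x}. enat (card P))"

definition upper_h :: "real measure \<Rightarrow> ereal" where
  "upper_h \<nu> = upper_exponent (N_R \<nu>)"

definition interval_families :: "real measure \<Rightarrow> real set set set" where
  "interval_families \<nu> = {P. finite P \<and> disjoint P \<and>
     (\<forall>C\<in>P. is_interval C \<and> C \<noteq> {} \<and> C \<subseteq> {0..1} \<and> measure \<nu> {Inf C} = 0 \<and> measure \<nu> {Sup C} = 0)}"

text \<open>
  The homothety about the midpoint of a nonempty bounded interval preserves the midpoint, divides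
  the length by \<open>m\<close>, and keeps the type (open, closed or half-open) of the interval.
\<close>

definition shrink :: "real \<Rightarrow> real set \<Rightarrow> real set" where
  "shrink m C = (let z = (Inf C + Sup C) / 2 in (\<lambda>t. z + (t - z) / m) ` C)"

text \<open>The empty family is admissible in the supremum: a minimum over it is read as infinite.\<close>

definition N_L :: "real measure \<Rightarrow> real \<Rightarrow> real \<Rightarrow> enat" where
  "N_L \<nu> m x =
     (SUP P\<in>{P\<in>interval_families \<nu>.
        \<forall>C\<in>P. measure \<nu> (shrink m C) * measure lborel (shrink m C) \<ge> 4 / (x * (m - 1))}.
      enat (card P))"

definition lower_h :: "real measure \<Rightarrow> real \<Rightarrow> ereal" where
  "lower_h \<nu> m = lower_exponent (N_L \<nu> m)"

definition regular_measure :: "real measure \<Rightarrow> bool" where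
  "regular_measure \<nu> \<longleftrightarrow> (SUP m\<in>{1<..}. lower_h \<nu> m) = upper_h \<nu>"

end

theory Submission
  imports Defs "HOL-Complex_Analysis.Great_Picard"
begin

text \<open>
  By the min-max principle the eigenvalue count at \<open>x\<close> is the largest dimension of a space of
  functions in \<^term>\<open>H01\<close> whose energy is at most \<open>x\<close> times their \<open>\<nu>\<close>-mass; restricting to the form
  domain costs nothing, since replacing a function by its affine interpolation off the support
  decreases the energy and keeps the mass. Hence the count is monotone in \<open>\<nu>\<close> and
  \<open>N\<^bsub>\<nu>1 + \<nu>2\<^esub>(x) \<le> N\<^bsub>\<nu>1\<^esub>(2x) + N\<^bsub>\<nu>2\<^esub>(2x)\<close>, which gives the two claims on spectral dimensions.

  For regularity one needs that the upper spectral dimension equals the upper partition entropy.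
  Functions vanishing at the points of an admissible partition have large energy, so
  \<open>N\<^sub>\<nu>(x)\<close> is bounded by the size of the partition. Conversely, adjacent cells of a minimal partition
  merge into blocks \<open>D\<close> with \<open>\<nu>(D) \<Lambda>(D) \<ge> 1/x\<close>. Block lengths lie between \<open>c/x\<close> and \<open>1\<close>, so passing
  repeatedly to a neighbour shorter by a factor \<open>x\<^sup>-\<^sup>\<epsilon>\<close> stops after about \<open>1/\<epsilon>\<close> steps; a positive
  proportion of the blocks therefore has neighbours long enough to carry a trapezoidal bump
  of energy at most \<open>2 x\<^sup>1\<^sup>+\<^sup>\<epsilon>\<close> times its mass.
\<close>

section \<open>Square-integrable gradients\<close>

text \<open>No spectral theorem is invoked. Every orthonormal system of eigenfunctions is bounded in
  size by the count, so a finite count allows a system of maximal size; maximising the mass on its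
  complement would yield one more eigenfunction unless the energy exceeds \<open>x\<close> times the
  mass there. Both halves of min-max then reduce to linear algebra with finite families. For a sum
  of measures the gaps at \<open>2 * x\<close> are added, and constant factors in \<open>x\<close>
  disappear in the quotient of logarithms.

  Regularity compares \<open>lower_h\<close> with \<open>upper_h\<close>, whereas the other
  hypotheses only order spectral dimensions; the equality of \<open>upper_h\<close> with the upper
  spectral dimension carries the maximum formula over to \<open>upper_h\<close>. For
  \<open>lower_h\<close> the comparison is direct: an interval heavy for one summand is heavy for
  the sum. The obstacle is that its endpoints may be atoms of the other summand, so the intervals
  and the ratio \<open>m\<close> must change, which the supremum over \<open>m\<close>
  permits.\<close>

abbreviation energy :: "(real \<Rightarrow> real) \<Rightarrow> real" where
  "energy f \<equiv> energy_form f f"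

text \<open>Measurability and vanishing on the whole line turn set integrals over subintervals into
  plain integrals and let gradients be cut and combined without side conditions.\<close>

definition L2I :: "(real \<Rightarrow> real) set" where
  "L2I = {g. g \<in> borel_measurable lborel \<and> integrable lborel (\<lambda>t. (g t)\<^sup>2) \<and>
     (\<forall>t. t \<notin> {0..1} \<longrightarrow> g t = 0)}"

lemma L2I_measurable: "g \<in> L2I \<Longrightarrow> g \<in> borel_measurable borel"
  by (simp add: L2I_def)

lemma L2I_square: "g \<in> L2I \<Longrightarrow> integrable lborel (\<lambda>t. (g t)\<^sup>2)"
  by (simp add: L2I_def)

lemma L2I_outside: "g \<in> L2I \<Longrightarrow> t \<notin> {0..1} \<Longrightarrow> g t = 0"
  by (simp add: L2I_def)

text \<open>Since \<open>\<bar>g t\<bar> \<le> 1 + (g t)\<^sup>2\<close> on the unit interval and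
  \<open>g\<close> vanishes elsewhere, a dominating function is at hand.\<close>

lemma L2I_integrable:
  assumes "g \<in> L2I"
  shows "integrable lborel g"
proof (rule Bochner_Integration.integrable_bound)
  show "integrable lborel (\<lambda>t. indicator {0..1::real} t + (g t)\<^sup>2)"
    using L2I_square[OF assms] by (intro Bochner_Integration.integrable_add) auto
  show "g \<in> borel_measurable lborel"
    using L2I_measurable[OF assms] by simp
  have "\<bar>g t\<bar> \<le> indicator {0..1::real} t + (g t)\<^sup>2" for t
  proof (cases "t \<in> {0..1}")
    case True
    have "0 \<le> (\<bar>g t\<bar> - 1)\<^sup>2 + \<bar>g t\<bar>"
      by simp
    then show ?thesis
      using True by (simp add: power2_eq_square algebra_simps)
  qed (simp add: L2I_outside[OF assms])
  then show "AE t in lborel. norm (g t) \<le> norm (indicator {0..1::real} t + (g t)\<^sup>2)"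
    by (auto intro: order_trans[OF _ abs_ge_self])
qed

lemma L2I_mult_integrable:
  assumes "g \<in> L2I" "h \<in> L2I"
  shows "integrable lborel (\<lambda>t. g t * h t)"
proof (rule Bochner_Integration.integrable_bound)
  show "integrable lborel (\<lambda>t. (g t)\<^sup>2 + (h t)\<^sup>2)"
    using L2I_square assms by (intro Bochner_Integration.integrable_add) auto
  have [measurable]: "g \<in> borel_measurable borel" "h \<in> borel_measurable borel"
    using L2I_measurable assms by auto
  show "(\<lambda>t. g t * h t) \<in> borel_measurable lborel"
    by simp
  have "\<bar>g t * h t\<bar> \<le> (g t)\<^sup>2 + (h t)\<^sup>2" for t
  proof -
    have "0 \<le> (\<bar>g t\<bar> - \<bar>h t\<bar>)\<^sup>2 + \<bar>g t\<bar> * \<bar>h t\<bar>"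
      by simp
    then show ?thesis
      by (simp add: power2_eq_square algebra_simps abs_mult)
  qed
  then show "AE t in lborel. norm (g t * h t) \<le> norm ((g t)\<^sup>2 + (h t)\<^sup>2)"
    by (auto intro: order_trans[OF _ abs_ge_self])
qed

lemma L2I_lincomb:
  assumes "g \<in> L2I" "h \<in> L2I"
  shows "(\<lambda>t. a * g t + b * h t) \<in> L2I"
proof -
  have [measurable]: "g \<in> borel_measurable borel" "h \<in> borel_measurable borel"
    using L2I_measurable assms by auto
  have "integrable lborel (\<lambda>t. a\<^sup>2 * (g t)\<^sup>2 + 2 * a * b * (g t * h t) + b\<^sup>2 * (h t)\<^sup>2)"
    using L2I_square assms L2I_mult_integrable
    by (intro Bochner_Integration.integrable_add Bochner_Integration.integrable_mult_right) auto
  then have "integrable lborel (\<lambda>t. (a * g t + b * h t)\<^sup>2)"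
    by (rule Bochner_Integration.integrable_cong[THEN iffD1, rotated -1])
      (auto simp: power2_eq_square algebra_simps)
  then show ?thesis
    using assms by (auto simp: L2I_def)
qed

lemma L2I_restrict:
  assumes "g \<in> L2I" "A \<in> sets borel"
  shows "(\<lambda>t. indicator A t * g t) \<in> L2I"
proof -
  have "integrable lborel (\<lambda>t. indicator A t *\<^sub>R (g t)\<^sup>2)"
    using assms L2I_square by (intro integrable_mult_indicator) auto
  then have "integrable lborel (\<lambda>t. (indicator A t * g t)\<^sup>2)"
    by (rule Bochner_Integration.integrable_cong[THEN iffD1, rotated -1])
      (auto simp: indicator_def)
  then show ?thesis
    using assms by (auto simp: L2I_def)
qed

lemma L2I_indicator:
  assumes "{a..b} \<subseteq> {0..1}"
  shows "(\<lambda>t. c * indicator {a..b} t) \<in> L2I"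
proof -
  have "integrable lborel (indicat_real {a..b})"
    by (rule integrable_real_indicator) (auto simp: emeasure_lborel_Icc_eq)
  then have "integrable lborel (\<lambda>t. c\<^sup>2 * indicator {a..b} t)"
    by simp
  then have "integrable lborel (\<lambda>t. (c * indicator {a..b} t)\<^sup>2)"
    by (rule Bochner_Integration.integrable_cong[THEN iffD1, rotated -1])
      (auto simp: indicator_def)
  then show ?thesis
    using assms by (auto simp: L2I_def indicator_def)
qed

section \<open>Integrals over adjacent intervals and over half-lines\<close>

lemma set_integral_singleton: "(LINT t:{a..a}|lborel. g t) = (0::real)" for a :: real
  unfolding set_lebesgue_integral_def
  by (rule integral_eq_zero_AE) (use AE_lborel_singleton[of a] in \<open>eventually_elim, auto\<close>)

lemma set_integral_split:
  assumes "integrable lborel (g :: real \<Rightarrow> real)" "a \<le> b" "b \<le> c"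
  shows "(LINT u:{a..c}|lborel. g u) = (LINT u:{a..b}|lborel. g u) + (LINT u:{b..c}|lborel. g u)"
proof -
  have i: "set_integrable lborel A g" if "A \<in> sets borel" for A
    using integrable_mult_indicator[of A lborel g] assms(1) that by (simp add: set_integrable_def)
  have "(LINT u:{a..c}|lborel. g u) = (LINT u:{a..b} \<union> {b..c}|lborel. g u)"
    using assms by (simp add: ivl_disj_un_two_touch)
  also have "\<dots> = (LINT u:{a..b}|lborel. g u) + (LINT u:{b..c}|lborel. g u)"
  proof (rule set_integral_Un_AE)
    show "AE x in lborel. \<not> (x \<in> {a..b} \<and> x \<in> {b..c})"
      using AE_lborel_singleton[of b] by eventually_elim auto
  qed (auto intro: i)
  finally show ?thesis .
qed

text \<open>Half-lines are stable under intersection and generate the Borel sets, so a Dynkin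
  argument extends the vanishing to all Borel sets. The complement step needs the integral over the
  whole line, which is the limit over \<open>{..real n}\<close>.\<close>

lemma AE_zero_if_interval_integrals_zero:
  assumes int: "integrable lborel (g :: real \<Rightarrow> real)"
    and zero: "\<And>x. (LINT t:{..x}|lborel. g t) = 0"
  shows "AE t in lborel. g t = 0"
proof (rule density_unique_real[OF int])
  show "integrable lborel (\<lambda>t. 0 :: real)" by simp
  have si: "set_integrable lborel A g" if "A \<in> sets borel" for A
    using integrable_mult_indicator[of A lborel g] int that by (simp add: set_integrable_def)
  have all: "(LINT t|lborel. g t) = 0"
  proof -
    have "((\<lambda>n. LINT t:{..real n}|lborel. g t) \<longlonglongrightarrow> (LINT t:(\<Union>n. {..real n})|lborel. g t))"
      by (rule set_integral_cont_up) (auto simp: incseq_def si)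
    moreover have "(\<Union>n. {..real n}) = UNIV"
      using real_arch_simple by auto
    ultimately have "(LINT t:UNIV|lborel. g t) = 0"
      by (simp add: zero LIMSEQ_const_iff)
    then show ?thesis
      by (simp add: set_lebesgue_integral_def)
  qed
  have stable: "Int_stable (range (\<lambda>x::real. {..x}))"
    by (auto simp: Int_stable_def)
  have pow: "range (\<lambda>x::real. {..x}) \<subseteq> Pow UNIV"
    by simp
  fix A :: "real set" assume "A \<in> sets lborel"
  then have "A \<in> sigma_sets UNIV (range (\<lambda>x::real. {..x}))"
    using sets_lborel by (simp add: borel_eq_atMost)
  then have "(LINT t:A|lborel. g t) = 0"
  proof (induction rule: sigma_sets_induct_disjoint[OF stable pow, consumes 1, case_names basic empty compl union])
    case (basic A) then show ?case using zero by auto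
  next
    case empty then show ?case by (simp add: set_lebesgue_integral_def)
  next
    case (compl A)
    then have A: "A \<in> sets borel"
      by (simp add: borel_eq_atMost)
    have "(LINT t:A \<union> (UNIV - A)|lborel. g t) = (LINT t:A|lborel. g t) + (LINT t:UNIV - A|lborel. g t)"
      using A by (intro set_integral_Un si) auto
    then show ?case
      using compl all by (simp add: set_lebesgue_integral_def)
  next
    case (union A)
    then have A: "A i \<in> sets borel" for i
      using union(2) by (auto simp: borel_eq_atMost)
    have "(LINT t:(\<Union>i. A i)|lborel. g t) = (\<Sum>i. LINT t:A i|lborel. g t)"
      using A union(1) by (intro lebesgue_integral_countable_add si) (auto simp: disjoint_family_on_def)
    then show ?case
      using union by simp
  qed
  then show "(LINT t:A|lborel. g t) = (LINT t:A|lborel. 0)"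
    by (simp add: set_lebesgue_integral_def)
qed

text \<open>Cutting the primitive off outside \<open>{0..1}\<close> matches the zero extension in
  \<open>H01\<close>, so that equality of functions is literal.\<close>

definition prim :: "(real \<Rightarrow> real) \<Rightarrow> real \<Rightarrow> real" where
  "prim g x = (if x \<in> {0..1} then LINT t:{0..x}|lborel. g t else 0)"

lemma L2I_set_integrable: "g \<in> L2I \<Longrightarrow> A \<in> sets borel \<Longrightarrow> set_integrable lborel A g"
  using integrable_mult_indicator[of A lborel g] L2I_integrable by (simp add: set_integrable_def)

lemma prim_1: 
  assumes "g \<in> L2I" shows "prim g 1 = (LINT t|lborel. g t)"
proof -
  have "indicator {0..1} t * g t = g t" for t
    using L2I_outside[OF assms, of t] by (cases "t \<in> {0..1}") auto
  then show ?thesis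
    by (simp only: set_lebesgue_integral_def real_scaleR_def prim_def) simp
qed

lemma prim_lincomb:
  assumes "g \<in> L2I" "h \<in> L2I"
  shows "prim (\<lambda>t. a * g t + b * h t) = (\<lambda>x. a * prim g x + b * prim h x)"
proof
  fix x
  have "set_integrable lborel {0..x} (\<lambda>t. a * g t)" "set_integrable lborel {0..x} (\<lambda>t. b * h t)"
    by (intro set_integrable_mult_right L2I_set_integrable assms; simp)+
  then show "prim (\<lambda>t. a * g t + b * h t) x = a * prim g x + b * prim h x"
    by (simp add: prim_def set_integral_add)
qed

text \<open>This makes the choice in \<open>gradient\<close> harmless: a primitive determines its
  integrand almost everywhere. Half-line integrals of the difference are values of its primitive,
  hence zero.\<close>

lemma prim_inj_AE:
  assumes g: "g \<in> L2I" and h: "h \<in> L2I" and eq: "\<And>x. x \<in> {0..1} \<Longrightarrow> prim g x = prim h x"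
  shows "AE t in lborel. g t = h t"
proof -
  define k where "k = (\<lambda>t. 1 * g t + (-1) * h t)"
  have k: "k \<in> L2I"
    unfolding k_def by (rule L2I_lincomb[OF g h])
  have pk: "prim k x = 0" for x
    unfolding k_def prim_lincomb[OF g h] using eq[of x] by (auto simp: prim_def)
  have "AE t in lborel. k t = 0"
  proof (rule AE_zero_if_interval_integrals_zero[OF L2I_integrable[OF k]])
    fix x
    show "(LINT t:{..x}|lborel. k t) = 0"
    proof (cases "x < 0")
      case True
      then have "indicator {..x} t * k t = 0" for t
        using L2I_outside[OF k, of t] by (cases "t \<in> {0..1}") auto
      then show ?thesis by (simp only: set_lebesgue_integral_def real_scaleR_def integral_zero)
    next
      case False
      then have "indicator {..x} t * k t = indicator {0..min x 1} t * k t" for t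
        using L2I_outside[OF k, of t] by (cases "t \<in> {0..1}") (auto simp: indicator_def)
      then have "(LINT t:{..x}|lborel. k t) = prim k (min x 1)"
        using False by (simp only: set_lebesgue_integral_def real_scaleR_def prim_def) simp
      then show ?thesis by (simp add: pk)
    qed
  qed
  then show ?thesis
    by (simp add: k_def)
qed

text \<open>\<open>is_gradient\<close> constrains its second argument only on the unit interval;
  truncation moves it into \<open>L2I\<close> and leaves the primitive unchanged.\<close>

lemma is_gradient_restrict:
  assumes "is_gradient f g"
  shows "(\<lambda>t. indicator {0..1} t * g t) \<in> L2I"
    and "x \<in> {0..1} \<Longrightarrow> f x = prim (\<lambda>t. indicator {0..1} t * g t) x"
proof -
  have "integrable lborel (\<lambda>t. indicator {0..1} t *\<^sub>R (g t)\<^sup>2)"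
    using assms by (simp add: is_gradient_def square_integrable_def set_integrable_def)
  then have "integrable lborel (\<lambda>t. (indicator {0..1} t * g t)\<^sup>2)"
    by (rule Bochner_Integration.integrable_cong[THEN iffD1, rotated -1])
      (auto simp: indicator_def)
  then show "(\<lambda>t. indicator {0..1} t * g t) \<in> L2I"
    using assms by (simp add: L2I_def is_gradient_def square_integrable_def set_borel_measurable_def)
  assume x: "x \<in> {0..1}"
  then have "f x = (LINT t:{0..x}|lborel. g t)"
    using assms by (simp add: is_gradient_def)
  also have "\<dots> = (LINT t:{0..x}|lborel. indicator {0..1} t * g t)"
    unfolding set_lebesgue_integral_def
    using x by (intro Bochner_Integration.integral_cong) (auto simp: indicator_def)
  finally show "f x = prim (\<lambda>t. indicator {0..1} t * g t) x"
    using x by (simp add: prim_def)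
qed

lemma is_gradient_prim:
  assumes "g \<in> L2I"
  shows "is_gradient (prim g) g"
  unfolding is_gradient_def square_integrable_def set_borel_measurable_def set_integrable_def
  using L2I_measurable[OF assms] integrable_mult_indicator[OF _ L2I_square[OF assms], of "{0..1}"]
  by (simp add: prim_def)

section \<open>The energy space\<close>

text \<open>Mean zero is the boundary condition at 1 read on the gradient; the one at 0 holds for
  every primitive.\<close>

definition L2Z :: "(real \<Rightarrow> real) set" where
  "L2Z = {g \<in> L2I. (LINT t|lborel. g t) = 0}"

lemma L2Z_L2I: "g \<in> L2Z \<Longrightarrow> g \<in> L2I"
  by (simp add: L2Z_def)

lemma L2Z_lincomb:
  assumes "g \<in> L2Z" "h \<in> L2Z"
  shows "(\<lambda>t. a * g t + b * h t) \<in> L2Z"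
proof -
  have "integrable lborel g" "integrable lborel h"
    using assms L2I_integrable by (auto simp: L2Z_def)
  then have "(LINT t|lborel. a * g t + b * h t) = a * (LINT t|lborel. g t) + b * (LINT t|lborel. h t)"
    by simp
  then show ?thesis
    using assms L2I_lincomb[of g h a b] by (simp add: L2Z_def)
qed

lemma prim_outside: "x \<notin> {0<..<1} \<Longrightarrow> g \<in> L2Z \<Longrightarrow> prim g x = 0"
proof -
  assume x: "x \<notin> {0<..<1}" and g: "g \<in> L2Z"
  have "prim g 0 = 0"
  proof -
    show ?thesis using set_integral_singleton[of 0 g] by (simp add: prim_def)
  qed
  moreover have "prim g 1 = 0"
    using g prim_1 by (simp add: L2Z_def)
  moreover have "x = 0 \<or> x = 1 \<or> x \<notin> {0..1}"
    using x by auto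
  ultimately show "prim g x = 0"
    by (auto simp: prim_def)
qed

lemma H01_eq: "H01 = prim ` L2Z"
proof (intro set_eqI iffI)
  fix f assume "f \<in> H01"
  then obtain g where g: "is_gradient f g" and f: "f 0 = 0" "f 1 = 0" "\<And>x. x \<notin> {0..1} \<Longrightarrow> f x = 0"
    by (auto simp: H01_def)
  define G where "G = (\<lambda>t. indicator {0..1} t * g t)"
  have G: "G \<in> L2I" and fG: "x \<in> {0..1} \<Longrightarrow> f x = prim G x" for x
    using is_gradient_restrict[OF g] by (auto simp: G_def)
  have "f = prim G"
    using fG f(3) by (auto simp: fun_eq_iff prim_def)
  moreover have "G \<in> L2Z"
    using G prim_1[OF G] fG[of 1] f by (simp add: L2Z_def)
  ultimately show "f \<in> prim ` L2Z" by blast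
next
  fix f assume "f \<in> prim ` L2Z"
  then obtain g where g: "g \<in> L2Z" "f = prim g" by auto
  then show "f \<in> H01"
    using is_gradient_prim[OF L2Z_L2I[OF g(1)]] prim_outside[OF _ g(1)]
    by (auto simp: H01_def)
qed

lemma H01E:
  assumes "f \<in> H01"
  obtains g where "g \<in> L2Z" "f = prim g"
  using assms by (auto simp: H01_eq)

text \<open>The energy becomes an inner product of explicit gradients. The chosen gradient agrees
  with the given one almost everywhere, and the endpoints missing from \<open>{0<..<1}\<close> form
  a null set.\<close>

lemma energy_prim:
  assumes "g \<in> L2I" "h \<in> L2I"
  shows "energy_form (prim g) (prim h) = (LINT t|lborel. g t * h t)"
proof -
  have *: "AE t in lborel. t \<in> {0<..<1} \<longrightarrow> gradient (prim k) t = k t" 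
      "(\<lambda>t. indicator {0..1} t * gradient (prim k) t) \<in> L2I" if k: "k \<in> L2I" for k
  proof -
    have gr: "is_gradient (prim k) (gradient (prim k))"
      unfolding gradient_def by (rule someI[of _ k]) (rule is_gradient_prim[OF k])
    note 1 = is_gradient_restrict[OF gr]
    show "(\<lambda>t. indicator {0..1} t * gradient (prim k) t) \<in> L2I" by (rule 1(1))
    have "AE t in lborel. k t = indicator {0..1} t * gradient (prim k) t"
      by (rule prim_inj_AE[OF k 1(1) 1(2)])
    then show "AE t in lborel. t \<in> {0<..<1} \<longrightarrow> gradient (prim k) t = k t"
      by eventually_elim auto
  qed
  define Dg where "Dg = (\<lambda>t. indicator {0..1} t * gradient (prim g) t)"
  define Dh where "Dh = (\<lambda>t. indicator {0..1} t * gradient (prim h) t)"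
  have [measurable]: "Dg \<in> borel_measurable borel" "Dh \<in> borel_measurable borel"
      "g \<in> borel_measurable borel" "h \<in> borel_measurable borel"
    using * assms L2I_measurable by (auto simp: Dg_def Dh_def)
  have "energy_form (prim g) (prim h) = (LINT t|lborel. indicator {0<..<1} t * (Dg t * Dh t))"
    unfolding energy_form_def set_lebesgue_integral_def
    by (intro Bochner_Integration.integral_cong) (auto simp: indicator_def Dg_def Dh_def)
  also have "\<dots> = (LINT t|lborel. g t * h t)"
  proof (rule integral_cong_AE)
    have "AE t in lborel. t \<noteq> (0::real)" "AE t in lborel. t \<noteq> (1::real)"
      by (simp_all add: AE_lborel_singleton)
    then show "AE t in lborel. indicator {0<..<1} t * (Dg t * Dh t) = g t * h t"
      using *(1)[OF assms(1)] *(1)[OF assms(2)]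
      by eventually_elim
        (use L2I_outside[OF assms(1)] in \<open>auto simp: Dg_def Dh_def indicator_def\<close>)
  qed auto
  finally show ?thesis .
qed

section \<open>The energy as a bilinear form on \<open>H01\<close>\<close>

lemma H01_lincomb: "f \<in> H01 \<Longrightarrow> g \<in> H01 \<Longrightarrow> (\<lambda>x. a * f x + b * g x) \<in> H01"
proof (elim H01E)
  fix u v assume "u \<in> L2Z" "f = prim u" "v \<in> L2Z" "g = prim v"
  then show ?thesis
    using prim_lincomb[of u v a b] L2Z_lincomb[of u v a b] L2Z_L2I
    by (metis H01_eq image_eqI)
qed

lemma H01_zero: "(\<lambda>x. 0) \<in> H01"
proof -
  have "(\<lambda>t. 0) \<in> L2Z" by (simp add: L2Z_def L2I_def)
  moreover have "prim (\<lambda>t. 0) = (\<lambda>x. 0)" by (auto simp: prim_def set_lebesgue_integral_def)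
  ultimately show ?thesis unfolding H01_eq by force
qed

lemma H01_sum: "(\<And>i. i \<in> I \<Longrightarrow> f i \<in> H01) \<Longrightarrow> (\<lambda>x. \<Sum>i\<in>I. c i * f i x) \<in> H01"
proof (induction I rule: infinite_finite_induct)
  case (insert i I)
  then show ?case
    using H01_lincomb[of "f i" "\<lambda>x. \<Sum>i\<in>I. c i * f i x" "c i" 1] by simp
qed (auto intro: H01_zero)

lemma energy_sym: "energy_form f g = energy_form g f"
  by (simp add: energy_form_def mult.commute)

lemma energy_nonneg: "energy f \<ge> 0"
  unfolding energy_form_def set_lebesgue_integral_def
  by (intro Bochner_Integration.integral_nonneg) auto

lemma energy_lincomb:
  assumes "f \<in> H01" "g \<in> H01" "h \<in> H01"
  shows "energy_form (\<lambda>x. a * f x + b * g x) h = a * energy_form f h + b * energy_form g h"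
proof -
  obtain u v w where u: "u \<in> L2I" "f = prim u" and v: "v \<in> L2I" "g = prim v" and w: "w \<in> L2I" "h = prim w"
    using assms H01E L2Z_L2I by metis
  have i: "integrable lborel (\<lambda>t. u t * w t)" "integrable lborel (\<lambda>t. v t * w t)"
    using u v w by (auto intro: L2I_mult_integrable)
  have "energy_form (\<lambda>x. a * f x + b * g x) h = (LINT t|lborel. (a * u t + b * v t) * w t)"
    unfolding u v w prim_lincomb[OF u(1) v(1), symmetric]
    by (rule energy_prim[OF L2I_lincomb[OF u(1) v(1)] w(1)])
  also have "\<dots> = (LINT t|lborel. a * (u t * w t) + b * (v t * w t))"
    by (intro Bochner_Integration.integral_cong) (auto simp: algebra_simps)
  also have "\<dots> = a * energy_form f h + b * energy_form g h"
    using i by (simp add: u v w energy_prim)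
  finally show ?thesis .
qed

lemma energy_lincomb_right:
  assumes "f \<in> H01" "g \<in> H01" "h \<in> H01"
  shows "energy_form h (\<lambda>x. a * f x + b * g x) = a * energy_form h f + b * energy_form h g"
  using energy_lincomb[OF assms, of a b] by (simp add: energy_sym)

lemma energy_lincomb_square:
  assumes "f \<in> H01" "g \<in> H01"
  shows "energy (\<lambda>x. a * f x + b * g x) =
    a\<^sup>2 * energy f + 2 * a * b * energy_form f g + b\<^sup>2 * energy g"
  by (simp add: energy_lincomb energy_lincomb_right H01_lincomb assms energy_sym[of g f]
      power2_eq_square algebra_simps)

lemma energy_sum:
  assumes "\<And>i. i \<in> I \<Longrightarrow> f i \<in> H01" "h \<in> H01"
  shows "energy_form (\<lambda>x. \<Sum>i\<in>I. c i * f i x) h = (\<Sum>i\<in>I. c i * energy_form (f i) h)"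
  using assms(1)
proof (induction I rule: infinite_finite_induct)
  case (insert i I)
  then show ?case
    using energy_lincomb[of "f i" "\<lambda>x. \<Sum>i\<in>I. c i * f i x" h "c i" 1] assms(2)
    by (simp add: H01_sum)
qed (use energy_lincomb[OF H01_zero H01_zero assms(2), of 0 0] in auto)

section \<open>Cauchy-Schwarz and Hoelder continuity\<close>

lemma set_integral_square_deviation:
  assumes "g \<in> L2I" "s < t"
  defines "a \<equiv> (LINT u:{s..t}|lborel. g u) / (t - s)"
  shows "(LINT u|lborel. (indicator {s..t} u * (g u - a))\<^sup>2) =
    (LINT u:{s..t}|lborel. (g u)\<^sup>2) - (LINT u:{s..t}|lborel. g u)\<^sup>2 / (t - s)"
proof -
  have i1: "integrable lborel (\<lambda>u. indicator {s..t} u * (g u)\<^sup>2)"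
    using integrable_mult_indicator[OF _ L2I_square[OF assms(1)], of "{s..t}"] by simp
  have i2: "integrable lborel (\<lambda>u. indicator {s..t} u * g u)"
    using integrable_mult_indicator[OF _ L2I_integrable[OF assms(1)], of "{s..t}"] by simp
  have i3: "integrable lborel (\<lambda>u. indicator {s..t} u :: real)"
    using assms(2) by (intro integrable_real_indicator) auto
  have "(LINT u|lborel. (indicator {s..t} u * (g u - a))\<^sup>2) =
    (LINT u|lborel. indicator {s..t} u * (g u)\<^sup>2 + (- 2 * a) * (indicator {s..t} u * g u) + a\<^sup>2 * indicator {s..t} u)"
    by (intro Bochner_Integration.integral_cong)
      (auto simp: indicator_def power2_eq_square algebra_simps)
  also have "\<dots> = (LINT u|lborel. indicator {s..t} u * (g u)\<^sup>2)
      + (- 2 * a) * (LINT u|lborel. indicator {s..t} u * g u) + a\<^sup>2 * (LINT u|lborel. indicator {s..t} u)"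
    using i1 i2 i3 by (simp only: Bochner_Integration.integral_add Bochner_Integration.integral_mult_right_zero
       Bochner_Integration.integrable_add Bochner_Integration.integrable_mult_right)
  also have "(LINT u|lborel. indicator {s..t} u :: real) = t - s"
    using assms(2) by simp
  finally have *: "(LINT u|lborel. (indicator {s..t} u * (g u - a))\<^sup>2) =
      (LINT u:{s..t}|lborel. (g u)\<^sup>2) + (- 2 * a) * (LINT u:{s..t}|lborel. g u) + a\<^sup>2 * (t - s)"
    by (simp only: set_lebesgue_integral_def real_scaleR_def)
  \<comment> \<open>With \<open>I\<close> and \<open>J\<close> the integrals of \<open>g\<close> and
    of its square and \<open>d\<close> the length: centring at the mean \<open>I / d\<close> lowers
    the second moment by \<open>I\<^sup>2 / d\<close>.\<close>
  have "J + (- 2 * (I / d)) * I + (I / d)\<^sup>2 * d = J - I\<^sup>2 / d" if "d \<noteq> 0" for I J d :: real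
    using that by (simp add: field_simps power2_eq_square)
  from this[of "t - s"] show ?thesis
    using assms(2) by (subst *) (auto simp only: a_def)
qed

text \<open>The square deviation from the mean slope is non-negative; a degenerate interval is
  treated apart because the mean divides by the length.\<close>

lemma set_integral_cauchy_schwarz:
  assumes "g \<in> L2I" "s \<le> t"
  shows "(LINT u:{s..t}|lborel. g u)\<^sup>2 \<le> (t - s) * (LINT u:{s..t}|lborel. (g u)\<^sup>2)"
proof (cases "s = t")
  case True
  then show ?thesis using set_integral_singleton[of t g] by simp
next
  case False
  then have st: "s < t" using assms by simp
  have "0 \<le> (LINT u:{s..t}|lborel. (g u)\<^sup>2) - (LINT u:{s..t}|lborel. g u)\<^sup>2 / (t - s)"
    unfolding set_integral_square_deviation[OF assms(1) st, symmetric]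
    by (intro Bochner_Integration.integral_nonneg) auto
  then show ?thesis using st by (simp add: field_simps)
qed

lemma prim_diff:
  assumes "g \<in> L2I" "0 \<le> s" "s \<le> t" "t \<le> 1"
  shows "prim g t - prim g s = (LINT u:{s..t}|lborel. g u)"
proof -
  have "(LINT u:{0..t}|lborel. g u) = (LINT u:{0..s}|lborel. g u) + (LINT u:{s..t}|lborel. g u)"
    using assms by (intro set_integral_split L2I_integrable)
  then show ?thesis using assms by (simp add: prim_def)
qed

lemma prim_diff_square:
  assumes "g \<in> L2I" "0 \<le> s" "s \<le> t" "t \<le> 1"
  shows "(prim g t - prim g s)\<^sup>2 \<le> (t - s) * (LINT u:{s..t}|lborel. (g u)\<^sup>2)"
  using set_integral_cauchy_schwarz[of g s t] prim_diff[of g s t] assms by simp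

lemma H01_vanishes: "f \<in> H01 \<Longrightarrow> x \<notin> {0<..<1} \<Longrightarrow> f x = 0"
  by (elim H01E) (simp add: prim_outside)

text \<open>Cauchy-Schwarz for the gradient between the two points. It extends to the whole line
  because clamping to the unit interval changes no value of \<open>f\<close> and shortens
  distances.\<close>

lemma H01_hoelder:
  assumes "f \<in> H01"
  shows "(f s - f t)\<^sup>2 \<le> \<bar>s - t\<bar> * energy f"
proof -
  obtain g where g: "g \<in> L2Z" "f = prim g" using assms by (rule H01E)
  have E: "energy f = (LINT u|lborel. (g u)\<^sup>2)"
    using g L2Z_L2I by (simp add: energy_prim power2_eq_square)
  have in01: "(f t - f s)\<^sup>2 \<le> (t - s) * energy f" if "0 \<le> s" "s \<le> t" "t \<le> 1" for s t
  proof -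
    have "(LINT u:{s..t}|lborel. (g u)\<^sup>2) \<le> (LINT u|lborel. (g u)\<^sup>2)"
      unfolding set_lebesgue_integral_def
      using L2I_square[OF L2Z_L2I[OF g(1)]]
      by (intro integral_mono integrable_mult_indicator) (auto simp: indicator_def)
    then have "(t - s) * (LINT u:{s..t}|lborel. (g u)\<^sup>2) \<le> (t - s) * energy f"
      using that unfolding E by (intro mult_left_mono) auto
    then show ?thesis
      using prim_diff_square[OF L2Z_L2I[OF g(1)] that] g by simp
  qed
  define c where "c x = min 1 (max 0 x)" for x :: real
  have fc: "f x = f (c x)" for x
    using H01_vanishes[OF assms, of x] H01_vanishes[OF assms, of 0] H01_vanishes[OF assms, of 1]
    by (auto simp: c_def min_def max_def)
  have le: "(f s - f t)\<^sup>2 \<le> (t - s) * energy f" if "s \<le> t" for s t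
  proof -
    have "(f (c t) - f (c s))\<^sup>2 \<le> (c t - c s) * energy f"
      using that by (intro in01) (auto simp: c_def)
    also have "\<dots> \<le> (t - s) * energy f"
      using that by (intro mult_right_mono energy_nonneg) (auto simp: c_def)
    finally show ?thesis
      by (simp add: fc[of s] fc[of t] power2_commute)
  qed
  show ?thesis
    using le[of s t] le[of t s] by (cases "s \<le> t") (auto simp: power2_commute)
qed

lemma H01_continuous:
  assumes "f \<in> H01"
  shows "continuous_on A f"
proof -
  have "isCont f x" for x
  proof -
    have "((\<lambda>t. sqrt (\<bar>t - x\<bar> * energy f)) \<longlongrightarrow> sqrt (\<bar>x - x\<bar> * energy f)) (at x)"
      by (intro tendsto_intros)
    then have lim: "((\<lambda>t. sqrt (\<bar>t - x\<bar> * energy f)) \<longlongrightarrow> 0) (at x)"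
      by simp
    have "\<bar>f t - f x\<bar> \<le> sqrt (\<bar>t - x\<bar> * energy f)" for t
      using H01_hoelder[OF assms, of t x] by (intro real_le_rsqrt) simp
    then have "((\<lambda>t. f t - f x) \<longlongrightarrow> 0) (at x)"
      by (intro Lim_null_comparison[OF _ lim]) auto
    then show ?thesis
      by (simp add: isCont_def LIM_zero_iff)
  qed
  then show ?thesis
    by (simp add: continuous_at_imp_continuous_on)
qed

text \<open>Hoelder continuity measured from the zero at 0. Control of the supremum by the energy
  gives definiteness of the energy, integrability of products for any finite \<nu>, and continuity
  of point evaluations.\<close>

lemma H01_bound:
  assumes "f \<in> H01"
  shows "(f t)\<^sup>2 \<le> energy f"
proof (cases "t \<in> {0<..<1}")
  case True
  have "(f t - f 0)\<^sup>2 \<le> \<bar>t - 0\<bar> * energy f"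
    by (rule H01_hoelder[OF assms])
  also have "\<dots> \<le> 1 * energy f"
    using True by (intro mult_right_mono energy_nonneg) auto
  finally show ?thesis
    using H01_vanishes[OF assms, of 0] by simp
qed (simp add: H01_vanishes[OF assms] energy_nonneg)

lemma energy_eq_0: "f \<in> H01 \<Longrightarrow> energy f \<le> 0 \<Longrightarrow> f = (\<lambda>x. 0)"
  using H01_bound[of f] by (auto simp: fun_eq_iff) (smt (verit) zero_less_power2)

lemma H01_diff: "f \<in> H01 \<Longrightarrow> g \<in> H01 \<Longrightarrow> (\<lambda>x. f x - g x) \<in> H01"
  using H01_lincomb[of f g 1 "-1"] by simp

lemma energy_diff_square:
  assumes "f \<in> H01" "g \<in> H01"
  shows "energy (\<lambda>x. f x - g x) =
    energy f - 2 * energy_form f g + energy g"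
  using energy_lincomb_square[OF assms, of 1 "-1"] by simp

lemma energy_add_square:
  assumes "f \<in> H01" "g \<in> H01"
  shows "energy (\<lambda>x. f x + g x) =
    energy f + 2 * energy_form f g + energy g"
  using energy_lincomb_square[OF assms, of 1 1] by simp

lemma L2I_diff: "g \<in> L2I \<Longrightarrow> h \<in> L2I \<Longrightarrow> (\<lambda>t. g t - h t) \<in> L2I"
  using L2I_lincomb[of g h 1 "-1"] by simp

lemma prim_minus: "g \<in> L2I \<Longrightarrow> h \<in> L2I \<Longrightarrow> prim (\<lambda>t. g t - h t) = (\<lambda>x. prim g x - prim h x)"
  using prim_lincomb[of g h 1 "-1"] by simp

section \<open>Completeness and energy minimisers\<close>

lemma L2I_abs: "g \<in> L2I \<Longrightarrow> (\<lambda>t. \<bar>g t\<bar>) \<in> L2I"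
  by (auto simp: L2I_def)

lemma L2I_integral_01: "g \<in> L2I \<Longrightarrow> (LINT t:{0..1}|lborel. g t) = (LINT t|lborel. g t)"
  using prim_1[of g] by (simp add: prim_def)

lemma L2I_integral_square_le:
  assumes "g \<in> L2I"
  shows "(LINT t|lborel. g t)\<^sup>2 \<le> (LINT t|lborel. (g t)\<^sup>2)"
proof -
  have "(LINT t:{0..1}|lborel. (g t)\<^sup>2) \<le> (LINT t|lborel. (g t)\<^sup>2)"
    unfolding set_lebesgue_integral_def
    using L2I_square[OF assms]
    by (intro integral_mono integrable_mult_indicator) (auto simp: indicator_def)
  then show ?thesis
    using set_integral_cauchy_schwarz[OF assms, of 0 1] by (simp add: L2I_integral_01[OF assms])
qed

text \<open>The Cauchy condition passes to mean distances by Cauchy-Schwarz, which gives a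
  subsequence converging almost everywhere; Fatou along it returns to square distances of the full
  sequence.\<close>

lemma L2I_complete:
  fixes g :: "nat \<Rightarrow> real \<Rightarrow> real"
  assumes g: "\<And>n. g n \<in> L2I"
    and cauchy: "\<And>e. e > 0 \<Longrightarrow> \<exists>N. \<forall>m\<ge>N. \<forall>n\<ge>N. (LINT t|lborel. (g m t - g n t)\<^sup>2) < e"
  obtains G where "G \<in> L2I"
    and "\<And>e. e > 0 \<Longrightarrow> \<exists>N. \<forall>n\<ge>N. (LINT t|lborel. (g n t - G t)\<^sup>2) \<le> e"
proof -
  have [measurable]: "g n \<in> borel_measurable borel" for n
    using g by (rule L2I_measurable)
  have c1: "\<exists>N. \<forall>i\<ge>N. \<forall>j\<ge>N. LINT t|lborel. norm (g i t - g j t) < e" if "e > 0" for e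
  proof -
    obtain N where N: "\<And>m n. m \<ge> N \<Longrightarrow> n \<ge> N \<Longrightarrow> (LINT t|lborel. (g m t - g n t)\<^sup>2) < e\<^sup>2"
      using cauchy[OF zero_less_power[OF \<open>e > 0\<close>, of 2]] by blast
    have "LINT t|lborel. norm (g i t - g j t) < e" if "i \<ge> N" "j \<ge> N" for i j
    proof -
      have "(LINT t|lborel. \<bar>g i t - g j t\<bar>)\<^sup>2 \<le> (LINT t|lborel. (g i t - g j t)\<^sup>2)"
        using L2I_integral_square_le[OF L2I_abs[OF L2I_diff[OF g g]], of i j] by simp
      also have "\<dots> < e\<^sup>2" using that by (rule N)
      finally show ?thesis
        using \<open>e > 0\<close> by (simp add: power2_less_imp_less)
    qed
    then show ?thesis by blast
  qed
  obtain r where r: "strict_mono r" "AE t in lborel. Cauchy (\<lambda>i. g (r i) t)"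
    by (rule cauchy_L1_AE_cauchy_subseq[of lborel g]) (use L2I_integrable[OF g] c1 in blast)+
  \<comment> \<open>Where the subsequence diverges \<open>lim\<close> is an arbitrary value, which
    matters only on a null set. Off the unit interval the sequence is constantly 0, so
    \<open>G\<close> vanishes there everywhere, as \<open>L2I\<close> demands.\<close>
  define G where "G t = lim (\<lambda>i. g (r i) t)" for t
  have [measurable]: "G \<in> borel_measurable borel"
    unfolding G_def by (rule borel_measurable_lim_metric) simp
  have G0: "G t = 0" if "t \<notin> {0..1}" for t
    using L2I_outside[OF g that] by (simp add: G_def)
  have lim: "AE t in lborel. (\<lambda>i. g (r i) t) \<longlonglongrightarrow> G t"
    using r(2) by eventually_elim (simp add: G_def Cauchy_convergent_iff convergent_LIMSEQ_iff)
  have fatou: "(\<integral>\<^sup>+ t. ennreal ((g n t - G t)\<^sup>2) \<partial>lborel) \<le> ennreal e"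
    if N: "\<And>m. m \<ge> N \<Longrightarrow> (LINT t|lborel. (g n t - g m t)\<^sup>2) < e" for N n e
  proof -
    have "AE t in lborel. ennreal ((g n t - G t)\<^sup>2) = liminf (\<lambda>i. ennreal ((g n t - g (r i) t)\<^sup>2))"
      using lim
    proof eventually_elim
      case (elim t)
      then have "(\<lambda>i. ennreal ((g n t - g (r i) t)\<^sup>2)) \<longlonglongrightarrow> ennreal ((g n t - G t)\<^sup>2)"
        by (intro tendsto_ennrealI tendsto_intros)
      then show ?case
        by (intro lim_imp_Liminf[symmetric]) auto
    qed
    then have "(\<integral>\<^sup>+ t. ennreal ((g n t - G t)\<^sup>2) \<partial>lborel) =
        (\<integral>\<^sup>+ t. liminf (\<lambda>i. ennreal ((g n t - g (r i) t)\<^sup>2)) \<partial>lborel)"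
      by (rule nn_integral_cong_AE)
    also have "\<dots> \<le> liminf (\<lambda>i. \<integral>\<^sup>+ t. ennreal ((g n t - g (r i) t)\<^sup>2) \<partial>lborel)"
      by (intro nn_integral_liminf) simp
    also have "\<dots> \<le> limsup (\<lambda>i. \<integral>\<^sup>+ t. ennreal ((g n t - g (r i) t)\<^sup>2) \<partial>lborel)"
      by (rule Liminf_le_Limsup) simp
    also have "\<dots> \<le> ennreal e"
    proof (rule Limsup_bounded)
      have "(\<integral>\<^sup>+ t. ennreal ((g n t - g (r i) t)\<^sup>2) \<partial>lborel) \<le> ennreal e" if "i \<ge> N" for i
      proof -
        have "r i \<ge> N"
          using seq_suble[OF r(1), of i] that by simp
        moreover have "(\<integral>\<^sup>+ t. ennreal ((g n t - g (r i) t)\<^sup>2) \<partial>lborel) =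
            ennreal (LINT t|lborel. (g n t - g (r i) t)\<^sup>2)"
          using L2I_square[OF L2I_diff[OF g g]] by (intro nn_integral_eq_integral) auto
        ultimately show ?thesis
          using N[of "r i"] by (simp add: ennreal_leI)
      qed
      then show "\<forall>\<^sub>F i in sequentially. (\<integral>\<^sup>+ t. ennreal ((g n t - g (r i) t)\<^sup>2) \<partial>lborel) \<le> ennreal e"
        by (auto simp: eventually_sequentially)
    qed
    finally show ?thesis .
  qed
  have int: "integrable lborel (\<lambda>t. (g n t - G t)\<^sup>2) \<and> (LINT t|lborel. (g n t - G t)\<^sup>2) \<le> e"
    if N: "\<And>m. m \<ge> N \<Longrightarrow> (LINT t|lborel. (g n t - g m t)\<^sup>2) < e" and "e > 0" for N n e
  proof -
    have fin: "(\<integral>\<^sup>+ t. ennreal ((g n t - G t)\<^sup>2) \<partial>lborel) \<le> ennreal e"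
      by (rule fatou[OF N])
    then have i: "integrable lborel (\<lambda>t. (g n t - G t)\<^sup>2)"
      using le_less_trans[OF fin ennreal_less_top]
      by (intro integrableI_bounded) auto
    then have "ennreal (LINT t|lborel. (g n t - G t)\<^sup>2) \<le> ennreal e"
      using fin by (subst nn_integral_eq_integral[symmetric]) auto
    then show ?thesis
      using i \<open>e > 0\<close> by simp
  qed
  show thesis
  proof
    obtain N where N: "\<And>m n. m \<ge> N \<Longrightarrow> n \<ge> N \<Longrightarrow> (LINT t|lborel. (g m t - g n t)\<^sup>2) < 1"
      using cauchy[of 1] by auto
    have "(\<lambda>t. g N t - G t) \<in> L2I"
      using int[of N N 1] N G0 L2I_outside[OF g] by (simp add: L2I_def)
    from L2I_diff[OF g this, of N] show "G \<in> L2I" by simp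
    show "\<exists>N. \<forall>n\<ge>N. (LINT t|lborel. (g n t - G t)\<^sup>2) \<le> e" if "e > 0" for e
    proof -
      obtain N where N: "\<And>m n. m \<ge> N \<Longrightarrow> n \<ge> N \<Longrightarrow> (LINT t|lborel. (g m t - g n t)\<^sup>2) < e"
        using cauchy[OF \<open>e > 0\<close>] by auto
      have "(LINT t|lborel. (g n t - G t)\<^sup>2) \<le> e" if "n \<ge> N" for n
        using int[of N n e] N that \<open>e > 0\<close> by blast
      then show ?thesis by blast
    qed
  qed
qed

lemma H01_complete:
  assumes f: "\<And>n. f n \<in> H01"
    and cauchy: "\<And>e. e > 0 \<Longrightarrow>
      \<exists>N. \<forall>m\<ge>N. \<forall>n\<ge>N. energy (\<lambda>x. f m x - f n x) < e"
  obtains F where "F \<in> H01"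
    and "(\<lambda>n. energy (\<lambda>x. f n x - F x)) \<longlonglongrightarrow> 0"
proof -
  have "\<forall>n. \<exists>g. g \<in> L2Z \<and> f n = prim g"
    using f unfolding H01_eq by blast
  from choice[OF this] obtain g where g: "\<And>n. g n \<in> L2Z" "\<And>n. f n = prim (g n)"
    by blast
  have E: "energy (\<lambda>x. prim u x - prim v x) =
      (LINT t|lborel. (u t - v t)\<^sup>2)" if "u \<in> L2I" "v \<in> L2I" for u v
    using energy_prim[OF L2I_diff[OF that] L2I_diff[OF that]] that
    by (simp add: prim_minus power2_eq_square)
  obtain G where G: "G \<in> L2I"
    and conv: "\<And>e. e > 0 \<Longrightarrow> \<exists>N. \<forall>n\<ge>N. (LINT t|lborel. (g n t - G t)\<^sup>2) \<le> e"
    using L2I_complete[OF L2Z_L2I[OF g(1)] cauchy[unfolded g(2) E[OF L2Z_L2I[OF g(1)] L2Z_L2I[OF g(1)]]]]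
    by blast
  \<comment> \<open>The boundary condition at 1 survives the limit: the integral of \<open>G\<close>
    is minus the integral of \<open>g n - G\<close>, which the square distance controls.\<close>
  have "(LINT t|lborel. G t)\<^sup>2 \<le> 0"
  proof (rule field_le_epsilon)
    fix e :: real assume "e > 0"
    then obtain n where n: "(LINT t|lborel. (g n t - G t)\<^sup>2) \<le> e"
      using conv by blast
    have "(LINT t|lborel. G t)\<^sup>2 = (LINT t|lborel. g n t - G t)\<^sup>2"
      using g(1)[of n] L2I_integrable[OF G] L2I_integrable[OF L2Z_L2I[OF g(1)]] by (simp add: L2Z_def)
    also have "\<dots> \<le> e"
      using L2I_integral_square_le[OF L2I_diff[OF L2Z_L2I[OF g(1)] G], of n] n by simp
    finally show "(LINT t|lborel. G t)\<^sup>2 \<le> 0 + e" by simp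
  qed
  then have GZ: "G \<in> L2Z"
    using G by (simp add: L2Z_def)
  show thesis
  proof
    show "prim G \<in> H01" using GZ by (simp add: H01_eq)
    show "(\<lambda>n. energy (\<lambda>x. f n x - prim G x)) \<longlonglongrightarrow> 0"
    proof (rule LIMSEQ_I)
      fix r :: real assume "r > 0"
      then obtain N where "\<forall>n\<ge>N. (LINT t|lborel. (g n t - G t)\<^sup>2) \<le> r / 2"
        using conv[of "r / 2"] by auto
      then show "\<exists>N. \<forall>n\<ge>N. norm (energy (\<lambda>x. f n x - prim G x) - 0) < r"
        using \<open>r > 0\<close> by (intro exI[of _ N]) (force simp: g(2) E L2Z_L2I[OF g(1)] G)
    qed
  qed
qed

lemma energy_limit_pointwise:
  assumes "\<And>n. f n \<in> H01" "F \<in> H01"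
    and "(\<lambda>n. energy (\<lambda>x. f n x - F x)) \<longlonglongrightarrow> 0"
  shows "(\<lambda>n. f n x) \<longlonglongrightarrow> F x"
proof -
  have "(\<lambda>n. sqrt (energy (\<lambda>x. f n x - F x))) \<longlonglongrightarrow> sqrt 0"
    by (intro tendsto_real_sqrt assms)
  then have lim: "(\<lambda>n. sqrt (energy (\<lambda>x. f n x - F x))) \<longlonglongrightarrow> 0"
    by simp
  have "\<bar>f n x - F x\<bar> \<le> sqrt (energy (\<lambda>x. f n x - F x))" for n
    using H01_bound[OF H01_diff[OF assms(1,2)], of n x] by (intro real_le_rsqrt) simp
  then have "(\<lambda>n. f n x - F x) \<longlonglongrightarrow> 0"
    by (intro Lim_null_comparison[OF _ lim]) auto
  then show ?thesis
    by (rule LIM_zero_cancel)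
qed

text \<open>Young's inequality for the cross term: divide the energy of
  \<open>e * f + (f - g)\<close> by \<open>e\<close>. The parameter keeps the factor of
  \<open>energy f\<close> as close to 1 as desired, without square roots.\<close>

lemma energy_triangle:
  assumes "f \<in> H01" "g \<in> H01" "e > 0"
  shows "energy g \<le> (1 + e) * energy f +
    (1 + 1 / e) * energy (\<lambda>x. f x - g x)"
proof -
  define d where "d = (\<lambda>x. f x - g x)"
  have d: "d \<in> H01" unfolding d_def by (rule H01_diff[OF assms(1,2)])
  have "g = (\<lambda>x. f x - d x)" by (simp add: d_def)
  then have g: "energy g = energy f - 2 * energy_form f d + energy d"
    using energy_diff_square[OF assms(1) d] by simp
  have "0 \<le> energy (\<lambda>x. e * f x + 1 * d x)"
    by (rule energy_nonneg)
  also have "\<dots> = e\<^sup>2 * energy f + 2 * e * energy_form f d + energy d"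
    by (subst energy_lincomb_square[OF assms(1) d]) simp
  finally have "0 \<le> (e\<^sup>2 * energy f + 2 * e * energy_form f d + energy d) / e"
    using assms(3) by simp
  also have "\<dots> = e * energy f + 2 * energy_form f d + energy d / e"
    using assms(3) by (simp add: field_simps power2_eq_square)
  finally show ?thesis
    unfolding g d_def[symmetric] by (simp add: field_simps)
qed

text \<open>In \<open>energy_triangle\<close> the sequence goes to its limit first, for fixed
  \<open>e\<close>; only then does \<open>e\<close> tend to 0.\<close>

lemma energy_limit_le:
  assumes f: "\<And>n. f n \<in> H01" "F \<in> H01"
    and lim: "(\<lambda>n. energy (\<lambda>x. f n x - F x)) \<longlonglongrightarrow> 0"
    and le: "\<And>n. energy (f n) \<le> c n" "c \<longlonglongrightarrow> c0"
  shows "energy F \<le> c0"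
proof -
  have *: "energy F \<le> (1 + e) * c0" if e: "e > 0" for e
  proof (rule tendsto_lowerbound)
    have "(\<lambda>n. (1 + e) * c n + (1 + 1 / e) * energy (\<lambda>x. f n x - F x)) \<longlonglongrightarrow> (1 + e) * c0 + (1 + 1 / e) * 0"
      by (intro tendsto_intros lim le)
    then show "(\<lambda>n. (1 + e) * c n + (1 + 1 / e) * energy (\<lambda>x. f n x - F x)) \<longlonglongrightarrow> (1 + e) * c0"
      by simp
    have "energy F \<le> (1 + e) * c n + (1 + 1 / e) * energy (\<lambda>x. f n x - F x)" for n
    proof -
      have "(1 + e) * energy (f n) \<le> (1 + e) * c n" using le(1) e by (intro mult_left_mono) auto
      then show ?thesis using energy_triangle[OF f e, of n] by simp
    qed
    then show "\<forall>\<^sub>F n in sequentially. energy F \<le> (1 + e) * c n + (1 + 1 / e) * energy (\<lambda>x. f n x - F x)"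
      by simp
  qed simp
  have "((\<lambda>e. (1 + e) * c0) \<longlongrightarrow> (1 + 0) * c0) (at_right 0)"
    by (intro tendsto_intros)
  then show ?thesis
    using * by (intro tendsto_lowerbound[of "\<lambda>e. (1 + e) * c0" c0 "at_right 0"])
      (auto simp: eventually_at_right_less intro: eventually_mono[OF eventually_at_right_less])
qed

text \<open>Closest-point argument: midpoints stay in \<open>A\<close>, so the parallelogram
  identity makes a minimising sequence Cauchy in energy. Closure under pointwise limits is enough
  because convergence in energy is stronger.\<close>

lemma energy_minimizer:
  assumes A: "A \<subseteq> H01" "A \<noteq> {}"
    and mid: "\<And>f g. f \<in> A \<Longrightarrow> g \<in> A \<Longrightarrow> (\<lambda>x. (1/2) * f x + (1/2) * g x) \<in> A"
    and closed: "\<And>f F. (\<And>n. f n \<in> A) \<Longrightarrow> F \<in> H01 \<Longrightarrow> (\<And>x. (\<lambda>n. f n x) \<longlonglongrightarrow> F x) \<Longrightarrow> F \<in> A"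
  obtains h where "h \<in> A" "\<And>f. f \<in> A \<Longrightarrow> energy h \<le> energy f"
proof -
  define m where "m = (INF f\<in>A. energy f)"
  have bdd: "bdd_below ((\<lambda>f. energy f) ` A)"
    by (rule bdd_belowI2[of _ 0]) (rule energy_nonneg)
  have m: "m \<le> energy f" if "f \<in> A" for f
    unfolding m_def by (rule cINF_lower[OF bdd that])
  have "\<exists>f\<in>A. energy f < m + 1 / real (Suc n)" for n
  proof (rule ccontr)
    assume "\<not> ?thesis"
    then have "m + 1 / real (Suc n) \<le> m"
      unfolding m_def using A by (intro cINF_greatest) (auto simp: not_less)
    then show False by simp
  qed
  then have "\<forall>n. \<exists>f. f \<in> A \<and> energy f < m + 1 / real (Suc n)" by blast
  from choice[OF this] obtain f where f: "\<And>n. f n \<in> A" "\<And>n. energy (f n) < m + 1 / real (Suc n)"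
    by blast
  have fH: "f n \<in> H01" for n using f A by auto
  \<comment> \<open>The energy of the difference is twice both energies minus four times that of the
    midpoint, and the midpoint costs at least \<open>m\<close>.\<close>
  have gap: "energy (\<lambda>x. f i x - f j x) < 2 / real (Suc i) + 2 / real (Suc j)" for i j
  proof -
    have "m \<le> energy (\<lambda>x. (1/2) * f i x + (1/2) * f j x)"
      by (rule m[OF mid[OF f(1) f(1)]])
    also have "\<dots> = (1/4) * energy (f i) + (1/2) * energy_form (f i) (f j) + (1/4) * energy (f j)"
      by (subst energy_lincomb_square[OF fH fH]) (simp add: power2_eq_square)
    finally show ?thesis
      unfolding energy_diff_square[OF fH fH] using f(2)[of i] f(2)[of j] by simp
  qed
  have inv0: "(\<lambda>n. 1 / real (Suc n)) \<longlonglongrightarrow> 0"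
    using LIMSEQ_inverse_real_of_nat by (simp add: inverse_eq_divide)
  have "\<exists>N. \<forall>i\<ge>N. \<forall>j\<ge>N. energy (\<lambda>x. f i x - f j x) < e" if "e > 0" for e
  proof -
    have "\<forall>\<^sub>F n in sequentially. 1 / real (Suc n) < e / 4"
      using inv0 that by (intro order_tendstoD) auto
    then obtain N where N: "\<And>n. n \<ge> N \<Longrightarrow> 1 / real (Suc n) < e / 4"
      by (auto simp: eventually_sequentially)
    have "energy (\<lambda>x. f i x - f j x) < e" if "i \<ge> N" "j \<ge> N" for i j
      using gap[of i j] N[OF that(1)] N[OF that(2)] by simp
    then show ?thesis by blast
  qed
  from H01_complete[OF fH this] obtain h where h: "h \<in> H01"
    and lim: "(\<lambda>n. energy (\<lambda>x. f n x - h x)) \<longlonglongrightarrow> 0"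
    by blast
  have "h \<in> A"
    by (rule closed[OF f(1) h energy_limit_pointwise[OF fH h lim]])
  moreover have "energy h \<le> m"
  proof (rule energy_limit_le[OF fH h lim less_imp_le[OF f(2)]])
    have "(\<lambda>n. m + 1 / real (Suc n)) \<longlonglongrightarrow> m + 0"
      by (intro tendsto_intros inv0)
    then show "(\<lambda>n. m + 1 / real (Suc n)) \<longlonglongrightarrow> m"
      by (simp only: add_0_right)
  qed
  ultimately show thesis
    using m by (blast intro: that order_trans)
qed

section \<open>Interpolation into the form domain\<close>

text \<open>The cross-multiplied form avoids division and unknown coefficients, hence passes to
  pointwise limits; it also covers empty sets and singletons.\<close>

lemma affine_on_iff:
  fixes h :: "real \<Rightarrow> real"
  shows "(\<exists>a b. \<forall>x\<in>K. h x = a * x + b) \<longleftrightarrow>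
    (\<forall>x\<in>K. \<forall>s\<in>K. \<forall>t\<in>K. (h x - h s) * (t - s) = (h t - h s) * (x - s))" (is "?L \<longleftrightarrow> ?R")
proof
  assume ?L
  then show ?R by (auto simp: algebra_simps)
next
  assume R: ?R
  show ?L
  proof (cases "\<exists>s\<in>K. \<exists>t\<in>K. s \<noteq> t")
    case True
    then obtain s t where st: "s \<in> K" "t \<in> K" "s \<noteq> t" by auto
    define a where "a = (h t - h s) / (t - s)"
    have "h x = a * x + (h s - a * s)" if "x \<in> K" for x
    proof -
      have "(h x - h s) * (t - s) = (h t - h s) * (x - s)" using R st that by auto
      also have "h t - h s = a * (t - s)" using st(3) by (simp add: a_def)
      also have "a * (t - s) * (x - s) = a * (x - s) * (t - s)"
        by (simp only: mult_ac)
      finally have "(h x - h s) * (t - s) = a * (x - s) * (t - s)" .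
      then have "h x - h s = a * (x - s)" using st(3) by simp
      then show ?thesis by (simp add: algebra_simps)
    qed
    then show ?thesis by blast
  next
    case False
    then have "K = {} \<or> (\<exists>x. K = {x})" by blast
    then show ?thesis by (auto intro: exI[of _ 0])
  qed
qed

text \<open>The removed part \<open>w\<close> is the deviation of the gradient from its mean on
  \<open>{s..t}\<close>. The remaining gradient is constant where \<open>w\<close> lives and
  \<open>w\<close> has mean zero, so the two parts are orthogonal and the energies split as in
  Pythagoras.\<close>

lemma replace_by_affine:
  assumes h: "h \<in> H01" and st: "0 \<le> s" "s < t" "t \<le> 1"
  obtains k where "k \<in> H01" "\<And>x. x \<notin> {s<..<t} \<Longrightarrow> k x = h x"
    "\<exists>a b. \<forall>x\<in>{s..t}. k x = a * x + b"
    "energy (\<lambda>x. h x - k x) = energy h - energy k"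
proof -
  obtain g where g: "g \<in> L2Z" "h = prim g" using h by (rule H01E)
  note gI = L2Z_L2I[OF g(1)]
  define a where "a = (LINT u:{s..t}|lborel. g u) / (t - s)"
  define w where "w = (\<lambda>u. indicator {s..t} u * g u - a * indicator {s..t} u)"
  have wI: "w \<in> L2I"
    unfolding w_def using st by (intro L2I_diff L2I_restrict gI L2I_indicator) auto
  have w0: "(LINT u|lborel. w u) = 0"
  proof -
    have "integrable lborel (\<lambda>u. a * indicator {s..t} u)"
      using L2I_indicator[of s t a] st by (intro L2I_integrable) auto
    then have "(LINT u|lborel. w u) = (LINT u|lborel. indicator {s..t} u * g u) - a * (t - s)"
      unfolding w_def using st L2I_integrable[OF L2I_restrict[OF gI]] by simp
    also have "\<dots> = 0"
      using st by (simp add: a_def set_lebesgue_integral_def)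
    finally show ?thesis .
  qed
  have wZ: "w \<in> L2Z" using wI w0 by (simp add: L2Z_def)
  define r where "r = (\<lambda>u. g u - w u)"
  have rZ: "r \<in> L2Z" using L2Z_lincomb[OF g(1) wZ, of 1 "-1"] by (simp add: r_def)
  have r_eq: "prim r = (\<lambda>x. h x - prim w x)"
    unfolding r_def g(2) by (rule prim_minus[OF gI wI])
  have prim_w: "prim w x = 0" if "x \<notin> {s<..<t}" for x
  proof (cases "x \<in> {0..1}")
    case x: True
    show ?thesis
    proof (cases "x \<le> s")
      case True
      have "(LINT u:{0..x}|lborel. w u) = 0"
        unfolding set_lebesgue_integral_def
      proof (rule integral_eq_zero_AE)
        show "AE u in lborel. indicator {0..x} u *\<^sub>R w u = 0"
          using AE_lborel_singleton[of s] by eventually_elim (use True in \<open>auto simp: w_def indicator_def\<close>)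
      qed
      then show ?thesis by (simp add: prim_def)
    next
      case False
      then have "t \<le> x" using that by auto
      then have "indicator {0..x} u * w u = w u" for u
        using x L2I_outside[OF wI, of u] by (auto simp: indicator_def w_def)
      then have "(LINT u:{0..x}|lborel. w u) = (LINT u|lborel. w u)"
        by (simp only: set_lebesgue_integral_def real_scaleR_def)
      then show ?thesis by (simp add: prim_def w0)
    qed
  qed (auto simp: prim_def)
  have aff: "prim r x = a * x + (prim r s - a * s)" if "x \<in> {s..t}" for x
  proof -
    have "indicator {s..x} u * r u = a * indicator {s..x} u" for u
      using that by (auto simp: r_def w_def indicator_def)
    then have "(LINT u:{s..x}|lborel. r u) = (LINT u|lborel. a * indicator {s..x} u)"
      by (simp only: set_lebesgue_integral_def real_scaleR_def)
    also have "\<dots> = a * (x - s)" using that by simp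
    finally have "prim r x - prim r s = a * (x - s)"
      using prim_diff[OF L2Z_L2I[OF rZ], of s x] that st by simp
    then show ?thesis by (simp add: algebra_simps)
  qed
  have orth: "energy_form (prim r) (prim w) = 0"
  proof -
    have "r u * w u = a * w u" for u
      by (auto simp: r_def w_def indicator_def)
    then show ?thesis
      unfolding energy_prim[OF L2Z_L2I[OF rZ] wI] by (simp only: w0 integral_mult_right_zero mult_zero_right)
  qed
  have rH: "prim r \<in> H01" and wH: "prim w \<in> H01" using rZ wZ by (auto simp: H01_eq)
  have "h = (\<lambda>x. prim r x + prim w x)" by (simp add: r_eq)
  then have "energy h = energy (prim r) + energy (prim w)"
    using energy_add_square[OF rH wH] orth by simp
  then have e: "energy (\<lambda>x. h x - prim r x) =
      energy h - energy (prim r)"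
    by (simp add: r_eq)
  show thesis
  proof (rule that[OF rH _ _ e])
    show "prim r x = h x" if "x \<notin> {s<..<t}" for x
      using prim_w[OF that] by (simp add: r_eq)
    show "\<exists>a b. \<forall>x\<in>{s..t}. prim r x = a * x + b"
      using aff by blast
  qed
qed

text \<open>Instead of interpolating on each of the possibly infinitely many gaps of the support,
  the energy is minimised among all functions that agree with \<open>f\<close> on it. By
  \<open>replace_by_affine\<close> a minimiser is affine on every closed interval inside a
  gap.\<close>

lemma projection_onto_dom_form:
  assumes f: "f \<in> H01"
  obtains h where "h \<in> dom_form \<nu>" "\<And>x. x \<in> measure_supp \<nu> \<Longrightarrow> h x = f x"
    "energy h \<le> energy f"
proof -
  define A where "A = {h \<in> H01. \<forall>x\<in>measure_supp \<nu>. h x = f x}"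
  obtain h where hA: "h \<in> A" and min: "\<And>k. k \<in> A \<Longrightarrow> energy h \<le> energy k"
  proof (rule energy_minimizer[of A])
    show "A \<noteq> {}" using f by (auto simp: A_def)
    show "F \<in> A" if "\<And>n. k n \<in> A" "F \<in> H01" "\<And>x. (\<lambda>n. k n x) \<longlonglongrightarrow> F x" for k F
    proof -
      have "F x = f x" if x: "x \<in> measure_supp \<nu>" for x
      proof -
        have "(\<lambda>n. f x) \<longlonglongrightarrow> F x"
          using \<open>\<And>x. (\<lambda>n. k n x) \<longlonglongrightarrow> F x\<close>[of x] \<open>\<And>n. k n \<in> A\<close> x by (simp add: A_def)
        then show ?thesis by (simp add: LIMSEQ_const_iff)
      qed
      then show ?thesis using that by (simp add: A_def)
    qed
    show "(\<lambda>x. (1/2) * u x + (1/2) * v x) \<in> A" if "u \<in> A" "v \<in> A" for u v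
      using that H01_lincomb[of u v "1/2" "1/2"] by (simp add: A_def)
  qed (auto simp: A_def)
  have h: "h \<in> H01" using hA by (simp add: A_def)
  have aff: "\<exists>a b. \<forall>x\<in>{s..t}. h x = a * x + b"
    if st: "s < t" "{s..t} \<subseteq> {0..1} - measure_supp \<nu>" for s t
  proof -
    have "s \<in> {s..t}" "t \<in> {s..t}" using st by auto
    then have "s \<in> {0..1}" "t \<in> {0..1}" using st by blast+
    then have "0 \<le> s" "t \<le> 1" by auto
    then obtain k where k: "k \<in> H01" "\<And>x. x \<notin> {s<..<t} \<Longrightarrow> k x = h x"
      "\<exists>a b. \<forall>x\<in>{s..t}. k x = a * x + b"
      "energy (\<lambda>x. h x - k x) = energy h - energy k"
      using replace_by_affine[OF h _ st(1)] by blast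
    have "k x = f x" if "x \<in> measure_supp \<nu>" for x
    proof -
      have "x \<notin> {s..t}" using that st by auto
      then show ?thesis using k(2)[of x] hA that by (auto simp: A_def)
    qed
    then have "k \<in> A" using k(1) by (simp add: A_def)
    \<comment> \<open>Minimality turns the Pythagorean identity into a non-positive energy of the
      difference, so \<open>h\<close> is its own affine replacement.\<close>
    then have "energy (\<lambda>x. h x - k x) \<le> 0"
      using min[of k] k(4) by simp
    then have "(\<lambda>x. h x - k x) = (\<lambda>x. 0)"
      by (rule energy_eq_0[OF H01_diff[OF h k(1)]])
    then have "h = k" by (simp add: fun_eq_iff)
    then show ?thesis using k(3) by simp
  qed
  have "\<exists>a b. \<forall>x\<in>K. h x = a * x + b" if K: "K \<in> components ({0..1} - measure_supp \<nu>)" for K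
    unfolding affine_on_iff
  proof (intro ballI)
    fix x s t assume xst: "x \<in> K" "s \<in> K" "t \<in> K"
    define l where "l = min x (min s t)"
    define u where "u = max x (max s t)"
    have iv: "is_interval K"
      using K in_components_connected is_interval_connected_1 by blast
    have "l \<in> K" "u \<in> K" using xst by (auto simp: l_def u_def min_def max_def)
    then have sub: "{l..u} \<subseteq> K"
      using interval_subset_is_interval[OF iv, of l u] by (simp add: cbox_interval)
    show "(h x - h s) * (t - s) = (h t - h s) * (x - s)"
    proof (cases "l < u")
      case True
      then have "\<exists>a b. \<forall>x\<in>{l..u}. h x = a * x + b"
        using sub in_components_subset[OF K] by (intro aff) auto
      moreover have "x \<in> {l..u}" "s \<in> {l..u}" "t \<in> {l..u}" by (auto simp: l_def u_def)
      ultimately show ?thesis unfolding affine_on_iff by blast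
    next
      case False
      then have "x = s" "t = s" by (auto simp: l_def u_def min_def max_def split: if_splits)
      then show ?thesis by simp
    qed
  qed
  then have "h \<in> dom_form \<nu>"
    using h H01_continuous[OF h] by (simp add: dom_form_def C_nu_def)
  then show thesis
    using hA min[of f] f by (intro that) (auto simp: A_def)
qed

section \<open>The form domain as a closed subspace\<close>

lemma dom_form_H01: "f \<in> dom_form \<nu> \<Longrightarrow> f \<in> H01"
  by (simp add: dom_form_def)

lemma dom_form_closed:
  assumes f: "\<And>n. f n \<in> dom_form \<nu>" and F: "F \<in> H01" and lim: "\<And>x. (\<lambda>n. f n x) \<longlonglongrightarrow> F x"
  shows "F \<in> dom_form \<nu>"
proof -
  have "\<exists>a b. \<forall>x\<in>K. F x = a * x + b" if K: "K \<in> components ({0..1} - measure_supp \<nu>)" for K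
    unfolding affine_on_iff
  proof (intro ballI)
    fix x s t assume xst: "x \<in> K" "s \<in> K" "t \<in> K"
    have eq: "(f n x - f n s) * (t - s) = (f n t - f n s) * (x - s)" for n
    proof -
      have "\<exists>a b. \<forall>x\<in>K. f n x = a * x + b"
        using f[of n] K by (simp add: dom_form_def C_nu_def)
      then show ?thesis using xst unfolding affine_on_iff by blast
    qed
    have "(\<lambda>n. (f n x - f n s) * (t - s)) \<longlonglongrightarrow> (F x - F s) * (t - s)"
      by (intro tendsto_intros lim)
    moreover have "(\<lambda>n. (f n x - f n s) * (t - s)) \<longlonglongrightarrow> (F t - F s) * (x - s)"
      unfolding eq by (intro tendsto_intros lim)
    ultimately show "(F x - F s) * (t - s) = (F t - F s) * (x - s)"
      by (rule LIMSEQ_unique)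
  qed
  then show ?thesis
    using F H01_continuous[OF F] by (simp add: dom_form_def C_nu_def)
qed

lemma dom_form_lincomb:
  assumes "f \<in> dom_form \<nu>" "g \<in> dom_form \<nu>"
  shows "(\<lambda>x. a * f x + b * g x) \<in> dom_form \<nu>"
proof -
  have "\<exists>c d. \<forall>x\<in>K. a * f x + b * g x = c * x + d" if K: "K \<in> components ({0..1} - measure_supp \<nu>)" for K
  proof -
    obtain p q p' q' where "\<forall>x\<in>K. f x = p * x + q" "\<forall>x\<in>K. g x = p' * x + q'"
      using assms K unfolding dom_form_def C_nu_def by blast
    then have "\<forall>x\<in>K. a * f x + b * g x = (a * p + b * p') * x + (a * q + b * q')"
      by (auto simp: algebra_simps)
    then show ?thesis by blast
  qed
  moreover have "(\<lambda>x. a * f x + b * g x) \<in> H01"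
    using assms by (intro H01_lincomb dom_form_H01)
  ultimately show ?thesis
    using H01_continuous by (simp add: dom_form_def C_nu_def)
qed

lemma dom_form_zero: "(\<lambda>x. 0) \<in> dom_form \<nu>"
  using H01_zero by (auto simp: dom_form_def C_nu_def intro!: exI[of _ 0])

lemma dom_form_sum: "(\<And>i. i \<in> I \<Longrightarrow> f i \<in> dom_form \<nu>) \<Longrightarrow> (\<lambda>x. \<Sum>i\<in>I. c i * f i x) \<in> dom_form \<nu>"
proof (induction I rule: infinite_finite_induct)
  case (insert i I)
  then show ?case
    using dom_form_lincomb[of "f i" _ "\<lambda>x. \<Sum>i\<in>I. c i * f i x" "c i" 1] by simp
qed (auto intro: dom_form_zero)

section \<open>The support carries the measure\<close>

lemma nzfb_sets: "nonzero_finite_borel \<nu> \<Longrightarrow> sets \<nu> = sets borel"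
  by (simp add: nonzero_finite_borel_def)

lemma nzfb_finite: "nonzero_finite_borel \<nu> \<Longrightarrow> finite_measure \<nu>"
  by (simp add: nonzero_finite_borel_def)

lemma nzfb_AE_open: 
  assumes "nonzero_finite_borel \<nu>"
  shows "AE x in \<nu>. x \<in> {0<..<1}"
proof (rule AE_I)
  have "space \<nu> = UNIV" using sets_eq_imp_space_eq[OF nzfb_sets[OF assms]] by simp
  then show "{x \<in> space \<nu>. x \<notin> {0<..<1}} \<subseteq> - {0<..<1}" by auto
  show "emeasure \<nu> (- {0<..<1}) = 0" using assms by (simp add: nonzero_finite_borel_def)
  show "- {0<..<1} \<in> sets \<nu>" using nzfb_sets[OF assms] by simp
qed

text \<open>Off the support every point has a null open neighbourhood; by Lindeloef countably many
  of these suffice.\<close>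

lemma nzfb_AE_supp:
  assumes "nonzero_finite_borel \<nu>"
  shows "AE x in \<nu>. x \<in> measure_supp \<nu>"
proof -
  define \<U> where "\<U> = {U. open U \<and> emeasure \<nu> U = 0}"
  obtain \<V> where V: "\<V> \<subseteq> \<U>" "countable \<V>" "\<Union>\<V> = \<Union>\<U>"
    using Lindelof[of \<U>] by (auto simp: \<U>_def)
  have sub: "U \<in> null_sets \<nu>" if "U \<in> \<V>" for U
    using V that nzfb_sets[OF assms] by (auto simp: \<U>_def null_sets_def)
  then have "\<Union>\<V> \<in> null_sets \<nu>"
    using null_sets_UN'[OF V(2), of "\<lambda>x. x" \<nu>] by simp
  then have "AE x in \<nu>. x \<notin> \<Union>\<U>"
    using V(3) AE_not_in[of "\<Union>\<V>" \<nu>] by simp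
  then show ?thesis
    using nzfb_AE_open[OF assms]
    by eventually_elim (auto simp: \<U>_def measure_supp_def zero_less_iff_neq_zero)
qed

section \<open>Maximisers of the mass under an energy constraint\<close>

definition mass_form :: "real measure \<Rightarrow> (real \<Rightarrow> real) \<Rightarrow> (real \<Rightarrow> real) \<Rightarrow> real" where
  "mass_form \<nu> f g = (LINT x:{0..1}|\<nu>. f x * g x)"

abbreviation mass :: "real measure \<Rightarrow> (real \<Rightarrow> real) \<Rightarrow> real" where
  "mass \<nu> f \<equiv> mass_form \<nu> f f"

lemma mass_form_sym: "mass_form \<nu> f g = mass_form \<nu> g f"
  by (simp add: mass_form_def mult.commute)

lemma H01_measurable: "f \<in> H01 \<Longrightarrow> f \<in> borel_measurable borel"
  by (intro borel_measurable_continuous_onI H01_continuous)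

lemma nzfb_measurable:
  assumes "nonzero_finite_borel \<nu>" "f \<in> H01"
  shows "f \<in> borel_measurable \<nu>"
  using H01_measurable[OF assms(2)] measurable_cong_sets[OF nzfb_sets[OF assms(1)] refl] by blast

lemma mass_form_eq:
  assumes "f \<in> H01"
  shows "mass_form \<nu> f g = (LINT x|\<nu>. f x * g x)"
proof -
  have "indicator {0..1} x *\<^sub>R (f x * g x) = f x * g x" for x
    using H01_vanishes[OF assms, of x] by (cases "x \<in> {0..1}") auto
  then show ?thesis
    by (simp only: mass_form_def set_lebesgue_integral_def)
qed

lemma H01_mult_integrable:
  assumes "nonzero_finite_borel \<nu>" "f \<in> H01" "g \<in> H01"
  shows "integrable \<nu> (\<lambda>x. f x * g x)"
proof -
  interpret finite_measure \<nu> by (rule nzfb_finite[OF assms(1)])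
  note [measurable] = nzfb_measurable[OF assms(1,2)] nzfb_measurable[OF assms(1,3)]
  have "\<bar>f x * g x\<bar> \<le> energy f + energy g" for x
  proof -
    have "0 \<le> (\<bar>f x\<bar> - \<bar>g x\<bar>)\<^sup>2 + \<bar>f x\<bar> * \<bar>g x\<bar>"
      by simp
    then have "\<bar>f x * g x\<bar> \<le> (f x)\<^sup>2 + (g x)\<^sup>2"
      by (simp add: power2_eq_square algebra_simps abs_mult)
    then show ?thesis
      using H01_bound[OF assms(2), of x] H01_bound[OF assms(3), of x] by linarith
  qed
  then show ?thesis
    by (intro integrable_const_bound[of _ "energy f + energy g"]) auto
qed

lemma mass_form_nonneg: "mass \<nu> f \<ge> 0"
  unfolding mass_form_def set_lebesgue_integral_def
  by (intro Bochner_Integration.integral_nonneg) auto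

lemma mass_form_lincomb:
  assumes "nonzero_finite_borel \<nu>" "f \<in> H01" "g \<in> H01" "h \<in> H01"
  shows "mass_form \<nu> (\<lambda>x. a * f x + b * g x) h = a * mass_form \<nu> f h + b * mass_form \<nu> g h"
proof -
  have "mass_form \<nu> (\<lambda>x. a * f x + b * g x) h = (LINT x|\<nu>. a * (f x * h x) + b * (g x * h x))"
    by (subst mass_form_eq[OF H01_lincomb[OF assms(2,3)]], rule Bochner_Integration.integral_cong)
      (simp_all add: algebra_simps)
  then show ?thesis
    using H01_mult_integrable[OF assms(1,2,4)] H01_mult_integrable[OF assms(1,3,4)]
    by (simp add: mass_form_eq assms)
qed

lemma mass_form_lincomb_square:
  assumes "nonzero_finite_borel \<nu>" "f \<in> H01" "g \<in> H01"
  shows "mass \<nu> (\<lambda>x. a * f x + b * g x) =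
    a\<^sup>2 * mass \<nu> f + 2 * a * b * mass_form \<nu> f g + b\<^sup>2 * mass \<nu> g"
proof -
  have "mass_form \<nu> (\<lambda>x. a * f x + b * g x) h = a * mass_form \<nu> f h + b * mass_form \<nu> g h" if "h \<in> H01" for h
    by (rule mass_form_lincomb[OF assms that])
  moreover have "mass_form \<nu> h (\<lambda>x. a * f x + b * g x) = a * mass_form \<nu> f h + b * mass_form \<nu> g h" if "h \<in> H01" for h
    using mass_form_lincomb[OF assms that] by (simp add: mass_form_sym)
  ultimately show ?thesis
    by (simp add: H01_lincomb assms mass_form_sym[of \<nu> g f] power2_eq_square algebra_simps)
qed

lemma mass_form_zero: "mass_form \<nu> (\<lambda>x. 0) h = 0"
  by (simp add: mass_form_def set_lebesgue_integral_def)

lemma mass_form_sum: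
  assumes "nonzero_finite_borel \<nu>" "\<And>i. i \<in> I \<Longrightarrow> f i \<in> H01" "h \<in> H01"
  shows "mass_form \<nu> (\<lambda>x. \<Sum>i\<in>I. c i * f i x) h = (\<Sum>i\<in>I. c i * mass_form \<nu> (f i) h)"
  using assms(2)
proof (induction I rule: infinite_finite_induct)
  case (insert i I)
  then show ?case
    using mass_form_lincomb[of \<nu> "f i" "\<lambda>x. \<Sum>i\<in>I. c i * f i x" h "c i" 1] assms
    by (simp add: H01_sum)
qed (simp_all add: mass_form_zero)

lemma mass_form_le_sup:
  assumes "nonzero_finite_borel \<nu>" "f \<in> H01" "\<And>x. (f x)\<^sup>2 \<le> c"
  shows "mass \<nu> f \<le> c * measure \<nu> (space \<nu>)"
proof -
  interpret finite_measure \<nu> by (rule nzfb_finite[OF assms(1)])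
  have "mass \<nu> f \<le> (LINT x|\<nu>. c)"
    unfolding mass_form_eq[OF assms(2)]
    using H01_mult_integrable[OF assms(1,2,2)] assms(3)
    by (intro integral_mono) (auto simp: power2_eq_square)
  then show ?thesis by (simp add: mult.commute)
qed

lemma mass_form_cong_supp:
  assumes "nonzero_finite_borel \<nu>" "f \<in> H01" "g \<in> H01" "h \<in> H01" "k \<in> H01"
    and "\<And>x. x \<in> measure_supp \<nu> \<Longrightarrow> f x = g x" "\<And>x. x \<in> measure_supp \<nu> \<Longrightarrow> h x = k x"
  shows "mass_form \<nu> f h = mass_form \<nu> g k"
  unfolding mass_form_eq[OF assms(2)] mass_form_eq[OF assms(3)]
proof (rule integral_cong_AE)
  note [measurable] = nzfb_measurable[OF assms(1,2)] nzfb_measurable[OF assms(1,3)]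
     nzfb_measurable[OF assms(1,4)] nzfb_measurable[OF assms(1,5)]
  show "(\<lambda>x. f x * h x) \<in> borel_measurable \<nu>" "(\<lambda>x. g x * k x) \<in> borel_measurable \<nu>" by simp_all
  show "AE x in \<nu>. f x * h x = g x * k x"
    using nzfb_AE_supp[OF assms(1)] by eventually_elim (simp add: assms)
qed

text \<open>
  Along a maximising sequence that converges uniformly, the masses of the sums tend to four times the
  supremum, which bounds the energies of the sums from below; the parallelogram identity then makes the
  sequence Cauchy in energy.
\<close>

lemma energy_maximizer:
  assumes \<nu>: "nonzero_finite_borel \<nu>" and U: "U \<subseteq> H01"
    and lin: "\<And>f g a b. f \<in> U \<Longrightarrow> g \<in> U \<Longrightarrow> (\<lambda>x. a * f x + b * g x) \<in> U"
    and closed: "\<And>f F. (\<And>n. f n \<in> U) \<Longrightarrow> F \<in> H01 \<Longrightarrow>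
      (\<lambda>n. energy (\<lambda>x. f n x - F x)) \<longlonglongrightarrow> 0 \<Longrightarrow> F \<in> U"
    and h0: "h0 \<in> U" "mass \<nu> h0 > 0"
  obtains h M where "h \<in> U" "mass \<nu> h > 0" "mass \<nu> h = M * energy h"
    "\<And>u. u \<in> U \<Longrightarrow> mass \<nu> u \<le> M * energy u"
proof -
  define c where "c = measure \<nu> (space \<nu>)"
  have c: "mass \<nu> f \<le> c * energy f" if "f \<in> H01" for f
    using mass_form_le_sup[OF \<nu> that H01_bound[OF that]] by (simp add: c_def mult.commute)
  have c0: "c \<ge> 0" by (simp add: c_def)
  define S where "S = {f \<in> U. energy f \<le> 1}"
  \<comment> \<open>The supremum of mass over energy, which turns out to be the reciprocal of the
    smallest eigenvalue on \<open>U\<close>.\<close>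
  define M where "M = (SUP f\<in>S. mass \<nu> f)"
  have bdd: "bdd_above ((\<lambda>f. mass \<nu> f) ` S)"
  proof (rule bdd_aboveI2)
    fix f assume f: "f \<in> S"
    have "mass \<nu> f \<le> c * energy f" using f U by (intro c) (auto simp: S_def)
    also have "\<dots> \<le> c * 1" using f c0 by (intro mult_left_mono) (auto simp: S_def)
    finally show "mass \<nu> f \<le> c" by simp
  qed
  \<comment> \<open>Rescaling to unit energy; when the energy is 0, the bound with \<open>c\<close>
    forces the mass to be 0 as well.\<close>
  have homog: "mass \<nu> u \<le> M * energy u" if u: "u \<in> U" for u
  proof (cases "energy u = 0")
    case True
    have "mass \<nu> u \<le> c * energy u" using u U by (intro c) auto
    then show ?thesis using True by simp
  next
    case False
    define e where "e = energy u"
    have e: "e > 0" using False energy_nonneg[of u] by (simp add: e_def)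
    define v where "v = (\<lambda>x. (1 / sqrt e) * u x + 0 * u x)"
    have uH: "u \<in> H01" using u U by auto
    have "v \<in> U" unfolding v_def by (rule lin[OF u u])
    moreover have "energy v = 1"
      unfolding v_def energy_lincomb_square[OF uH uH] using e by (simp add: e_def[symmetric] power_divide)
    ultimately have "mass \<nu> v \<le> M"
      unfolding M_def by (intro cSUP_upper bdd) (auto simp: S_def)
    moreover have "mass \<nu> v = mass \<nu> u / e"
      unfolding v_def mass_form_lincomb_square[OF \<nu> uH uH] using e by (simp add: power_divide)
    ultimately show ?thesis using e by (simp add: e_def[symmetric] field_simps)
  qed
  have M0: "M > 0"
  proof (rule ccontr)
    assume "\<not> M > 0"
    then have "M * energy h0 \<le> 0"
      using energy_nonneg[of h0] by (simp add: mult_nonpos_nonneg)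
    then show False using homog[OF h0(1)] h0(2) by simp
  qed
  have "S \<noteq> {}"
  proof -
    have "(\<lambda>x. 0 * h0 x + 0 * h0 x) \<in> U" by (rule lin[OF h0(1) h0(1)])
    then have "(\<lambda>x. 0) \<in> S"
      using c[OF H01_zero] energy_sum[of "{}" "\<lambda>x. x" "\<lambda>x. 0"] H01_zero by (simp add: S_def)
    then show ?thesis by blast
  qed
  then have "\<exists>f. f \<in> S \<and> M - 1 / real (Suc n) < mass \<nu> f" for n
    unfolding M_def using less_cSUP_iff[OF _ bdd, of "M - 1 / real (Suc n)"] by (auto simp: M_def)
  then have "\<forall>n. \<exists>f. f \<in> S \<and> M - 1 / real (Suc n) < mass \<nu> f" by blast
  from choice[OF this] obtain f where f: "\<And>n. f n \<in> S" "\<And>n. M - 1 / real (Suc n) < mass \<nu> (f n)"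
    by blast
  have fU: "f n \<in> U" and fH: "f n \<in> H01" and fE: "energy (f n) \<le> 1" for n
    using f(1)[of n] U by (auto simp: S_def)
  obtain G k where k: "strict_mono (k :: nat \<Rightarrow> nat)"
    and unif: "\<And>e. 0 < e \<Longrightarrow> \<exists>N. \<forall>n x. n \<ge> N \<and> x \<in> {0..1} \<longrightarrow> norm (f (k n) x - G x) < e"
  \<comment> \<open>Energies at most 1 give the uniform bound through \<open>H01_bound\<close> and
    equicontinuity through \<open>H01_hoelder\<close>; the modulus is a square root, hence the
    radius \<open>e\<^sup>2\<close>.\<close>
  proof (rule Arzela_Ascoli[of "{0..1::real}" f 1])
    show "norm (f n x) \<le> 1" for n x
      using H01_bound[OF fH[of n], of x] fE[of n] by (simp add: abs_square_le_1[symmetric])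
    show "\<exists>d>0. \<forall>n y. y \<in> {0..1} \<and> norm (x - y) < d \<longrightarrow> norm (f n x - f n y) < e" if "e > 0" for x e
    proof (intro exI[of _ "e\<^sup>2"] conjI allI impI)
      fix n y assume y: "y \<in> {0..1} \<and> norm (x - y) < e\<^sup>2"
      have "(f n x - f n y)\<^sup>2 \<le> \<bar>x - y\<bar> * energy (f n)"
        by (rule H01_hoelder[OF fH])
      also have "\<dots> \<le> \<bar>x - y\<bar> * 1"
        using fE by (intro mult_left_mono) auto
      finally have "\<bar>f n x - f n y\<bar>\<^sup>2 < e\<^sup>2" using y by simp
      then show "norm (f n x - f n y) < e"
        using that by (simp add: power2_less_imp_less)
    qed (use that in simp)
  qed auto
  define F where "F n = f (k n)" for n
  have FU: "F n \<in> U" and FH: "F n \<in> H01" and FE: "energy (F n) \<le> 1" for n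
    by (simp_all add: F_def fU fH fE)
  have Fq: "M - 1 / real (Suc n) < mass \<nu> (F n)" for n
  proof -
    have "1 / real (Suc (k n)) \<le> 1 / real (Suc n)"
      using seq_suble[OF k, of n] by (intro divide_left_mono) auto
    then show ?thesis using f(2)[of "k n"] by (simp add: F_def)
  qed
  have gap: "M * energy (\<lambda>x. F i x - F j x) \<le>
      2 / real (Suc i) + 2 / real (Suc j) + mass \<nu> (\<lambda>x. F i x - F j x)" for i j
  proof -
    have "mass \<nu> (\<lambda>x. F i x + F j x) \<le> M * energy (\<lambda>x. F i x + F j x)"
      using homog[OF lin[OF FU[of i] FU[of j], of 1 1]] by simp
    then have "mass \<nu> (F i) + 2 * mass_form \<nu> (F i) (F j) + mass \<nu> (F j) \<le>
        M * (energy (F i) + 2 * energy_form (F i) (F j) + energy (F j))"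
      using mass_form_lincomb_square[OF \<nu> FH FH, of 1 i 1 j] energy_add_square[OF FH FH, of i j] by simp
    moreover have "mass \<nu> (\<lambda>x. F i x - F j x) =
        mass \<nu> (F i) - 2 * mass_form \<nu> (F i) (F j) + mass \<nu> (F j)"
      using mass_form_lincomb_square[OF \<nu> FH FH, of 1 i "-1" j] by simp
    moreover have "M * energy (F i) \<le> M" "M * energy (F j) \<le> M"
      using FE M0 by (simp_all add: mult_left_le)
    ultimately show ?thesis
      using Fq[of i] Fq[of j] unfolding energy_diff_square[OF FH FH] by (simp add: algebra_simps)
  qed
  have inv0: "(\<lambda>n. 1 / real (Suc n)) \<longlonglongrightarrow> 0"
    using LIMSEQ_inverse_real_of_nat by (simp add: inverse_eq_divide)
  have cauchy: "\<exists>N. \<forall>i\<ge>N. \<forall>j\<ge>N. energy (\<lambda>x. F i x - F j x) < e" if "e > 0" for e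
  proof -
    \<comment> \<open>Five errors of size \<open>d\<close> occur in \<open>gap\<close>: two for each
      of \<open>i\<close> and \<open>j\<close>, and one from the mass of the difference. The
      \<open>c + 1\<close> in \<open>s\<close> guards against division by zero.\<close>
    define d where "d = M * e / 8"
    have d: "d > 0" using that M0 by (simp add: d_def)
    define s where "s = sqrt (d / (c + 1))"
    have s: "s > 0" "s\<^sup>2 * c \<le> d"
      using d c0 by (auto simp: s_def field_simps)
    have "\<forall>\<^sub>F n in sequentially. 1 / real (Suc n) < d"
      using inv0 d by (intro order_tendstoD) auto
    then obtain N1 where N1: "\<And>n. n \<ge> N1 \<Longrightarrow> 1 / real (Suc n) < d"
      by (auto simp: eventually_sequentially)
    have "s / 2 > 0" using s by simp
    from unif[OF this] obtain N2 where N2: "\<And>n x. n \<ge> N2 \<Longrightarrow> x \<in> {0..1} \<Longrightarrow> norm (F n x - G x) < s / 2"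
      unfolding F_def by blast
    have "energy (\<lambda>x. F i x - F j x) < e" if "i \<ge> max N1 N2" "j \<ge> max N1 N2" for i j
    proof -
      have "\<bar>F i x - F j x\<bar> \<le> s" for x
      proof (cases "x \<in> {0..1}")
        case True
        then have "\<bar>F i x - G x\<bar> < s / 2" "\<bar>F j x - G x\<bar> < s / 2"
          using N2[of i x] N2[of j x] that by auto
        then show ?thesis by linarith
      next
        case False
        then show ?thesis using H01_vanishes[OF FH, of x] s by auto
      qed
      then have "(F i x - F j x)\<^sup>2 \<le> s\<^sup>2" for x
        by (intro abs_le_square_iff[THEN iffD1]) (use s in auto)
      then have "mass \<nu> (\<lambda>x. F i x - F j x) \<le> s\<^sup>2 * c"
        unfolding c_def by (intro mass_form_le_sup \<nu> H01_diff FH)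
      also have "\<dots> \<le> d" by (rule s(2))
      finally have "M * energy (\<lambda>x. F i x - F j x) < 5 * d"
        using gap[of i j] N1[of i] N1[of j] that by simp
      also have "\<dots> < M * e" using d unfolding d_def by simp
      finally show ?thesis using M0 by simp
    qed
    then show ?thesis by blast
  qed
  from H01_complete[OF FH cauchy] obtain h where h: "h \<in> H01"
    and lim: "(\<lambda>n. energy (\<lambda>x. F n x - h x)) \<longlonglongrightarrow> 0"
    by blast
  have hU: "h \<in> U" by (rule closed[OF FU h lim])
  have hq: "mass \<nu> h \<ge> M"
  proof -
    \<comment> \<open>The mass is continuous along the sequence: the cross term is at most the
      supremum of the difference times the total mass, because \<open>F n\<close> is bounded by
      1.\<close>
    have *: "M - 1 / real (Suc n) - 2 * c * sqrt (energy (\<lambda>x. F n x - h x)) \<le> mass \<nu> h" for n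
    proof -
      define D where "D = (\<lambda>x. F n x - h x)"
      define \<delta> where "\<delta> = sqrt (energy D)"
      have D: "D \<in> H01" unfolding D_def by (rule H01_diff[OF FH h])
      have \<delta>: "\<bar>D x\<bar> \<le> \<delta>" for x
        unfolding \<delta>_def using H01_bound[OF D, of x] by (intro real_le_rsqrt) simp
      interpret finite_measure \<nu> by (rule nzfb_finite[OF \<nu>])
      have F1: "\<bar>F n x\<bar> \<le> 1" for x
        using H01_bound[OF FH[of n], of x] FE[of n] by (simp add: abs_square_le_1[symmetric])
      have "h = (\<lambda>x. 1 * F n x + (-1) * D x)" by (simp add: D_def)
      then have "mass \<nu> h = mass \<nu> (F n) - 2 * mass_form \<nu> (F n) D + mass \<nu> D"
        using mass_form_lincomb_square[OF \<nu> FH D, of 1 n "-1"] by simp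
      moreover have "mass_form \<nu> (F n) D \<le> (LINT x|\<nu>. \<delta>)"
        unfolding mass_form_eq[OF FH]
      proof (intro integral_mono H01_mult_integrable \<nu> FH D)
        fix x
        have "F n x * D x \<le> \<bar>F n x\<bar> * \<bar>D x\<bar>" by (simp add: abs_mult[symmetric])
        also have "\<dots> \<le> 1 * \<delta>" using F1 \<delta> by (intro mult_mono) auto
        finally show "F n x * D x \<le> \<delta>" by simp
      qed auto
      ultimately show ?thesis
        using mass_form_nonneg[of \<nu> D] Fq[of n] unfolding D_def[symmetric] \<delta>_def[symmetric]
        by (simp add: c_def)
    qed
    have "(\<lambda>n. M - 1 / real (Suc n) - 2 * c * sqrt (energy (\<lambda>x. F n x - h x)))
        \<longlonglongrightarrow> M - 0 - 2 * c * sqrt 0"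
      by (intro tendsto_intros inv0 lim)
    then have "(\<lambda>n. M - 1 / real (Suc n) - 2 * c * sqrt (energy (\<lambda>x. F n x - h x)))
        \<longlonglongrightarrow> M"
      by simp
    then show ?thesis
      by (rule LIMSEQ_le_const2) (use * in blast)
  qed
  have hE: "energy h \<le> 1"
    by (rule energy_limit_le[OF FH h lim FE tendsto_const])
  have "M * energy h \<le> M" using hE M0 by (simp add: mult_left_le)
  then have "mass \<nu> h = M * energy h"
    using homog[OF hU] hq by simp
  then show thesis
    using hU hq M0 homog by (intro that[of h M]) auto
qed

lemma quadratic_nonneg_imp_linear_zero:
  fixes p q :: real
  assumes "\<And>t. 0 \<le> 2 * t * p + t\<^sup>2 * q"
  shows "p = 0"
proof (rule ccontr)
  assume p: "p \<noteq> 0"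
  \<comment> \<open>Since \<open>d\<close> exceeds \<open>q\<close>, the quadratic term at
    \<open>t = - p / d\<close> is at most \<open>- t * p\<close>, half of what the linear term takes
    away.\<close>
  define d where "d = \<bar>q\<bar> + 1"
  define t where "t = - p / d"
  have d: "d > 0" by (simp add: d_def)
  have td: "t * d = - p" using d by (simp add: t_def)
  have "t\<^sup>2 * q \<le> t\<^sup>2 * d" by (intro mult_left_mono) (auto simp: d_def)
  also have "\<dots> = t * (t * d)" by (simp add: power2_eq_square)
  finally have "0 \<le> t * p" using assms[of t] unfolding td by simp
  moreover have "t * p = - (p\<^sup>2 / d)" by (simp add: t_def power2_eq_square)
  moreover have "p\<^sup>2 / d > 0" using p d by simp
  ultimately show False by simp
qed

text \<open>First variation: \<open>M * energy - mass\<close> is a non-negative quadratic form on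
  \<open>U\<close> that vanishes at \<open>h\<close>, so its linear part in every direction
  \<open>u\<close> vanishes.\<close>

lemma maximizer_weak_equation:
  assumes \<nu>: "nonzero_finite_borel \<nu>" and U: "U \<subseteq> H01"
    and lin: "\<And>f g a b. f \<in> U \<Longrightarrow> g \<in> U \<Longrightarrow> (\<lambda>x. a * f x + b * g x) \<in> U"
    and h: "h \<in> U" "mass \<nu> h = M * energy h"
    and max: "\<And>u. u \<in> U \<Longrightarrow> mass \<nu> u \<le> M * energy u"
    and u: "u \<in> U"
  shows "mass_form \<nu> h u = M * energy_form h u"
proof -
  have hH: "h \<in> H01" and uH: "u \<in> H01" using h u U by auto
  have "M * energy_form h u - mass_form \<nu> h u = 0"
  proof (rule quadratic_nonneg_imp_linear_zero)
    fix t
    have "mass \<nu> (\<lambda>x. 1 * h x + t * u x) \<le>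
        M * energy (\<lambda>x. 1 * h x + t * u x)"
      by (rule max[OF lin[OF h(1) u]])
    then show "0 \<le> 2 * t * (M * energy_form h u - mass_form \<nu> h u) + t\<^sup>2 * (M * energy u - mass \<nu> u)"
      unfolding mass_form_lincomb_square[OF \<nu> hH uH] energy_lincomb_square[OF hH uH]
      using h(2) by (simp add: algebra_simps)
  qed
  then show ?thesis by simp
qed

section \<open>Eigenvalue counting by Rayleigh quotients\<close>

text \<open>Gaussian elimination with a pivot \<open>p\<close>. This is the dimension count of the
  min-max arguments: a family with more members than there are constraints has a nontrivial
  combination that meets all of them.\<close>

lemma homogeneous_system_solvable:
  fixes A :: "'i \<Rightarrow> 'j \<Rightarrow> 'a :: field"
  assumes "finite J" "finite I" "card J < card I"
  shows "\<exists>c. (\<exists>i\<in>I. c i \<noteq> 0) \<and> (\<forall>j\<in>J. (\<Sum>i\<in>I. c i * A i j) = 0)"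
  using assms
proof (induction J arbitrary: I A rule: finite_induct)
  case empty
  then have "I \<noteq> {}" by auto
  then show ?case by (intro exI[of _ "\<lambda>_. 1"]) auto
next
  case (insert j J)
  show ?case
  proof (cases "\<forall>i\<in>I. A i j = 0")
    case True
    then show ?thesis
      using insert.IH[of I A] insert.prems insert.hyps by auto
  next
    case False
    then obtain p where p: "p \<in> I" "A p j \<noteq> 0" by auto
    define I' where "I' = I - {p}"
    define A' where "A' i k = A i k - A i j / A p j * A p k" for i k
    have fin: "finite I'" using insert.prems by (simp add: I'_def)
    have "card J < card I'"
      using insert.prems insert.hyps p by (simp add: I'_def card_Diff_singleton)
    then obtain c where c: "\<exists>i\<in>I'. c i \<noteq> 0" "\<forall>k\<in>J. (\<Sum>i\<in>I'. c i * A' i k) = 0"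
      using insert.IH[of I' A'] fin by blast
    define s where "s = (\<Sum>i\<in>I'. c i * A i j) / A p j"
    define d where "d i = (if i = p then - s else c i)" for i
    have split: "(\<Sum>i\<in>I. d i * A i k) = (\<Sum>i\<in>I'. c i * A i k) - s * A p k" for k
    proof -
      have "I = insert p I'" "p \<notin> I'" using p by (auto simp: I'_def)
      then have "(\<Sum>i\<in>I. d i * A i k) = d p * A p k + (\<Sum>i\<in>I'. d i * A i k)"
        using fin by simp
      moreover have "(\<Sum>i\<in>I'. d i * A i k) = (\<Sum>i\<in>I'. c i * A i k)"
        by (rule sum.cong) (auto simp: d_def I'_def)
      ultimately show ?thesis by (simp add: d_def)
    qed
    have "(\<Sum>i\<in>I. d i * A i k) = 0" if "k \<in> insert j J" for k
    proof (cases "k = j")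
      case True
      then show ?thesis using p by (simp add: split s_def)
    next
      case False
      then have "(\<Sum>i\<in>I'. c i * A' i k) = 0" using c that by auto
      then have "(\<Sum>i\<in>I'. c i * A i k) = (\<Sum>i\<in>I'. c i * (A i j / A p j * A p k))"
        by (simp add: A'_def right_diff_distrib sum_subtractf)
      also have "\<dots> = s * A p k"
        by (simp add: s_def sum_divide_distrib sum_distrib_left sum_distrib_right mult_ac)
      finally show ?thesis by (simp add: split)
    qed
    moreover have "\<exists>i\<in>I. d i \<noteq> 0"
      using c(1) by (auto simp: d_def I'_def)
    ultimately show ?thesis by blast
  qed
qed

lemma sum_fun_apply: "(\<Sum>i\<in>I. (f i :: 'b \<Rightarrow> 'a :: comm_monoid_add)) x = (\<Sum>i\<in>I. f i x)"
  by (induction I rule: infinite_finite_induct) auto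

lemma real_fun_independent_iff:
  assumes "finite B"
  shows "real_fun.independent B \<longleftrightarrow>
    (\<forall>c. (\<exists>b\<in>B. c b \<noteq> 0) \<longrightarrow> (\<lambda>x. \<Sum>b\<in>B. c b * b x) \<noteq> (\<lambda>x. 0))"
proof -
  have "(\<Sum>b\<in>B. (\<lambda>x. c b * b x)) = (\<lambda>x. \<Sum>b\<in>B. c b * b x)" for c :: "(real \<Rightarrow> real) \<Rightarrow> real"
    by (rule ext) (rule sum_fun_apply)
  then show ?thesis
    using real_fun.dependent_finite[OF assms] by (auto simp: func_zero)
qed

section \<open>Eigenspaces and multiplicities\<close>

lemma eigenspace_H01: "f \<in> eigenspace \<nu> \<mu> \<Longrightarrow> f \<in> H01"
  by (auto simp: eigenspace_def dom_form_H01)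

lemma eigenspace_dom: "f \<in> eigenspace \<nu> \<mu> \<Longrightarrow> f \<in> dom_form \<nu>"
  by (simp add: eigenspace_def)

lemma eigenspace_eq: "f \<in> eigenspace \<nu> \<mu> \<Longrightarrow> g \<in> dom_form \<nu> \<Longrightarrow> energy_form f g = \<mu> * mass_form \<nu> f g"
  by (simp add: eigenspace_def mass_form_def)

lemma eigenspaceI:
  "f \<in> dom_form \<nu> \<Longrightarrow> (\<And>g. g \<in> dom_form \<nu> \<Longrightarrow> energy_form f g = \<mu> * mass_form \<nu> f g) \<Longrightarrow> f \<in> eigenspace \<nu> \<mu>"
  by (simp add: eigenspace_def mass_form_def)

lemma eigenspace_sum:
  assumes "nonzero_finite_borel \<nu>" "\<And>i. i \<in> I \<Longrightarrow> f i \<in> eigenspace \<nu> \<mu>"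
  shows "(\<lambda>x. \<Sum>i\<in>I. c i * f i x) \<in> eigenspace \<nu> \<mu>"
proof (rule eigenspaceI)
  show "(\<lambda>x. \<Sum>i\<in>I. c i * f i x) \<in> dom_form \<nu>"
    using assms(2) by (intro dom_form_sum eigenspace_dom)
  fix g assume g: "g \<in> dom_form \<nu>"
  have H: "f i \<in> H01" if "i \<in> I" for i using assms(2)[OF that] by (rule eigenspace_H01)
  show "energy_form (\<lambda>x. \<Sum>i\<in>I. c i * f i x) g = \<mu> * mass_form \<nu> (\<lambda>x. \<Sum>i\<in>I. c i * f i x) g"
    using eigenspace_eq[OF assms(2) g]
    by (simp add: energy_sum[OF H dom_form_H01[OF g]] mass_form_sum[OF assms(1) H dom_form_H01[OF g]]
        sum_distrib_left mult_ac)
qed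

lemma eigenspace_lincomb:
  assumes "nonzero_finite_borel \<nu>" "f \<in> eigenspace \<nu> \<mu>" "g \<in> eigenspace \<nu> \<mu>"
  shows "(\<lambda>x. a * f x + b * g x) \<in> eigenspace \<nu> \<mu>"
  using eigenspace_sum[OF assms(1), of "UNIV :: bool set" "\<lambda>i. if i then f else g" \<mu> "\<lambda>i. if i then a else b"] assms
  by (simp add: UNIV_bool add.commute)

lemma eigenspace_orthogonal:
  assumes "f \<in> eigenspace \<nu> \<mu>'" "g \<in> eigenspace \<nu> \<mu>" "\<mu>' \<noteq> \<mu>"
  shows "mass_form \<nu> f g = 0" "energy_form f g = 0"
proof -
  have "energy_form f g = \<mu>' * mass_form \<nu> f g" "energy_form f g = \<mu> * mass_form \<nu> f g"
    using eigenspace_eq[OF assms(1) eigenspace_dom[OF assms(2)]]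
      eigenspace_eq[OF assms(2) eigenspace_dom[OF assms(1)]]
    by (simp_all add: energy_sym[of g f] mass_form_sym[of \<nu> g f])
  then show "mass_form \<nu> f g = 0" using assms(3) by auto
  then show "energy_form f g = 0" using \<open>energy_form f g = \<mu>' * mass_form \<nu> f g\<close> by simp
qed

text \<open>The energy is positive definite on \<open>H01\<close> and equals \<open>\<mu>\<close>
  times a non-negative mass, so neither factor can vanish.\<close>

lemma eigenfunction_positive:
  assumes "f \<in> eigenspace \<nu> \<mu>" "f \<noteq> (\<lambda>x. 0)"
  shows "\<mu> > 0" "mass \<nu> f > 0"
proof -
  have "energy f > 0"
    using energy_eq_0[OF eigenspace_H01[OF assms(1)]] assms(2) by force
  then have "\<mu> * mass \<nu> f > 0"
    using eigenspace_eq[OF assms(1) eigenspace_dom[OF assms(1)]] by simp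
  then show "\<mu> > 0" "mass \<nu> f > 0"
    using mass_form_nonneg[of \<nu> f] by (auto simp: zero_less_mult_iff)
qed

lemma enat_le_multiplicity:
  assumes "finite B" "B \<subseteq> eigenspace \<nu> \<mu>" "real_fun.independent B"
  shows "enat (card B) \<le> multiplicity_eigen \<nu> \<mu>"
proof (cases "\<exists>S. finite S \<and> eigenspace \<nu> \<mu> \<subseteq> real_fun.span S")
  case True
  then obtain S where S: "finite S" "eigenspace \<nu> \<mu> \<subseteq> real_fun.span S" by auto
  obtain C where C: "C \<subseteq> eigenspace \<nu> \<mu>" "real_fun.independent C" "eigenspace \<nu> \<mu> \<subseteq> real_fun.span C"
    "card C = real_fun.dim (eigenspace \<nu> \<mu>)"
    using real_fun.basis_exists by blast
  have "finite C"
    using real_fun.independent_span_bound[OF S(1) C(2)] C(1) S(2) by blast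
  then have "card B \<le> card C"
    using real_fun.independent_span_bound[of C B] assms C by blast
  then show ?thesis using True C by (auto simp: multiplicity_eigen_def)
next
  case False
  then show ?thesis by (simp only: multiplicity_eigen_def if_False) simp
qed

text \<open>With infinite multiplicity no finite set spans the eigenspace, so an independent set can
  always be enlarged by one vector.\<close>

lemma independent_of_multiplicity:
  assumes "enat j \<le> multiplicity_eigen \<nu> \<mu>"
  obtains B where "finite B" "B \<subseteq> eigenspace \<nu> \<mu>" "real_fun.independent B" "card B = j"
proof (cases "\<exists>S. finite S \<and> eigenspace \<nu> \<mu> \<subseteq> real_fun.span S")
  case True
  then obtain S where S: "finite S" "eigenspace \<nu> \<mu> \<subseteq> real_fun.span S" by auto
  obtain C where C: "C \<subseteq> eigenspace \<nu> \<mu>" "real_fun.independent C" "eigenspace \<nu> \<mu> \<subseteq> real_fun.span C"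
    "card C = real_fun.dim (eigenspace \<nu> \<mu>)"
    using real_fun.basis_exists by blast
  have fin: "finite C"
    using real_fun.independent_span_bound[OF S(1) C(2)] C(1) S(2) by blast
  have "j \<le> card C" using assms True C(4) by (auto simp: multiplicity_eigen_def)
  then obtain B where B: "B \<subseteq> C" "card B = j" "finite B"
    by (rule obtain_subset_with_card_n)
  show thesis
    by (rule that[OF B(3) order_trans[OF B(1) C(1)] real_fun.independent_mono[OF C(2) B(1)] B(2)])
next
  case False
  have "\<exists>B. finite B \<and> B \<subseteq> eigenspace \<nu> \<mu> \<and> real_fun.independent B \<and> card B = j"
  proof (induction j)
    case 0
    show ?case by (intro exI[of _ "{}"]) (simp add: real_fun.independent_empty)
  next
    case (Suc j)
    then obtain B where B: "finite B" "B \<subseteq> eigenspace \<nu> \<mu>" "real_fun.independent B" "card B = j"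
      by blast
    then obtain v where v: "v \<in> eigenspace \<nu> \<mu>" "v \<notin> real_fun.span B"
      using False by blast
    then have "v \<notin> B" using real_fun.span_base by blast
    then show ?case
      using B v real_fun.independent_insertI[OF v(2) B(3)]
      by (intro exI[of _ "insert v B"]) auto
  qed
  then show thesis using that by blast
qed

lemma eigenvalue_count_SUP:
  "eigenvalue_count \<nu> y =
    (SUP L\<in>{L. finite L \<and> L \<subseteq> {\<mu>. is_eigenvalue \<nu> \<mu> \<and> \<mu> \<le> y}}. \<Sum>\<mu>\<in>L. multiplicity_eigen \<nu> \<mu>)"
  unfolding eigenvalue_count_def by (rule nonneg_infsum_complete) simp

text \<open>
  Positivity of the mass of all nontrivial combinations makes the family linearly independent, so that the
  eigenvalue count is the largest cardinality of such a family.
\<close>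

definition rayleigh :: "real measure \<Rightarrow> real \<Rightarrow> 'i set \<Rightarrow> ('i \<Rightarrow> real \<Rightarrow> real) \<Rightarrow> bool" where
  "rayleigh \<nu> y I \<phi> \<longleftrightarrow> finite I \<and> (\<forall>i\<in>I. \<phi> i \<in> H01) \<and>
    (\<forall>c. (\<exists>i\<in>I. c i \<noteq> 0) \<longrightarrow>
      mass \<nu> (\<lambda>x. \<Sum>i\<in>I. c i * \<phi> i x) > 0 \<and>
      energy (\<lambda>x. \<Sum>i\<in>I. c i * \<phi> i x) \<le>
        y * mass \<nu> (\<lambda>x. \<Sum>i\<in>I. c i * \<phi> i x))"

lemma mass_form_sum_orthogonal:
  assumes \<nu>: "nonzero_finite_borel \<nu>" and fin: "finite L" and H: "\<And>i. i \<in> L \<Longrightarrow> f i \<in> H01"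
    and orth: "\<And>i j. i \<in> L \<Longrightarrow> j \<in> L \<Longrightarrow> i \<noteq> j \<Longrightarrow> mass_form \<nu> (f i) (f j) = 0"
  shows "mass \<nu> (\<lambda>x. \<Sum>i\<in>L. c i * f i x) = (\<Sum>i\<in>L. (c i)\<^sup>2 * mass \<nu> (f i))"
proof -
  have "mass_form \<nu> (f i) (\<lambda>x. \<Sum>i\<in>L. c i * f i x) = c i * mass \<nu> (f i)" if i: "i \<in> L" for i
  proof -
    have "mass_form \<nu> (f i) (\<lambda>x. \<Sum>i\<in>L. c i * f i x) = (\<Sum>j\<in>L. c j * mass_form \<nu> (f j) (f i))"
      by (subst mass_form_sym) (rule mass_form_sum[OF \<nu> H H[OF i]])
    also have "\<dots> = (\<Sum>j\<in>L. if j = i then c i * mass \<nu> (f i) else 0)"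
      by (rule sum.cong) (auto simp: orth i)
    finally show ?thesis using fin i by simp
  qed
  then show ?thesis
    by (subst mass_form_sum[OF \<nu> H H01_sum[OF H]]) (auto simp: power2_eq_square mult.assoc)
qed

lemma energy_sum_orthogonal:
  assumes fin: "finite L" and H: "\<And>i. i \<in> L \<Longrightarrow> f i \<in> H01"
    and orth: "\<And>i j. i \<in> L \<Longrightarrow> j \<in> L \<Longrightarrow> i \<noteq> j \<Longrightarrow> energy_form (f i) (f j) = 0"
  shows "energy (\<lambda>x. \<Sum>i\<in>L. c i * f i x) =
    (\<Sum>i\<in>L. (c i)\<^sup>2 * energy (f i))"
proof -
  have "energy_form (f i) (\<lambda>x. \<Sum>i\<in>L. c i * f i x) = c i * energy (f i)" if i: "i \<in> L" for i
  proof -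
    have "energy_form (f i) (\<lambda>x. \<Sum>i\<in>L. c i * f i x) = (\<Sum>j\<in>L. c j * energy_form (f j) (f i))"
      by (subst energy_sym) (rule energy_sum[OF H H[OF i]])
    also have "\<dots> = (\<Sum>j\<in>L. if j = i then c i * energy (f i) else 0)"
      by (rule sum.cong) (auto simp: orth i)
    finally show ?thesis using fin i by simp
  qed
  then show ?thesis
    by (subst energy_sum[OF H H01_sum[OF H]]) (auto simp: power2_eq_square mult.assoc)
qed

text \<open>Distinct eigenspaces are orthogonal for both forms, so grouping a combination by
  eigenvalue makes mass and energy additive; inside one group the energy is exactly
  \<open>\<mu>\<close> times the mass. The bases themselves may be arbitrary.\<close>

lemma rayleigh_eigenfunctions:
  assumes \<nu>: "nonzero_finite_borel \<nu>" and L: "finite L" "\<And>\<mu>. \<mu> \<in> L \<Longrightarrow> \<mu> \<le> y"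
    and B: "\<And>\<mu>. \<mu> \<in> L \<Longrightarrow> finite (B \<mu>)" "\<And>\<mu>. \<mu> \<in> L \<Longrightarrow> B \<mu> \<subseteq> eigenspace \<nu> \<mu>"
      "\<And>\<mu>. \<mu> \<in> L \<Longrightarrow> real_fun.independent (B \<mu>)"
  shows "rayleigh \<nu> y (\<Union>\<mu>\<in>L. B \<mu>) (\<lambda>f. f)" "card (\<Union>\<mu>\<in>L. B \<mu>) = (\<Sum>\<mu>\<in>L. card (B \<mu>))"
proof -
  have nz: "b \<noteq> (\<lambda>x. 0)" if "b \<in> B \<mu>" "\<mu> \<in> L" for b \<mu>
    using real_fun.dependent_zero[of "B \<mu>"] B(3)[OF that(2)] that(1) by (auto simp: func_zero)
  have disj: "B \<mu> \<inter> B \<mu>' = {}" if "\<mu> \<in> L" "\<mu>' \<in> L" "\<mu> \<noteq> \<mu>'" for \<mu> \<mu>'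
  proof (rule ccontr)
    assume "\<not> ?thesis"
    then obtain b where b: "b \<in> B \<mu>" "b \<in> B \<mu>'" by auto
    then have "b \<in> eigenspace \<nu> \<mu>" "b \<in> eigenspace \<nu> \<mu>'" using B(2) that by auto
    then have "mass \<nu> b = 0" "mass \<nu> b > 0"
      using eigenspace_orthogonal(1)[of b \<nu> \<mu> b \<mu>'] that
        eigenfunction_positive(2)[OF _ nz[OF b(1) that(1)]] by blast+
    then show False by simp
  qed
  show "card (\<Union>\<mu>\<in>L. B \<mu>) = (\<Sum>\<mu>\<in>L. card (B \<mu>))"
    using L B(1) disj by (intro card_UN_disjoint) auto
  show "rayleigh \<nu> y (\<Union>\<mu>\<in>L. B \<mu>) (\<lambda>f. f)"
    unfolding rayleigh_def
  proof (intro conjI allI impI ballI)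
    show "finite (\<Union>\<mu>\<in>L. B \<mu>)" using L B by auto
    show "f \<in> H01" if "f \<in> (\<Union>\<mu>\<in>L. B \<mu>)" for f using that B(2) eigenspace_H01 by blast
  next
    fix c :: "(real \<Rightarrow> real) \<Rightarrow> real"
    assume "\<exists>i\<in>\<Union>\<mu>\<in>L. B \<mu>. c i \<noteq> 0"
    then obtain b \<mu>0 where b: "\<mu>0 \<in> L" "b \<in> B \<mu>0" "c b \<noteq> 0" by auto
    define F where "F \<mu> = (\<lambda>x. \<Sum>b\<in>B \<mu>. c b * b x)" for \<mu>
    have FE: "F \<mu> \<in> eigenspace \<nu> \<mu>" if "\<mu> \<in> L" for \<mu>
      unfolding F_def using B(2)[OF that] by (intro eigenspace_sum[OF \<nu>]) auto
    note FH = eigenspace_H01[OF FE]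
    have sum: "(\<lambda>x. \<Sum>i\<in>(\<Union>\<mu>\<in>L. B \<mu>). c i * i x) = (\<lambda>x. \<Sum>\<mu>\<in>L. 1 * F \<mu> x)"
      using L B(1) disj by (intro ext) (simp add: F_def sum.UNION_disjoint)
    have q: "mass \<nu> (\<lambda>x. \<Sum>\<mu>\<in>L. 1 * F \<mu> x) = (\<Sum>\<mu>\<in>L. mass \<nu> (F \<mu>))"
      by (subst mass_form_sum_orthogonal[OF \<nu> L(1) FH]) (auto intro: eigenspace_orthogonal FE)
    have e: "energy (\<lambda>x. \<Sum>\<mu>\<in>L. 1 * F \<mu> x) = (\<Sum>\<mu>\<in>L. energy (F \<mu>))"
      by (subst energy_sum_orthogonal[OF L(1) FH]) (auto intro: eigenspace_orthogonal FE)
    have "F \<mu>0 \<noteq> (\<lambda>x. 0)"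
      unfolding F_def using B(3)[OF b(1)] b real_fun_independent_iff[OF B(1)[OF b(1)]] by blast
    then have "mass \<nu> (F \<mu>0) > 0"
      by (rule eigenfunction_positive(2)[OF FE[OF b(1)]])
    then have "(\<Sum>\<mu>\<in>L. mass \<nu> (F \<mu>)) > 0"
      using L b by (intro sum_pos2) (auto simp: mass_form_nonneg)
    then show "0 < mass \<nu> (\<lambda>x. \<Sum>i\<in>(\<Union>\<mu>\<in>L. B \<mu>). c i * i x)"
      unfolding sum q .
    have "(\<Sum>\<mu>\<in>L. energy (F \<mu>)) \<le> (\<Sum>\<mu>\<in>L. y * mass \<nu> (F \<mu>))"
    proof (rule sum_mono)
      fix \<mu> assume "\<mu> \<in> L"
      then show "energy (F \<mu>) \<le> y * mass \<nu> (F \<mu>)"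
        using eigenspace_eq[OF FE eigenspace_dom[OF FE]] L(2) mass_form_nonneg by (simp add: mult_right_mono)
    qed
    then show "energy (\<lambda>x. \<Sum>i\<in>(\<Union>\<mu>\<in>L. B \<mu>). c i * i x) \<le>
        y * mass \<nu> (\<lambda>x. \<Sum>i\<in>(\<Union>\<mu>\<in>L. B \<mu>). c i * i x)"
      unfolding sum q e by (simp add: sum_distrib_left)
  qed
qed

text \<open>The upper half of min-max: bases of finitely many eigenspaces together form a Rayleigh
  family.\<close>

lemma eigenvalue_count_le:
  assumes \<nu>: "nonzero_finite_borel \<nu>"
    and bound: "\<And>B :: (real \<Rightarrow> real) set. rayleigh \<nu> y B (\<lambda>f. f) \<Longrightarrow> card B \<le> k"
  shows "eigenvalue_count \<nu> y \<le> enat k"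
  unfolding eigenvalue_count_SUP
proof (rule SUP_least)
  fix L assume "L \<in> {L. finite L \<and> L \<subseteq> {\<mu>. is_eigenvalue \<nu> \<mu> \<and> \<mu> \<le> y}}"
  then have L: "finite L" "\<And>\<mu>. \<mu> \<in> L \<Longrightarrow> \<mu> \<le> y" by auto
  \<comment> \<open>Infinite multiplicities are excluded first, since afterwards a full basis of
    each eigenspace is chosen.\<close>
  have "multiplicity_eigen \<nu> \<mu> \<le> enat k" if "\<mu> \<in> L" for \<mu>
  proof (rule ccontr)
    assume "\<not> ?thesis"
    then have "enat (Suc k) \<le> multiplicity_eigen \<nu> \<mu>"
      by (metis eSuc_enat ileI1 not_le)
    then obtain B where B: "finite B" "B \<subseteq> eigenspace \<nu> \<mu>" "real_fun.independent B" "card B = Suc k"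
      by (rule independent_of_multiplicity)
    have "rayleigh \<nu> y B (\<lambda>f. f)"
      using rayleigh_eigenfunctions(1)[OF \<nu>, of "{\<mu>}" y "\<lambda>_. B"] B L(2)[OF that] by simp
    then show False using bound B(4) by fastforce
  qed
  then have "\<forall>\<mu>\<in>L. \<exists>m. multiplicity_eigen \<nu> \<mu> = enat m"
    using enat_ile by blast
  then obtain m where m: "\<And>\<mu>. \<mu> \<in> L \<Longrightarrow> multiplicity_eigen \<nu> \<mu> = enat (m \<mu>)"
    by metis
  have "\<forall>\<mu>\<in>L. \<exists>B. finite B \<and> B \<subseteq> eigenspace \<nu> \<mu> \<and> real_fun.independent B \<and> card B = m \<mu>"
    using independent_of_multiplicity m by (metis order_refl)
  then obtain B where B: "\<And>\<mu>. \<mu> \<in> L \<Longrightarrow> finite (B \<mu>) \<and> B \<mu> \<subseteq> eigenspace \<nu> \<mu> \<and> real_fun.independent (B \<mu>) \<and> card (B \<mu>) = m \<mu>"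
    by metis
  have "(\<Sum>\<mu>\<in>L. m \<mu>) = card (\<Union>\<mu>\<in>L. B \<mu>)"
    using rayleigh_eigenfunctions(2)[OF \<nu> L, of B] B by simp
  also have "\<dots> \<le> k"
    using rayleigh_eigenfunctions(1)[OF \<nu> L, of B] B by (intro bound) auto
  finally have "enat (\<Sum>\<mu>\<in>L. m \<mu>) \<le> enat k" by simp
  moreover have "(\<Sum>\<mu>\<in>L. multiplicity_eigen \<nu> \<mu>) = enat (\<Sum>\<mu>\<in>L. m \<mu>)"
    using m by (simp add: of_nat_eq_enat[symmetric])
  ultimately show "(\<Sum>\<mu>\<in>L. multiplicity_eigen \<nu> \<mu>) \<le> enat k" by simp
qed

text \<open>With mass 1 the eigenvalue of \<open>e\<close> is its energy, so no separate list of
  eigenvalues has to be carried along.\<close>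

definition orthonormal_eigenfunctions :: "real measure \<Rightarrow> real \<Rightarrow> (real \<Rightarrow> real) set \<Rightarrow> bool" where
  "orthonormal_eigenfunctions \<nu> y F \<longleftrightarrow> finite F \<and>
     (\<forall>e\<in>F. mass \<nu> e = 1 \<and> energy e \<le> y \<and> e \<in> eigenspace \<nu> (energy e)) \<and>
     (\<forall>e\<in>F. \<forall>e'\<in>F. e \<noteq> e' \<longrightarrow> mass_form \<nu> e e' = 0)"

lemma card_orthonormal_eigenfunctions:
  assumes \<nu>: "nonzero_finite_borel \<nu>" and F: "orthonormal_eigenfunctions \<nu> y F"
  shows "enat (card F) \<le> eigenvalue_count \<nu> y"
proof -
  define L where "L = (\<lambda>e. energy e) ` F"
  define B where "B \<mu> = {e \<in> F. energy e = \<mu>}" for \<mu>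
  have fin: "finite F" using F by (simp add: orthonormal_eigenfunctions_def)
  have "card F = (\<Sum>\<mu>\<in>L. card (B \<mu>))"
    using sum.image_gen[OF fin, of "\<lambda>_. 1::nat" "\<lambda>e. energy e"] by (simp add: L_def B_def)
  then have "enat (card F) = (\<Sum>\<mu>\<in>L. enat (card (B \<mu>)))"
    by (simp add: of_nat_eq_enat[symmetric])
  also have "\<dots> \<le> (\<Sum>\<mu>\<in>L. multiplicity_eigen \<nu> \<mu>)"
  proof (rule sum_mono, rule enat_le_multiplicity)
    fix \<mu> assume "\<mu> \<in> L"
    show finB: "finite (B \<mu>)" using fin by (simp add: B_def)
    show sub: "B \<mu> \<subseteq> eigenspace \<nu> \<mu>"
      using F by (auto simp: B_def orthonormal_eigenfunctions_def)
    show "real_fun.independent (B \<mu>)"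
      unfolding real_fun_independent_iff[OF finB]
    proof (intro allI impI notI)
      fix c :: "(real \<Rightarrow> real) \<Rightarrow> real"
      assume "\<exists>b\<in>B \<mu>. c b \<noteq> 0" and 0: "(\<lambda>x. \<Sum>b\<in>B \<mu>. c b * b x) = (\<lambda>x. 0)"
      then obtain b where b: "b \<in> B \<mu>" "c b \<noteq> 0" by auto
      have BH: "e \<in> H01" if "e \<in> B \<mu>" for e using sub that eigenspace_H01 by blast
      have "mass \<nu> (\<lambda>x. \<Sum>b\<in>B \<mu>. c b * b x) =
          (\<Sum>e\<in>B \<mu>. (c e)\<^sup>2 * mass \<nu> e)"
        by (rule mass_form_sum_orthogonal[where f = "\<lambda>e. e", OF \<nu> finB BH])
          (use F in \<open>auto simp: orthonormal_eigenfunctions_def B_def\<close>)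
      then have "0 = (\<Sum>e\<in>B \<mu>. (c e)\<^sup>2 * mass \<nu> e)"
        unfolding 0 mass_form_zero .
      moreover have "(\<Sum>e\<in>B \<mu>. (c e)\<^sup>2 * mass \<nu> e) > 0"
        using b F finB by (intro sum_pos2[of _ b])
          (auto simp: mass_form_nonneg orthonormal_eigenfunctions_def B_def)
      ultimately show False by simp
    qed
  qed
  also have "\<dots> \<le> eigenvalue_count \<nu> y"
    unfolding eigenvalue_count_SUP
  proof (rule SUP_upper, intro CollectI conjI)
    show "finite L" using fin by (simp add: L_def)
    show "L \<subseteq> {\<mu>. is_eigenvalue \<nu> \<mu> \<and> \<mu> \<le> y}"
    proof
      fix \<mu> assume "\<mu> \<in> L"
      then obtain e where e: "e \<in> F" "\<mu> = energy e" by (auto simp: L_def)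
      have "e \<noteq> 0"
        using F e(1) mass_form_zero[of \<nu> e] by (auto simp: orthonormal_eigenfunctions_def func_zero)
      then show "\<mu> \<in> {\<mu>. is_eigenvalue \<nu> \<mu> \<and> \<mu> \<le> y}"
        using F e by (auto simp: orthonormal_eigenfunctions_def is_eigenvalue_def)
    qed
  qed
  finally show ?thesis .
qed

text \<open>The bound by \<open>n\<close> yields an orthonormal system \<open>F\<close> of maximal
  size. If the gap failed somewhere on the complement \<open>U\<close> of \<open>F\<close>, the
  maximiser of the mass there would be an eigenfunction with eigenvalue at most \<open>y\<close>,
  and adding it to \<open>F\<close> would contradict maximality.\<close>

lemma spectral_gap:
  assumes \<nu>: "nonzero_finite_borel \<nu>" and count: "eigenvalue_count \<nu> y = enat n"
  obtains F where "finite F" "card F \<le> n" "F \<subseteq> H01"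
    "\<And>f. f \<in> H01 \<Longrightarrow> (\<And>e. e \<in> F \<Longrightarrow> mass_form \<nu> f e = 0) \<Longrightarrow> mass \<nu> f > 0 \<Longrightarrow> y * mass \<nu> f < energy f"
proof -
  define P where "P k \<longleftrightarrow> (\<exists>F. orthonormal_eigenfunctions \<nu> y F \<and> card F = k)" for k
  have "P 0" unfolding P_def orthonormal_eigenfunctions_def by (intro exI[of _ "{}"]) simp
  moreover have le: "k \<le> n" if "P k" for k
    using card_orthonormal_eigenfunctions[OF \<nu>, of y] that count by (auto simp: P_def)
  ultimately obtain F where F: "orthonormal_eigenfunctions \<nu> y F" "P (card F)"
    and max: "\<And>k. P k \<Longrightarrow> k \<le> card F"
    using Greatest_le_nat[of P _ n] GreatestI_nat[of P 0 n] P_def by (metis (full_types))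
  have FE: "e \<in> eigenspace \<nu> (energy e)" "mass \<nu> e = 1" "energy e \<le> y" if "e \<in> F" for e
    using F that by (auto simp: orthonormal_eigenfunctions_def)
  have fin: "finite F" using F by (simp add: orthonormal_eigenfunctions_def)
  have FH: "e \<in> H01" if "e \<in> F" for e using FE(1)[OF that] by (rule eigenspace_H01)
  define U where "U = {u \<in> dom_form \<nu>. \<forall>e\<in>F. mass_form \<nu> u e = 0}"
  have UH: "U \<subseteq> H01" by (auto simp: U_def dom_form_H01)
  have lin: "(\<lambda>x. a * f x + b * g x) \<in> U" if "f \<in> U" "g \<in> U" for f g a b
    using that dom_form_lincomb mass_form_lincomb[OF \<nu> _ _ FH] by (auto simp: U_def dom_form_H01)
  have closed: "G \<in> U" if u: "\<And>n. u n \<in> U" and G: "G \<in> H01"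
    and lim: "(\<lambda>n. energy (\<lambda>x. u n x - G x)) \<longlonglongrightarrow> 0" for u G
  proof -
    have uH: "u n \<in> H01" and ud: "u n \<in> dom_form \<nu>" for n using u[of n] UH by (auto simp: U_def)
    have "G \<in> dom_form \<nu>"
      by (rule dom_form_closed[OF ud G energy_limit_pointwise[OF uH G lim]])
    moreover have "mass_form \<nu> G e = 0" if e: "e \<in> F" for e
    proof -
      \<comment> \<open>Cauchy-Schwarz for the mass form against the unit vector \<open>e\<close>,
        read off from the non-negative mass of \<open>D\<close> plus a multiple of
        \<open>e\<close>.\<close>
      have "(mass_form \<nu> G e)\<^sup>2 \<le> measure \<nu> (space \<nu>) * energy (\<lambda>x. u n x - G x)" for n
      proof -
        define D where "D = (\<lambda>x. u n x - G x)"
        have D: "D \<in> H01" unfolding D_def by (rule H01_diff[OF uH G])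
        have "mass_form \<nu> D e = mass_form \<nu> (u n) e - mass_form \<nu> G e"
          using mass_form_lincomb[OF \<nu> uH G FH[OF e], of 1 n "-1"] by (simp add: D_def)
        then have De: "mass_form \<nu> D e = - mass_form \<nu> G e" using u[of n] e by (simp add: U_def)
        have "0 \<le> mass \<nu> (\<lambda>x. 1 * D x + (mass_form \<nu> G e) * e x)"
          by (rule mass_form_nonneg)
        also have "\<dots> = mass \<nu> D - (mass_form \<nu> G e)\<^sup>2"
          unfolding mass_form_lincomb_square[OF \<nu> D FH[OF e]] De FE(2)[OF e] by (simp add: power2_eq_square)
        also have "\<dots> \<le> energy D * measure \<nu> (space \<nu>) - (mass_form \<nu> G e)\<^sup>2"
          using mass_form_le_sup[OF \<nu> D H01_bound[OF D]] by simp
        finally show ?thesis by (simp add: D_def mult.commute)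
      qed
      moreover have "(\<lambda>n. measure \<nu> (space \<nu>) * energy (\<lambda>x. u n x - G x)) \<longlonglongrightarrow> 0"
        using tendsto_mult_left[OF lim] by simp
      ultimately have "(mass_form \<nu> G e)\<^sup>2 \<le> 0"
        using LIMSEQ_le_const by blast
      then show ?thesis by simp
    qed
    ultimately show ?thesis by (simp add: U_def)
  qed
  have gapU: "y * mass \<nu> u < energy u" if u: "u \<in> U" "mass \<nu> u > 0" for u
  proof (rule ccontr)
    assume neg: "\<not> ?thesis"
    obtain h M where h: "h \<in> U" "mass \<nu> h > 0" "mass \<nu> h = M * energy h"
      and hmax: "\<And>u. u \<in> U \<Longrightarrow> mass \<nu> u \<le> M * energy u"
    proof (rule energy_maximizer[OF \<nu> UH])
      show "(\<lambda>x. a * f x + b * g x) \<in> U" if "f \<in> U" "g \<in> U" for f g a b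
        using that by (rule lin)
      show "G \<in> U" if "\<And>n. v n \<in> U" "G \<in> H01"
        "(\<lambda>n. energy (\<lambda>x. v n x - G x)) \<longlonglongrightarrow> 0" for v G
        using that by (rule closed)
    qed (use u in auto)
    have M: "M > 0"
      using h energy_nonneg[of h] by (metis mult_nonpos_nonneg not_le)
    \<comment> \<open>\<open>M\<close> is at least the quotient of mass by energy of
      \<open>u\<close>, which is at least \<open>1 / y\<close>; hence the eigenvalue
      \<open>1 / M\<close> is at most \<open>y\<close>.\<close>
    have "energy u \<le> y * (M * energy u)"
    proof -
      have upos: "0 < M * energy u" using hmax[OF u(1)] u(2) by simp
      then have "0 < energy u" using M by (simp add: zero_less_mult_iff)
      then have "y * mass \<nu> u > 0" using neg by simp
      then have "y > 0" using u(2) by (simp add: zero_less_mult_iff)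
      then have "y * mass \<nu> u \<le> y * (M * energy u)"
        using hmax[OF u(1)] by (intro mult_left_mono) auto
      then show ?thesis using neg by simp
    qed
    moreover have "energy u > 0"
      using hmax[OF u(1)] u(2) M energy_nonneg[of u] by (metis less_le_trans mult_zero_right order_less_le)
    ultimately have yM: "1 / M \<le> y" using M by (simp add: field_simps)
    have hd: "h \<in> dom_form \<nu>" and hH: "h \<in> H01" using h UH by (auto simp: U_def)
    have eig: "h \<in> eigenspace \<nu> (1 / M)"
    proof (rule eigenspaceI[OF hd])
      fix g assume g: "g \<in> dom_form \<nu>"
      \<comment> \<open>The weak equation for \<open>h\<close> holds only against \<open>U\<close>.
        Removing from \<open>g\<close> its components along \<open>F\<close> lands in
        \<open>U\<close>, and \<open>h\<close> is orthogonal to these components for both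
        forms.\<close>
      define p where "p = (\<lambda>x. \<Sum>e\<in>F. mass_form \<nu> g e * e x)"
      have pd: "p \<in> dom_form \<nu>" unfolding p_def by (intro dom_form_sum eigenspace_dom[OF FE(1)])
      have gp: "(\<lambda>x. 1 * g x + (-1) * p x) \<in> U"
        unfolding U_def
      proof (intro CollectI conjI ballI)
        show "(\<lambda>x. 1 * g x + (-1) * p x) \<in> dom_form \<nu>" by (rule dom_form_lincomb[OF g pd])
        fix e assume e: "e \<in> F"
        have "mass_form \<nu> p e = (\<Sum>e'\<in>F. mass_form \<nu> g e' * mass_form \<nu> e' e)"
          unfolding p_def by (rule mass_form_sum[where f = "\<lambda>e. e", OF \<nu> FH FH[OF e]])
        also have "\<dots> = (\<Sum>e'\<in>F. if e' = e then mass_form \<nu> g e else 0)"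
          using F e by (intro sum.cong) (auto simp: orthonormal_eigenfunctions_def)
        also have "\<dots> = mass_form \<nu> g e" using fin e by simp
        finally show "mass_form \<nu> (\<lambda>x. 1 * g x + (-1) * p x) e = 0"
          unfolding mass_form_lincomb[OF \<nu> dom_form_H01[OF g] dom_form_H01[OF pd] FH[OF e]] by simp
      qed
      have he: "mass_form \<nu> h e = 0" "energy_form h e = 0" if "e \<in> F" for e
      proof -
        show "mass_form \<nu> h e = 0" using h(1) that by (simp add: U_def)
        then show "energy_form h e = 0"
          using eigenspace_eq[OF FE(1)[OF that] hd] by (simp add: energy_sym[of h] mass_form_sym[of \<nu> h])
      qed
      have hp: "mass_form \<nu> h p = 0" "energy_form h p = 0"
      proof -
        have "mass_form \<nu> p h = (\<Sum>e\<in>F. mass_form \<nu> g e * mass_form \<nu> e h)"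
          unfolding p_def by (rule mass_form_sum[where f = "\<lambda>e. e", OF \<nu> FH hH])
        then show "mass_form \<nu> h p = 0" using he(1) by (simp add: mass_form_sym[of \<nu> h])
        have "energy_form p h = (\<Sum>e\<in>F. mass_form \<nu> g e * energy_form e h)"
          unfolding p_def by (rule energy_sum[where f = "\<lambda>e. e", OF FH hH])
        then show "energy_form h p = 0" using he(2) by (simp add: energy_sym[of h])
      qed
      have "mass_form \<nu> h (\<lambda>x. 1 * g x + (-1) * p x) = M * energy_form h (\<lambda>x. 1 * g x + (-1) * p x)"
        by (rule maximizer_weak_equation[OF \<nu> UH _ h(1,3) _ gp]) (erule (1) lin, erule hmax)
      moreover have "mass_form \<nu> h (\<lambda>x. 1 * g x + (-1) * p x) = mass_form \<nu> h g"
        using mass_form_lincomb[OF \<nu> dom_form_H01[OF g] dom_form_H01[OF pd] hH, of 1 "-1"] hp(1)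
        by (simp add: mass_form_sym[of \<nu> _ h])
      moreover have "energy_form h (\<lambda>x. 1 * g x + (-1) * p x) = energy_form h g"
        using energy_lincomb_right[OF dom_form_H01[OF g] dom_form_H01[OF pd] hH, of 1 "-1"] hp(2)
        by simp
      ultimately show "energy_form h g = 1 / M * mass_form \<nu> h g" using M by (simp add: field_simps)
    qed
    define s where "s = 1 / sqrt (mass \<nu> h)"
    define v where "v = (\<lambda>x. s * h x + 0 * h x)"
    have s: "s\<^sup>2 * mass \<nu> h = 1" using h(2) by (simp add: s_def power_divide)
    have vH: "v \<in> H01" unfolding v_def by (rule H01_lincomb[OF hH hH])
    have v1: "mass \<nu> v = 1" unfolding v_def mass_form_lincomb_square[OF \<nu> hH hH] using s by simp
    have veig: "v \<in> eigenspace \<nu> (1 / M)" unfolding v_def by (rule eigenspace_lincomb[OF \<nu> eig eig])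
    have vE: "energy v = 1 / M"
      using eigenspace_eq[OF veig eigenspace_dom[OF veig]] v1 by simp
    have vF: "mass_form \<nu> v e = 0" if "e \<in> F" for e
      unfolding v_def mass_form_lincomb[OF \<nu> hH hH FH[OF that]] using h(1) that by (simp add: U_def)
    have "v \<notin> F" using vF[of v] v1 by auto
    moreover have "orthonormal_eigenfunctions \<nu> y (insert v F)"
    proof -
      have "mass_form \<nu> e v = 0" if "e \<in> F" for e using vF[OF that] by (subst mass_form_sym)
      then show ?thesis
        using F(1) v1 veig vE yM vF unfolding orthonormal_eigenfunctions_def by simp
    qed
    ultimately have "P (Suc (card F))"
      unfolding P_def using fin by (intro exI[of _ "insert v F"]) auto
    then show False using max by fastforce
  qed
  show thesis
  proof (rule that[OF fin le[OF F(2)]])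
    show "F \<subseteq> H01" using FH by blast
    fix f assume f: "f \<in> H01" "\<And>e. e \<in> F \<Longrightarrow> mass_form \<nu> f e = 0" "mass \<nu> f > 0"
    \<comment> \<open>\<open>U\<close> lies in the form domain; interpolation keeps all masses and
      does not raise the energy, so the gap carries back to \<open>f\<close>.\<close>
    obtain h where h: "h \<in> dom_form \<nu>" "\<And>x. x \<in> measure_supp \<nu> \<Longrightarrow> h x = f x"
      "energy h \<le> energy f"
      using projection_onto_dom_form[OF f(1)] by blast
    note hH = dom_form_H01[OF h(1)]
    have "mass \<nu> h = mass \<nu> f"
      by (rule mass_form_cong_supp[OF \<nu> hH f(1) hH f(1) h(2) h(2)])
    moreover have "h \<in> U"
      using h(1) f(2) mass_form_cong_supp[OF \<nu> hH f(1) FH FH h(2)] by (auto simp: U_def)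
    ultimately show "y * mass \<nu> f < energy f"
      using gapU[of h] f(3) h(3) by simp
  qed
qed

text \<open>The lower half of min-max: a family larger than the set \<open>F\<close> of
  \<open>spectral_gap\<close> has a nontrivial combination orthogonal to \<open>F\<close>, and there
  the gap contradicts the Rayleigh bound.\<close>

lemma card_rayleigh_le:
  assumes \<nu>: "nonzero_finite_borel \<nu>" and I: "rayleigh \<nu> y I \<phi>"
  shows "enat (card I) \<le> eigenvalue_count \<nu> y"
proof (cases "eigenvalue_count \<nu> y")
  case (enat n)
  obtain F where F: "finite F" "card F \<le> n" "F \<subseteq> H01"
    and gap: "\<And>f. f \<in> H01 \<Longrightarrow> (\<And>e. e \<in> F \<Longrightarrow> mass_form \<nu> f e = 0) \<Longrightarrow> mass \<nu> f > 0 \<Longrightarrow> y * mass \<nu> f < energy f"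
    using spectral_gap[OF \<nu> enat] by blast
  have H: "\<phi> i \<in> H01" if "i \<in> I" for i using I that by (simp add: rayleigh_def)
  have "card I \<le> n"
  proof (rule ccontr)
    assume "\<not> ?thesis"
    then have "card F < card I" using F(2) by simp
    then obtain c where c: "\<exists>i\<in>I. c i \<noteq> 0" "\<forall>e\<in>F. (\<Sum>i\<in>I. c i * mass_form \<nu> (\<phi> i) e) = 0"
      using homogeneous_system_solvable[OF F(1), of I "\<lambda>i e. mass_form \<nu> (\<phi> i) e"] I by (auto simp: rayleigh_def)
    define f where "f = (\<lambda>x. \<Sum>i\<in>I. c i * \<phi> i x)"
    have f: "f \<in> H01" unfolding f_def by (rule H01_sum[OF H])
    have "mass_form \<nu> f e = 0" if "e \<in> F" for e
      using mass_form_sum[of \<nu> I \<phi> e c, OF \<nu> H] c(2) that F(3) by (auto simp: f_def)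
    moreover have "mass \<nu> f > 0 \<and> energy f \<le> y * mass \<nu> f"
      using I c(1) unfolding f_def rayleigh_def by blast
    ultimately show False using gap[OF f] by fastforce
  qed
  then show ?thesis using enat by simp
qed simp

section \<open>Sums of measures\<close>

lemma nn_integral_sum_measure:
  assumes sets: "sets M = sets N" and f: "f \<in> borel_measurable M"
  shows "(\<integral>\<^sup>+ x. f x \<partial>sum_measure M N) = (\<integral>\<^sup>+ x. f x \<partial>M) + (\<integral>\<^sup>+ x. f x \<partial>N)"
proof -
  have mN: "u \<in> borel_measurable N" "u \<in> borel_measurable (sum_measure M N)"
    if "u \<in> borel_measurable M" for u :: "'a \<Rightarrow> ennreal"
    using that measurable_cong_sets[OF sets, of borel borel]
      measurable_cong_sets[OF sets_sum_measure[of M N], of borel borel] by auto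
  show ?thesis using f
  proof (induction rule: borel_measurable_induct)
    case (cong f g)
    have "space N = space M" using sets_eq_imp_space_eq[OF sets] by simp
    then have "(\<integral>\<^sup>+ x. f x \<partial>K) = (\<integral>\<^sup>+ x. g x \<partial>K)" if "K \<in> {M, N, sum_measure M N}" for K
      using cong(3) that by (intro nn_integral_cong) auto
    then show ?case using cong(4) by simp
  next
    case (set A)
    then show ?case using sets by (simp add: emeasure_sum_measure)
  next
    case (mult u c)
    have [measurable]: "u \<in> borel_measurable N" "u \<in> borel_measurable (sum_measure M N)"
      using mN[OF mult(2)] by blast+
    show ?case using mult by (simp add: nn_integral_cmult distrib_left)
  next
    case (add u v)
    have [measurable]: "u \<in> borel_measurable N" "u \<in> borel_measurable (sum_measure M N)"
       "v \<in> borel_measurable N" "v \<in> borel_measurable (sum_measure M N)"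
      using add mN[of u] mN[of v] by blast+
    show ?case using add by (simp add: nn_integral_add add_ac)
  next
    case (seq U)
    have [measurable]: "U i \<in> borel_measurable N" "U i \<in> borel_measurable (sum_measure M N)" for i
      using seq mN[of "U i"] by blast+
    have SUP: "(\<integral>\<^sup>+ x. (SUP i. U i x) \<partial>K) = (SUP i. \<integral>\<^sup>+ x. U i x \<partial>K)" if "K \<in> {M, N, sum_measure M N}" for K
      using seq that by (intro nn_integral_monotone_convergence_SUP) auto
    have inc: "incseq (\<lambda>i. \<integral>\<^sup>+ x. U i x \<partial>K)" for K
      using seq by (auto simp: incseq_def le_fun_def intro!: nn_integral_mono)
    have "(\<integral>\<^sup>+ x. (SUP i. U i x) \<partial>sum_measure M N) = (SUP i. (\<integral>\<^sup>+ x. U i x \<partial>M) + (\<integral>\<^sup>+ x. U i x \<partial>N))"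
      using SUP seq by simp
    also have "\<dots> = (SUP i. \<integral>\<^sup>+ x. U i x \<partial>M) + (SUP i. \<integral>\<^sup>+ x. U i x \<partial>N)"
      by (intro ennreal_SUP_add inc)
    finally show ?case using SUP by (simp add: image_comp SUP_apply)
  qed
qed

lemma nzfb_sum_measure:
  assumes "nonzero_finite_borel \<nu>1" "nonzero_finite_borel \<nu>2"
  shows "nonzero_finite_borel (sum_measure \<nu>1 \<nu>2)"
proof -
  have s: "sets \<nu>1 = sets \<nu>2" "sets \<nu>1 = sets borel" "sets \<nu>2 = sets borel"
    using assms by (simp_all add: nzfb_sets)
  interpret n1: finite_measure \<nu>1 by (rule nzfb_finite[OF assms(1)])
  interpret n2: finite_measure \<nu>2 by (rule nzfb_finite[OF assms(2)])
  have "emeasure (sum_measure \<nu>1 \<nu>2) (space (sum_measure \<nu>1 \<nu>2)) \<noteq> \<infinity>"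
    using emeasure_sum_measure[OF s(1) sets.top] sets_eq_imp_space_eq[OF s(1)] by simp
  then have "finite_measure (sum_measure \<nu>1 \<nu>2)" by (rule finite_measureI)
  then show ?thesis
    using assms s by (simp add: nonzero_finite_borel_def emeasure_sum_measure)
qed

lemma measure_sum_measure:
  assumes "nonzero_finite_borel \<nu>1" "nonzero_finite_borel \<nu>2" "A \<in> sets borel"
  shows "measure (sum_measure \<nu>1 \<nu>2) A = measure \<nu>1 A + measure \<nu>2 A"
proof -
  interpret n1: finite_measure \<nu>1 by (rule nzfb_finite[OF assms(1)])
  interpret n2: finite_measure \<nu>2 by (rule nzfb_finite[OF assms(2)])
  have "emeasure (sum_measure \<nu>1 \<nu>2) A = emeasure \<nu>1 A + emeasure \<nu>2 A"
    using assms by (intro emeasure_sum_measure) (simp_all add: nzfb_sets)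
  then show ?thesis
    by (simp add: measure_def enn2real_plus less_top[symmetric])
qed

text \<open>Additivity in the measure is proved for non-negative integrals, and this transfers it to
  masses.\<close>

lemma mass_form_nn_integral:
  assumes "f \<in> H01" "sets \<nu> = sets borel"
  shows "mass \<nu> f = enn2real (\<integral>\<^sup>+ x. ennreal ((f x)\<^sup>2) \<partial>\<nu>)"
proof -
  have "f \<in> borel_measurable \<nu>"
    using H01_measurable[OF assms(1)] measurable_cong_sets[OF assms(2) refl] by blast
  then show ?thesis
    unfolding mass_form_eq[OF assms(1)] by (subst integral_eq_nn_integral) (auto simp: power2_eq_square)
qed

lemma mass_form_sum_measure:
  assumes \<nu>: "nonzero_finite_borel \<nu>1" "nonzero_finite_borel \<nu>2" and f: "f \<in> H01"
  shows "mass (sum_measure \<nu>1 \<nu>2) f = mass \<nu>1 f + mass \<nu>2 f"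
proof -
  have s: "sets \<nu>1 = sets borel" "sets \<nu>2 = sets borel" "sets (sum_measure \<nu>1 \<nu>2) = sets borel"
    using \<nu> by (simp_all add: nzfb_sets)
  have m: "f \<in> borel_measurable \<nu>1" using nzfb_measurable[OF \<nu>(1) f] .
  have fin: "(\<integral>\<^sup>+ x. ennreal ((f x)\<^sup>2) \<partial>\<nu>) < top" if "nonzero_finite_borel \<nu>" for \<nu>
    using H01_mult_integrable[OF that f f] nzfb_measurable[OF that f]
    by (simp add: integrable_iff_bounded power2_eq_square abs_mult_self_eq)
  have "(\<integral>\<^sup>+ x. ennreal ((f x)\<^sup>2) \<partial>sum_measure \<nu>1 \<nu>2) =
      (\<integral>\<^sup>+ x. ennreal ((f x)\<^sup>2) \<partial>\<nu>1) + (\<integral>\<^sup>+ x. ennreal ((f x)\<^sup>2) \<partial>\<nu>2)"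
    using m by (intro nn_integral_sum_measure) (simp_all add: s)
  then show ?thesis
    unfolding mass_form_nn_integral[OF f s(1)] mass_form_nn_integral[OF f s(2)] mass_form_nn_integral[OF f s(3)]
    using fin[OF \<nu>(1)] fin[OF \<nu>(2)] by (simp add: enn2real_plus)
qed

lemma rayleighD:
  assumes "rayleigh \<nu> y I \<phi>" "\<exists>i\<in>I. c i \<noteq> 0"
  shows "mass \<nu> (\<lambda>x. \<Sum>i\<in>I. c i * \<phi> i x) > 0"
    and "energy (\<lambda>x. \<Sum>i\<in>I. c i * \<phi> i x) \<le>
        y * mass \<nu> (\<lambda>x. \<Sum>i\<in>I. c i * \<phi> i x)"
  using assms by (auto simp: rayleigh_def)

lemma eigenvalue_count_mono_measure:
  assumes "nonzero_finite_borel \<nu>" "nonzero_finite_borel \<nu>'" "y \<ge> 0"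
    and le: "\<And>f. f \<in> H01 \<Longrightarrow> mass \<nu> f \<le> mass \<nu>' f"
  shows "eigenvalue_count \<nu> y \<le> eigenvalue_count \<nu>' y"
proof (cases "eigenvalue_count \<nu>' y")
  case (enat k)
  have "eigenvalue_count \<nu> y \<le> enat k"
  proof (rule eigenvalue_count_le[OF assms(1)])
    fix B :: "(real \<Rightarrow> real) set"
    assume B: "rayleigh \<nu> y B (\<lambda>f. f)"
    have "rayleigh \<nu>' y B (\<lambda>f. f)"
      unfolding rayleigh_def
    proof (intro conjI allI impI)
      show "finite B" "\<forall>i\<in>B. i \<in> H01" using B by (simp_all add: rayleigh_def)
      fix c :: "(real \<Rightarrow> real) \<Rightarrow> real" assume c: "\<exists>i\<in>B. c i \<noteq> 0"
      define f where "f = (\<lambda>x. \<Sum>i\<in>B. c i * i x)"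
      have "f \<in> H01" unfolding f_def using B by (intro H01_sum) (simp add: rayleigh_def)
      then have q: "mass \<nu> f \<le> mass \<nu>' f" by (rule le)
      have f: "mass \<nu> f > 0" "energy f \<le> y * mass \<nu> f"
        using rayleighD[OF B c] unfolding f_def by simp_all
      show "mass \<nu>' (\<lambda>x. \<Sum>i\<in>B. c i * i x) > 0"
        using q f(1) unfolding f_def by simp
      show "energy (\<lambda>x. \<Sum>i\<in>B. c i * i x) \<le>
          y * mass \<nu>' (\<lambda>x. \<Sum>i\<in>B. c i * i x)"
        using f(2) mult_left_mono[OF q assms(3)] unfolding f_def by simp
    qed
    then show "card B \<le> k"
      using card_rayleigh_le[OF assms(2)] enat by fastforce
  qed
  then show ?thesis using enat by simp
qed simp

lemma eigenvalue_count_sum_ge: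
  assumes "nonzero_finite_borel \<nu>1" "nonzero_finite_borel \<nu>2" "y \<ge> 0"
  shows "eigenvalue_count \<nu>1 y \<le> eigenvalue_count (sum_measure \<nu>1 \<nu>2) y"
    and "eigenvalue_count \<nu>2 y \<le> eigenvalue_count (sum_measure \<nu>1 \<nu>2) y"
  by (rule eigenvalue_count_mono_measure;
      simp add: assms nzfb_sum_measure mass_form_sum_measure mass_form_nonneg)+

text \<open>A combination orthogonal to both exceptional sets has energy above \<open>2 * y\<close>
  times each mass; averaging the two gaps gives \<open>y\<close> times the total mass.\<close>

lemma eigenvalue_count_sum_le:
  assumes \<nu>: "nonzero_finite_borel \<nu>1" "nonzero_finite_borel \<nu>2"
  shows "eigenvalue_count (sum_measure \<nu>1 \<nu>2) y \<le> eigenvalue_count \<nu>1 (2 * y) + eigenvalue_count \<nu>2 (2 * y)"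
proof (cases "eigenvalue_count \<nu>1 (2 * y)")
  case n1: (enat n1)
  show ?thesis
  proof (cases "eigenvalue_count \<nu>2 (2 * y)")
    case n2: (enat n2)
    obtain F1 where F1: "finite F1" "card F1 \<le> n1" "F1 \<subseteq> H01"
      and gap1: "\<And>f. f \<in> H01 \<Longrightarrow> (\<And>e. e \<in> F1 \<Longrightarrow> mass_form \<nu>1 f e = 0) \<Longrightarrow> mass \<nu>1 f > 0 \<Longrightarrow>
        (2 * y) * mass \<nu>1 f < energy f"
      using spectral_gap[OF \<nu>(1) n1] by blast
    obtain F2 where F2: "finite F2" "card F2 \<le> n2" "F2 \<subseteq> H01"
      and gap2: "\<And>f. f \<in> H01 \<Longrightarrow> (\<And>e. e \<in> F2 \<Longrightarrow> mass_form \<nu>2 f e = 0) \<Longrightarrow> mass \<nu>2 f > 0 \<Longrightarrow>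
        (2 * y) * mass \<nu>2 f < energy f"
      using spectral_gap[OF \<nu>(2) n2] by blast
    have "eigenvalue_count (sum_measure \<nu>1 \<nu>2) y \<le> enat (n1 + n2)"
    proof (rule eigenvalue_count_le[OF nzfb_sum_measure[OF \<nu>]], rule ccontr)
      fix B :: "(real \<Rightarrow> real) set"
      assume B: "rayleigh (sum_measure \<nu>1 \<nu>2) y B (\<lambda>f. f)" and "\<not> card B \<le> n1 + n2"
      then have card: "card (F1 <+> F2) < card B"
        using F1 F2 by (simp add: card_Plus)
      have BH: "b \<in> H01" if "b \<in> B" for b using B that by (simp add: rayleigh_def)
      \<comment> \<open>One equation per element of the disjoint union, each in its own mass form;
        the tags keep both equations of a function common to \<open>F1\<close> and
        \<open>F2\<close>.\<close>
      define A where "A b j = (case j of Inl e \<Rightarrow> mass_form \<nu>1 b e | Inr e \<Rightarrow> mass_form \<nu>2 b e)" for b j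
      have "finite (F1 <+> F2)" "finite B" using F1 F2 B by (auto simp: rayleigh_def)
      from homogeneous_system_solvable[OF this card, of A]
      obtain c where c: "\<exists>b\<in>B. c b \<noteq> 0" "\<And>j. j \<in> F1 <+> F2 \<Longrightarrow> (\<Sum>b\<in>B. c b * A b j) = 0"
        by blast
      define f where "f = (\<lambda>x. \<Sum>b\<in>B. c b * b x)"
      have f: "f \<in> H01" unfolding f_def by (rule H01_sum[OF BH])
      have o1: "mass_form \<nu>1 f e = 0" if "e \<in> F1" for e
      proof -
        have "mass_form \<nu>1 f e = (\<Sum>b\<in>B. c b * mass_form \<nu>1 b e)"
          unfolding f_def
          by (rule mass_form_sum[where f = "\<lambda>b. b", OF \<nu>(1) BH]) (use F1(3) that in auto)
        then show ?thesis using c(2)[of "Inl e"] that by (simp add: A_def InlI)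
      qed
      have o2: "mass_form \<nu>2 f e = 0" if "e \<in> F2" for e
      proof -
        have "mass_form \<nu>2 f e = (\<Sum>b\<in>B. c b * mass_form \<nu>2 b e)"
          unfolding f_def
          by (rule mass_form_sum[where f = "\<lambda>b. b", OF \<nu>(2) BH]) (use F2(3) that in auto)
        then show ?thesis using c(2)[of "Inr e"] that by (simp add: A_def InrI)
      qed
      have q: "mass (sum_measure \<nu>1 \<nu>2) f > 0" "energy f \<le> y * mass (sum_measure \<nu>1 \<nu>2) f"
        using rayleighD[OF B c(1)] unfolding f_def by simp_all
      \<comment> \<open>A vanishing mass leaves only the weak inequality; strictness comes from
        whichever mass is positive.\<close>
      have "2 * y * mass \<nu>1 f \<le> energy f" "mass \<nu>1 f > 0 \<Longrightarrow> 2 * y * mass \<nu>1 f < energy f"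
        using gap1[OF f o1] mass_form_nonneg[of \<nu>1 f] energy_nonneg[of f]
        by (cases "mass \<nu>1 f = 0"; simp add: order_less_le)+
      moreover have "2 * y * mass \<nu>2 f \<le> energy f" "mass \<nu>2 f > 0 \<Longrightarrow> 2 * y * mass \<nu>2 f < energy f"
        using gap2[OF f o2] mass_form_nonneg[of \<nu>2 f] energy_nonneg[of f]
        by (cases "mass \<nu>2 f = 0"; simp add: order_less_le)+
      moreover have "mass \<nu>1 f > 0 \<or> mass \<nu>2 f > 0"
        using q(1) unfolding mass_form_sum_measure[OF \<nu> f] by linarith
      ultimately have "2 * y * mass \<nu>1 f + 2 * y * mass \<nu>2 f < 2 * energy f" by linarith
      then show False using q(2) unfolding mass_form_sum_measure[OF \<nu> f] by (simp add: algebra_simps)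
    qed
    then show ?thesis by (simp add: n1 n2)
  qed simp
qed simp

section \<open>Partitions bound the eigenvalue count from above\<close>

text \<open>The ordered points are kept apart from the set of cells, which forgets the order that
  vanishing conditions and merging rely on.\<close>

definition adapted_grid :: "real measure \<Rightarrow> nat \<Rightarrow> (nat \<Rightarrow> real) \<Rightarrow> bool" where
  "adapted_grid \<nu> n c \<longleftrightarrow> n \<ge> 2 \<and> c 1 = 0 \<and> c n = 1 \<and>
     (\<forall>k\<in>{1..<n}. c k < c (k + 1)) \<and> (\<forall>k\<in>{1..n}. measure \<nu> {c k} = 0)"

definition cells :: "nat \<Rightarrow> (nat \<Rightarrow> real) \<Rightarrow> real set set" where
  "cells n c = (\<lambda>k. {c k<..c (k + 1)}) ` {1..<n}"

lemma nu_partitions_eq: "nu_partitions \<nu> = {cells n c | n c. adapted_grid \<nu> n c}"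
  by (auto simp: nu_partitions_def adapted_grid_def cells_def)

lemma adapted_grid_less:
  assumes "adapted_grid \<nu> n c" "1 \<le> i" "i < j" "j \<le> n"
  shows "c i < c j"
  using assms(3,4)
proof (induction j)
  case (Suc j)
  then have "c j < c (Suc j)" using assms(1,2) by (auto simp: adapted_grid_def)
  then show ?case using Suc by (cases "i = j") auto
qed simp

lemma adapted_grid_le:
  assumes "adapted_grid \<nu> n c" "1 \<le> i" "i \<le> j" "j \<le> n"
  shows "c i \<le> c j"
  using adapted_grid_less[OF assms(1,2), of j] assms(3,4) by (cases "i = j") auto

lemma card_cells:
  assumes "adapted_grid \<nu> n c"
  shows "card (cells n c) = n - 1"
proof -
  have "inj_on (\<lambda>k. {c k<..c (k + 1)}) {1..<n}"
  proof (rule inj_onI)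
    fix i j assume ij: "i \<in> {1..<n}" "j \<in> {1..<n}" and eq: "{c i<..c (i + 1)} = {c j<..c (j + 1)}"
    have "c i < c (i + 1)" "c j < c (j + 1)"
      using adapted_grid_less[OF assms] ij by auto
    then have "Sup {c i<..c (i + 1)} = c (i + 1)" "Sup {c j<..c (j + 1)} = c (j + 1)" by auto
    then have "c (i + 1) = c (j + 1)" using eq by simp
    then show "i = j"
      using adapted_grid_less[OF assms, of "i + 1" "j + 1"] adapted_grid_less[OF assms, of "j + 1" "i + 1"] ij
      by (cases i j rule: linorder_cases) auto
  qed
  then show ?thesis by (simp add: cells_def card_image)
qed

lemma adapted_grid_cell:
  assumes "adapted_grid \<nu> n c" "x \<in> {0<..1}"
  obtains k where "k \<in> {1..<n}" "x \<in> {c k<..c (k + 1)}"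
proof -
  define i where "i = (LEAST j. 1 \<le> j \<and> x \<le> c j)"
  have n: "n \<ge> 2" "c 1 = 0" "c n = 1" using assms by (simp_all add: adapted_grid_def)
  then have ex: "1 \<le> n \<and> x \<le> c n" using assms(2) by simp
  have i: "1 \<le> i \<and> x \<le> c i" unfolding i_def by (rule LeastI[of _ n]) (rule ex)
  have "i \<le> n" unfolding i_def by (rule Least_le) (rule ex)
  have "i \<noteq> 1" using i assms n by auto
  then have "i \<ge> 2" using i by simp
  then have "\<not> (1 \<le> i - 1 \<and> x \<le> c (i - 1))"
    using not_less_Least[of "i - 1" "\<lambda>j. 1 \<le> j \<and> x \<le> c j"] unfolding i_def[symmetric] by simp
  then show thesis
    using i \<open>i \<ge> 2\<close> \<open>i \<le> n\<close> by (intro that[of "i - 1"]) auto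
qed

lemma sum_cell_integrals:
  assumes "adapted_grid \<nu> n c" "integrable lborel (g :: real \<Rightarrow> real)" "1 \<le> m" "m \<le> n"
  shows "(\<Sum>k\<in>{1..<m}. LINT u:{c k..c (k + 1)}|lborel. g u) = (LINT u:{0..c m}|lborel. g u)"
  using assms(3,4)
proof (induction m rule: dec_induct)
  case base
  show ?case using assms(1) set_integral_singleton[of 0 g] by (simp add: adapted_grid_def)
next
  case (step m)
  have "0 \<le> c m" "c m \<le> c (Suc m)"
    using adapted_grid_le[OF assms(1), of 1 m] adapted_grid_le[OF assms(1), of m "Suc m"] step assms(1)
    by (auto simp: adapted_grid_def)
  then show ?case
    using step set_integral_split[OF assms(2), of 0 "c m" "c (Suc m)"] by simp
qed

text \<open>If \<open>f\<close> vanishes at all grid points, its square on a cell is at most the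
  length times the energy of that cell. Integrating over \<nu> weights each cell energy by less than
  \<open>1 / x\<close>, so \<open>x\<close> times the mass falls below the energy.\<close>

lemma eigenvalue_count_le_card_cells:
  assumes \<nu>: "nonzero_finite_borel \<nu>" and x: "x > 0" and grid: "adapted_grid \<nu> n c"
    and small: "\<And>k. k \<in> {1..<n} \<Longrightarrow> measure \<nu> {c k<..c (k + 1)} * (c (k + 1) - c k) < 1 / x"
  shows "eigenvalue_count \<nu> x \<le> enat (n - 1)"
proof (rule eigenvalue_count_le[OF \<nu>], rule ccontr)
  fix B :: "(real \<Rightarrow> real) set"
  assume B: "rayleigh \<nu> x B (\<lambda>f. f)" and "\<not> card B \<le> n - 1"
  \<comment> \<open>Only the interior points impose equations, because \<open>H01\<close> functions
    vanish at both ends.\<close>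
  then have card: "card {2..<n} < card B" by simp
  have BH: "b \<in> H01" if "b \<in> B" for b using B that by (simp add: rayleigh_def)
  have "finite B" using B by (simp add: rayleigh_def)
  from homogeneous_system_solvable[OF _ this card, of "\<lambda>b k. b (c k)"]
  obtain a where a: "\<exists>b\<in>B. a b \<noteq> 0" "\<And>k. k \<in> {2..<n} \<Longrightarrow> (\<Sum>b\<in>B. a b * b (c k)) = 0"
    by blast
  define f where "f = (\<lambda>x. \<Sum>b\<in>B. a b * b x)"
  have f: "f \<in> H01" unfolding f_def by (rule H01_sum[OF BH])
  have q: "mass \<nu> f > 0" "energy f \<le> x * mass \<nu> f"
    using rayleighD[OF B a(1)] unfolding f_def by simp_all
  have n2: "n \<ge> 2" "c 1 = 0" "c n = 1" using grid by (simp_all add: adapted_grid_def)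
  have zero: "f (c k) = 0" if "k \<in> {1..n}" for k
  proof (cases "k = 1 \<or> k = n")
    case True
    then show ?thesis using n2 H01_vanishes[OF f] by auto
  next
    case False
    then show ?thesis using a(2)[of k] that by (simp add: f_def)
  qed
  obtain g where g: "g \<in> L2Z" "f = prim g" using f by (rule H01E)
  note gI = L2Z_L2I[OF g(1)]
  define e where "e k = (LINT u:{c k..c (k + 1)}|lborel. (g u)\<^sup>2)" for k
  have e0: "e k \<ge> 0" for k
    unfolding e_def set_lebesgue_integral_def by (intro Bochner_Integration.integral_nonneg) auto
  have E: "energy f = (\<Sum>k\<in>{1..<n}. e k)"
  proof -
    have "(\<Sum>k\<in>{1..<n}. e k) = (LINT u:{0..1}|lborel. (g u)\<^sup>2)"
      unfolding e_def using sum_cell_integrals[OF grid L2I_square[OF gI], of n] n2 by simp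
    also have "\<dots> = (LINT u|lborel. g u * g u)"
    proof -
      have "indicator {0..1} u *\<^sub>R (g u)\<^sup>2 = g u * g u" for u
        using L2I_outside[OF gI, of u] by (cases "u \<in> {0..1}") (auto simp: power2_eq_square)
      then show ?thesis by (simp only: set_lebesgue_integral_def)
    qed
    finally show ?thesis unfolding g(2) energy_prim[OF gI gI] by simp
  qed
  interpret finite_measure \<nu> by (rule nzfb_finite[OF \<nu>])
  define w where "w k = measure \<nu> {c k<..c (k + 1)} * (c (k + 1) - c k)" for k
  have step: "c k < c (k + 1)" "0 \<le> c k" "c (k + 1) \<le> 1" if "k \<in> {1..<n}" for k
    using adapted_grid_less[OF grid, of k "k + 1"] adapted_grid_le[OF grid, of 1 k]
      adapted_grid_le[OF grid, of "k + 1" n] that n2 by auto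
  have pointwise: "(f t)\<^sup>2 \<le> (\<Sum>k\<in>{1..<n}. indicator {c k<..c (k + 1)} t * ((c (k + 1) - c k) * e k))" for t
  proof (cases "t \<in> {0<..1}")
    case True
    then obtain k where k: "k \<in> {1..<n}" "t \<in> {c k<..c (k + 1)}" by (rule adapted_grid_cell[OF grid])
    note ck = step[OF k(1)]
    have "(f t)\<^sup>2 = (prim g t - prim g (c k))\<^sup>2" using zero[of k] k(1) by (simp add: g(2))
    also have "\<dots> \<le> (t - c k) * (LINT u:{c k..t}|lborel. (g u)\<^sup>2)"
      using ck k(2) by (intro prim_diff_square gI) auto
    also have "\<dots> \<le> (c (k + 1) - c k) * e k"
    proof (rule mult_mono)
      have "e k = (LINT u:{c k..t}|lborel. (g u)\<^sup>2) + (LINT u:{t..c (k + 1)}|lborel. (g u)\<^sup>2)"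
        unfolding e_def using k(2) by (intro set_integral_split L2I_square gI) auto
      moreover have "(LINT u:{t..c (k + 1)}|lborel. (g u)\<^sup>2) \<ge> 0" "(LINT u:{c k..t}|lborel. (g u)\<^sup>2) \<ge> 0"
        unfolding set_lebesgue_integral_def by (auto intro!: Bochner_Integration.integral_nonneg)
      ultimately show "(LINT u:{c k..t}|lborel. (g u)\<^sup>2) \<le> e k" "0 \<le> (LINT u:{c k..t}|lborel. (g u)\<^sup>2)"
        by simp_all
    qed (use k(2) ck in auto)
    also have "\<dots> = indicator {c k<..c (k + 1)} t * ((c (k + 1) - c k) * e k)" using k(2) by simp
    also have "\<dots> \<le> (\<Sum>k\<in>{1..<n}. indicator {c k<..c (k + 1)} t * ((c (k + 1) - c k) * e k))"
      by (rule member_le_sum[OF k(1)]) (use step e0 in \<open>auto simp: less_imp_le\<close>)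
    finally show ?thesis .
  next
    case False
    then have "f t = 0" using H01_vanishes[OF f, of t] by auto
    then show ?thesis using step e0 by (auto intro!: sum_nonneg mult_nonneg_nonneg simp: less_imp_le)
  qed
  have cell_sets: "{c k<..c (k + 1)} \<in> sets \<nu>" for k by (simp add: nzfb_sets[OF \<nu>])
  have int: "integrable \<nu> (\<lambda>t. indicator {c k<..c (k + 1)} t * ((c (k + 1) - c k) * e k))" for k
    using cell_sets[of k] by (intro integrable_mult_left integrable_real_indicator) (simp_all add: less_top[symmetric])
  have "mass \<nu> f \<le> (LINT t|\<nu>. (\<Sum>k\<in>{1..<n}. indicator {c k<..c (k + 1)} t * ((c (k + 1) - c k) * e k)))"
    unfolding mass_form_eq[OF f]
  proof (intro integral_mono H01_mult_integrable[OF \<nu> f f] Bochner_Integration.integrable_sum int)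
    show "f t * f t \<le> (\<Sum>k\<in>{1..<n}. indicator {c k<..c (k + 1)} t * ((c (k + 1) - c k) * e k))" for t
      using pointwise[of t] by (simp add: power2_eq_square)
  qed
  also have "\<dots> = (\<Sum>k\<in>{1..<n}. (LINT t|\<nu>. indicator {c k<..c (k + 1)} t * ((c (k + 1) - c k) * e k)))"
    by (rule Bochner_Integration.integral_sum) (rule int)
  also have "\<dots> = (\<Sum>k\<in>{1..<n}. w k * e k)"
    using cell_sets by (intro sum.cong refl) (simp add: w_def)
  finally have qw: "mass \<nu> f \<le> (\<Sum>k\<in>{1..<n}. w k * e k)" .
  have w: "w k < 1 / x" if "k \<in> {1..<n}" for k using small[OF that] by (simp add: w_def)
  \<comment> \<open>The strict inequality below needs one cell with positive energy; without it the
    mass would be zero.\<close>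
  have "\<exists>k\<in>{1..<n}. e k > 0"
  proof (rule ccontr)
    assume "\<not> ?thesis"
    then have "\<And>k. k \<in> {1..<n} \<Longrightarrow> e k = 0" using e0 by (meson antisym not_less)
    then have "(\<Sum>k\<in>{1..<n}. w k * e k) = 0" by simp
    then show False using qw q(1) by simp
  qed
  then have "(\<Sum>k\<in>{1..<n}. w k * e k) < (\<Sum>k\<in>{1..<n}. 1 / x * e k)"
  proof (intro sum_strict_mono_ex1 ballI)
    show "w k * e k \<le> 1 / x * e k" if "k \<in> {1..<n}" for k
      using w[OF that] e0 by (intro mult_right_mono) auto
    show "\<exists>k\<in>{1..<n}. w k * e k < 1 / x * e k"
      using \<open>\<exists>k\<in>{1..<n}. e k > 0\<close> w by (meson mult_strict_right_mono)
  qed simp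
  also have "\<dots> = energy f / x" by (simp add: E sum_divide_distrib)
  finally have "mass \<nu> f < energy f / x" using qw by simp
  then show False using q(2) x by (simp add: field_simps)
qed

lemma cell_small_iff:
  assumes "adapted_grid \<nu> n c"
  shows "(\<forall>C\<in>cells n c. measure \<nu> C * measure lborel C < 1 / x) \<longleftrightarrow>
    (\<forall>k\<in>{1..<n}. measure \<nu> {c k<..c (k + 1)} * (c (k + 1) - c k) < 1 / x)"
proof -
  have "measure lborel {c k<..c (k + 1)} = c (k + 1) - c k" if "k \<in> {1..<n}" for k
    using adapted_grid_less[OF assms, of k "k + 1"] that by simp
  then show ?thesis by (simp add: cells_def)
qed

lemma eigenvalue_count_le_N_R:
  assumes "nonzero_finite_borel \<nu>" "x > 0"
  shows "eigenvalue_count \<nu> x \<le> N_R \<nu> x"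
  unfolding N_R_def
proof (rule INF_greatest)
  fix P assume "P \<in> {P \<in> nu_partitions \<nu>. \<forall>C\<in>P. measure \<nu> C * measure lborel C < 1 / x}"
  then obtain n c where P: "P = cells n c" "adapted_grid \<nu> n c"
    and "\<forall>C\<in>cells n c. measure \<nu> C * measure lborel C < 1 / x"
    by (auto simp: nu_partitions_eq)
  then have "\<forall>k\<in>{1..<n}. measure \<nu> {c k<..c (k + 1)} * (c (k + 1) - c k) < 1 / x"
    using cell_small_iff[OF P(2)] by simp
  then show "eigenvalue_count \<nu> x \<le> enat (card P)"
    using eigenvalue_count_le_card_cells[OF assms P(2)] by (simp add: P(1) card_cells[OF P(2)])
qed

section \<open>Bumps over the blocks of a minimal partition\<close>

lemma prim_indicator:
  assumes "0 \<le> p" "p \<le> a" "a \<le> 1" "x \<in> {0..1}"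
  shows "prim (\<lambda>t. c * indicator {p..a} t) x = c * max 0 (min a x - p)"
proof -
  have "indicator {0..x} t * (c * indicator {p..a} t) = c * (indicator {p..min a x} t :: real)" for t
    using assms by (auto simp: indicator_def)
  then have "prim (\<lambda>t. c * indicator {p..a} t) x = (LINT t|lborel. c * (indicator {p..min a x} t :: real))"
    using assms(4) by (simp only: prim_def set_lebesgue_integral_def real_scaleR_def if_True)
  also have "\<dots> = c * max 0 (min a x - p)"
  proof (cases "p \<le> min a x")
    case False
    then have "{p..min a x} = {}" "max 0 (min a x - p) = 0" by auto
    then show ?thesis by simp
  qed simp
  finally show ?thesis .
qed

text \<open>Gradient of the trapezoid that rises from 0 to 1 on \<open>{p..a}\<close>, stays 1 on
  \<open>{a..b}\<close> and falls to 0 on \<open>{b..q}\<close>.\<close>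

definition bump_grad :: "real \<Rightarrow> real \<Rightarrow> real \<Rightarrow> real \<Rightarrow> real \<Rightarrow> real" where
  "bump_grad p a b q t = 1 / (a - p) * indicator {p..a} t - 1 / (q - b) * indicator {b..q} t"

lemma bump_grad_L2I:
  assumes "0 \<le> p" "p < a" "a < b" "b < q" "q \<le> 1"
  shows "bump_grad p a b q \<in> L2I"
  unfolding bump_grad_def[abs_def] using assms by (intro L2I_diff L2I_indicator) auto

lemma prim_bump_grad:
  assumes "0 \<le> p" "p < a" "a < b" "b < q" "q \<le> 1" "x \<in> {0..1}"
  shows "prim (bump_grad p a b q) x = max 0 (min a x - p) / (a - p) - max 0 (min q x - b) / (q - b)"
proof -
  have I: "(\<lambda>t. 1 / (a - p) * indicator {p..a} t) \<in> L2I" "(\<lambda>t. 1 / (q - b) * indicator {b..q} t) \<in> L2I"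
    using assms by (intro L2I_indicator; auto)+
  show ?thesis
    unfolding bump_grad_def[abs_def] prim_minus[OF I]
    using assms prim_indicator[of p a x "1 / (a - p)"] prim_indicator[of b q x "1 / (q - b)"] by simp
qed

lemma bump_properties:
  assumes "0 \<le> p" "p < a" "a < b" "b < q" "q \<le> 1"
  defines "\<phi> \<equiv> prim (bump_grad p a b q)"
  shows "\<phi> \<in> H01" "\<And>x. x \<in> {a..b} \<Longrightarrow> \<phi> x = 1" "\<And>x. x \<notin> {p<..<q} \<Longrightarrow> \<phi> x = 0"
    and "energy \<phi> = 1 / (a - p) + 1 / (q - b)"
proof -
  note I = bump_grad_L2I[OF assms(1-5)] and val = prim_bump_grad[OF assms(1-5)]
  have "bump_grad p a b q \<in> L2Z"
    using I prim_1[OF I] val[of 1] assms by (simp add: L2Z_def)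
  then show "\<phi> \<in> H01" by (simp add: \<phi>_def H01_eq)
  show "\<phi> x = 1" if "x \<in> {a..b}" for x
    unfolding \<phi>_def using val[of x] that assms by simp
  show "\<phi> x = 0" if "x \<notin> {p<..<q}" for x
  proof (cases "x \<in> {0..1}")
    case True
    then show ?thesis unfolding \<phi>_def using val[of x] that assms by (auto simp: not_less)
  qed (auto simp: \<phi>_def prim_def)
  have "energy \<phi> = (LINT t|lborel. bump_grad p a b q t * bump_grad p a b q t)"
    unfolding \<phi>_def by (rule energy_prim[OF I I])
  also have "\<dots> = (LINT t|lborel. (1 / (a - p))\<^sup>2 * indicator {p..a} t + (1 / (q - b))\<^sup>2 * indicator {b..q} t)"
    using assms by (intro Bochner_Integration.integral_cong)
      (auto simp: bump_grad_def indicator_def power2_eq_square)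
  also have "\<dots> = (1 / (a - p))\<^sup>2 * (a - p) + (1 / (q - b))\<^sup>2 * (q - b)"
    using assms by (subst Bochner_Integration.integral_add) auto
  finally show "energy \<phi> = 1 / (a - p) + 1 / (q - b)"
    using assms by (simp add: power2_eq_square)
qed

lemma bump_orthogonal:
  assumes "0 \<le> p" "p < a" "a < b" "b < q" "q \<le> 1"
    and "0 \<le> p'" "p' < a'" "a' < b'" "b' < q'" "q' \<le> 1" and "q \<le> p'"
  shows "energy_form (prim (bump_grad p a b q)) (prim (bump_grad p' a' b' q')) = 0"
proof -
  have "AE t in lborel. bump_grad p a b q t * bump_grad p' a' b' q' t = 0"
    using AE_lborel_singleton[of q]
    by eventually_elim (use assms in \<open>auto simp: bump_grad_def indicator_def\<close>)
  then show ?thesis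
    by (simp add: energy_prim[OF bump_grad_L2I bump_grad_L2I] assms integral_eq_zero_AE)
qed

text \<open>Bumps meet at most in endpoints, so the energy of a combination is diagonal. On each
  plateau only one bump is nonzero, and discarding the flanks bounds the mass below by a diagonal
  sum.\<close>

lemma eigenvalue_count_ge_bumps:
  fixes p a b q :: "nat \<Rightarrow> real"
  assumes \<nu>: "nonzero_finite_borel \<nu>" and Y: "Y > 0"
    and ord: "\<And>i. i < K \<Longrightarrow> 0 \<le> p i \<and> p i < a i \<and> a i < b i \<and> b i < q i \<and> q i \<le> 1"
    and sep: "\<And>i j. i < j \<Longrightarrow> j < K \<Longrightarrow> q i \<le> p j"
    and en: "\<And>i. i < K \<Longrightarrow> 1 / (a i - p i) + 1 / (q i - b i) \<le> Y * measure \<nu> {a i<..b i}"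
  shows "enat K \<le> eigenvalue_count \<nu> Y"
proof -
  define \<phi> where "\<phi> i = prim (bump_grad (p i) (a i) (b i) (q i))" for i
  have \<phi>: "\<phi> i \<in> H01" "x \<in> {a i..b i} \<Longrightarrow> \<phi> i x = 1" "x \<notin> {p i<..<q i} \<Longrightarrow> \<phi> i x = 0"
    "energy (\<phi> i) = 1 / (a i - p i) + 1 / (q i - b i)" if "i < K" for i x
  proof -
    have o: "0 \<le> p i" "p i < a i" "a i < b i" "b i < q i" "q i \<le> 1" using ord[OF that] by auto
    note B = bump_properties[OF o, folded \<phi>_def]
    show "\<phi> i \<in> H01" "energy (\<phi> i) = 1 / (a i - p i) + 1 / (q i - b i)" by (fact B)+
    show "x \<in> {a i..b i} \<Longrightarrow> \<phi> i x = 1" "x \<notin> {p i<..<q i} \<Longrightarrow> \<phi> i x = 0" by (fact B)+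
  qed
  have orth: "energy_form (\<phi> i) (\<phi> j) = 0" if "i < K" "j < K" "i \<noteq> j" for i j
  proof -
    have *: "energy_form (\<phi> i) (\<phi> j) = 0" if "i < j" "j < K" for i j
      unfolding \<phi>_def using ord[of i] ord[of j] sep[OF that] that by (intro bump_orthogonal) auto
    show ?thesis using *[of i j] *[of j i] that energy_sym by (metis linorder_neqE_nat)
  qed
  have mpos: "measure \<nu> {a i<..b i} > 0" if "i < K" for i
  proof -
    have "0 < 1 / (a i - p i) + 1 / (q i - b i)" using ord[OF that] by (simp add: add_pos_pos)
    then have "0 < Y * measure \<nu> {a i<..b i}" using en[OF that] by simp
    then show ?thesis using Y by (simp add: zero_less_mult_iff)
  qed
  interpret finite_measure \<nu> by (rule nzfb_finite[OF \<nu>])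
  have "rayleigh \<nu> Y {..<K} \<phi>"
    unfolding rayleigh_def
  proof (intro conjI allI impI)
    show "finite {..<K}" "\<forall>i\<in>{..<K}. \<phi> i \<in> H01" using \<phi>(1) by auto
    fix c :: "nat \<Rightarrow> real" assume "\<exists>i\<in>{..<K}. c i \<noteq> 0"
    then obtain i0 where i0: "i0 < K" "c i0 \<noteq> 0" by auto
    define f where "f = (\<lambda>x. \<Sum>i\<in>{..<K}. c i * \<phi> i x)"
    have f: "f \<in> H01" unfolding f_def using \<phi>(1) by (intro H01_sum) auto
    have fx: "f x = c i" if "i < K" "x \<in> {a i<..b i}" for i x
    proof -
      have "\<phi> j x = 0" if j: "j < K" "j \<noteq> i" for j
      proof (rule \<phi>(3)[OF j(1)])
        show "x \<notin> {p j<..<q j}"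
          using sep[of i j] sep[of j i] ord[OF j(1)] ord[OF \<open>i < K\<close>] j \<open>i < K\<close> \<open>x \<in> {a i<..b i}\<close>
          by (cases i j rule: linorder_cases) auto
      qed
      then have "f x = (\<Sum>j\<in>{..<K}. if j = i then c i * \<phi> i x else 0)"
        unfolding f_def by (intro sum.cong) auto
      then show ?thesis using that \<phi>(2)[of i x] by simp
    qed
    have sets: "{a i<..b i} \<in> sets \<nu>" for i by (simp add: nzfb_sets[OF \<nu>])
    have int: "integrable \<nu> (\<lambda>x. (c i)\<^sup>2 * indicator {a i<..b i} x)" for i
      using sets[of i] by (intro integrable_mult_right integrable_real_indicator) (simp_all add: less_top[symmetric])
    have pw: "(\<Sum>i\<in>{..<K}. (c i)\<^sup>2 * indicator {a i<..b i} x) \<le> (f x)\<^sup>2" for x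
    proof (cases "\<exists>i<K. x \<in> {a i<..b i}")
      case True
      then obtain i where i: "i < K" "x \<in> {a i<..b i}" by auto
      have "x \<notin> {a j<..b j}" if j: "j < K" "j \<noteq> i" for j
        using sep[of i j] sep[of j i] ord[OF j(1)] ord[OF i(1)] j i
        by (cases i j rule: linorder_cases) auto
      then have "(\<Sum>i\<in>{..<K}. (c i)\<^sup>2 * indicator {a i<..b i} x) = (\<Sum>j\<in>{..<K}. if j = i then (c i)\<^sup>2 else 0)"
        using i by (intro sum.cong) auto
      then show ?thesis using fx[OF i] i by simp
    next
      case False
      then have "(\<Sum>i\<in>{..<K}. (c i)\<^sup>2 * indicator {a i<..b i} x) = 0"
        by (intro sum.neutral) auto
      then show ?thesis by simp
    qed
    have "(\<Sum>i\<in>{..<K}. (c i)\<^sup>2 * measure \<nu> {a i<..b i}) = (LINT x|\<nu>. (\<Sum>i\<in>{..<K}. (c i)\<^sup>2 * indicator {a i<..b i} x))"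
      using sets by (subst Bochner_Integration.integral_sum[OF int]) simp
    also have "\<dots> \<le> mass \<nu> f"
      unfolding mass_form_eq[OF f] using pw
      by (intro integral_mono H01_mult_integrable[OF \<nu> f f] Bochner_Integration.integrable_sum int)
        (simp add: power2_eq_square)
    finally have q: "(\<Sum>i\<in>{..<K}. (c i)\<^sup>2 * measure \<nu> {a i<..b i}) \<le> mass \<nu> f" .
    have "(\<Sum>i\<in>{..<K}. (c i)\<^sup>2 * measure \<nu> {a i<..b i}) > 0"
      using i0 mpos by (intro sum_pos2[of _ i0]) auto
    then show "mass \<nu> (\<lambda>x. \<Sum>i\<in>{..<K}. c i * \<phi> i x) > 0"
      using q unfolding f_def by simp
    have "energy f = (\<Sum>i\<in>{..<K}. (c i)\<^sup>2 * energy (\<phi> i))"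
      unfolding f_def using \<phi>(1) orth by (intro energy_sum_orthogonal) auto
    also have "\<dots> \<le> (\<Sum>i\<in>{..<K}. (c i)\<^sup>2 * (Y * measure \<nu> {a i<..b i}))"
      using \<phi>(4) en by (intro sum_mono mult_left_mono) auto
    also have "\<dots> = Y * (\<Sum>i\<in>{..<K}. (c i)\<^sup>2 * measure \<nu> {a i<..b i})"
      by (simp add: sum_distrib_left mult_ac)
    also have "\<dots> \<le> Y * mass \<nu> f" using q Y by (intro mult_left_mono) auto
    finally show "energy (\<lambda>x. \<Sum>i\<in>{..<K}. c i * \<phi> i x) \<le>
        Y * mass \<nu> (\<lambda>x. \<Sum>i\<in>{..<K}. c i * \<phi> i x)"
      unfolding f_def .
  qed
  then show ?thesis using card_rayleigh_le[OF \<nu>, of Y "{..<K}" \<phi>] by simp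
qed

text \<open>
  If every index near \<open>j0\<close> had a neighbour shorter by the factor \<open>q\<close>, then moving to such neighbours \<open>R\<close>
  times would reach a length below \<open>q ^ R\<close>.
\<close>

lemma window_contains_good_index:
  fixes l :: "nat \<Rightarrow> real"
  assumes q: "q > 0" and R: "R < j0" and l: "\<And>j. j0 \<le> j + R \<Longrightarrow> j \<le> j0 + R \<Longrightarrow> q ^ R < l j"
    and l1: "l j0 \<le> 1"
  obtains j where "j0 \<le> j + R" "j \<le> j0 + R" "q * l j \<le> l (j - 1)" "q * l j \<le> l (j + 1)"
proof -
  have "\<exists>j. j0 \<le> j + R \<and> j \<le> j0 + R \<and> q * l j \<le> l (j - 1) \<and> q * l j \<le> l (j + 1)"
  proof (rule ccontr)
    assume "\<not> ?thesis"
    then have bad: "l (j - 1) < q * l j \<or> l (j + 1) < q * l j" if "j0 \<le> j + R" "j \<le> j0 + R" for j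
      using that by (meson not_less)
    have "\<exists>j. j0 \<le> j + r \<and> j \<le> j0 + r \<and> l j \<le> q ^ r" if "r \<le> R" for r
      using that
    proof (induction r)
      case 0
      then show ?case using l1 by (intro exI[of _ j0]) simp
    next
      case (Suc r)
      then obtain j where j: "j0 \<le> j + r" "j \<le> j0 + r" "l j \<le> q ^ r" by auto
      have "q * l j \<le> q ^ Suc r" using j(3) q by simp
      moreover have "l (j - 1) < q * l j \<or> l (j + 1) < q * l j" using bad[of j] j Suc by simp
      \<comment> \<open>Makes \<open>j - 1\<close> a genuine predecessor, since subtraction of
        naturals stops at 0; it follows from \<open>R < j0\<close>.\<close>
      moreover have "1 \<le> j" using j Suc R by simp
      ultimately show ?case
      proof (elim disjE)
        assume "l (j - 1) < q * l j" "q * l j \<le> q ^ Suc r" "1 \<le> j"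
        then show ?thesis using j by (intro exI[of _ "j - 1"]) auto
      next
        assume "l (j + 1) < q * l j" "q * l j \<le> q ^ Suc r" "1 \<le> j"
        then show ?thesis using j by (intro exI[of _ "j + 1"]) auto
      qed
    qed
    from this[of R] l show False by force
  qed
  then show thesis using that by blast
qed

text \<open>A heavy block has length at least \<open>1 / (x * M)\<close> with \<open>M\<close> the
  total mass, which exceeds \<open>q ^ R\<close>, so every window of radius \<open>R\<close>
  contains a good block. That block is the plateau of a bump; its neighbours, at least
  \<open>q\<close> times as long, are the flanks.\<close>

lemma eigenvalue_count_ge_blocks:
  fixes d :: "nat \<Rightarrow> real"
  assumes \<nu>: "nonzero_finite_borel \<nu>" and x: "x > 0" and q: "q > 0"
    and qR: "q ^ R * (x * measure \<nu> (space \<nu>)) < 1"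
    and d: "\<And>j. j < m \<Longrightarrow> d j < d (j + 1)" "0 \<le> d 0" "d m \<le> 1"
    and heavy: "\<And>j. j < m \<Longrightarrow> 1 / x \<le> measure \<nu> {d j<..d (j + 1)} * (d (j + 1) - d j)"
    and K: "(2 * R + 4) * K + R + 2 \<le> m"
  shows "enat K \<le> eigenvalue_count \<nu> (2 * x / q)"
proof -
  interpret finite_measure \<nu> by (rule nzfb_finite[OF \<nu>])
  define M where "M = measure \<nu> (space \<nu>)"
  define l where "l j = d (j + 1) - d j" for j
  have dle: "d i \<le> d j" if "i \<le> j" "j \<le> m" for i j
    using that
  proof (induction j rule: dec_induct)
    case (step j)
    then show ?case using d(1)[of j] by auto
  qed simp
  have M: "M > 0"
  proof (rule ccontr)
    assume "\<not> M > 0"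
    moreover have "0 < m" using K by simp
    ultimately have "measure \<nu> {d 0<..d (0 + 1)} = 0"
      using bounded_measure[of "{d 0<..d (0 + 1)}"] measure_nonneg[of \<nu> "{d 0<..d (0 + 1)}"]
      unfolding M_def by linarith
    then show False using heavy[OF \<open>0 < m\<close>] x by simp
  qed
  have l_lower: "q ^ R < l j" if "j < m" for j
  proof -
    have "l j > 0" using d(1)[OF that] by (simp add: l_def)
    have "1 / x \<le> measure \<nu> {d j<..d (j + 1)} * l j" using heavy[OF that] by (simp add: l_def)
    also have "\<dots> \<le> M * l j"
      unfolding M_def using \<open>l j > 0\<close> by (intro mult_right_mono bounded_measure) auto
    finally have "1 \<le> (x * M) * l j" using x by (simp add: field_simps)
    then have "q ^ R * (x * M) < l j * (x * M)" using qR unfolding M_def by (simp add: mult_ac)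
    then show ?thesis using x M by simp
  qed
  \<comment> \<open>A window of radius \<open>R\<close> with one flanking block on each side spans
    \<open>2 * R + 3\<close> blocks. The offset \<open>i + 1\<close> leaves room on the left, and
    the summand \<open>R + 2\<close> in the hypothesis on \<open>m\<close> leaves it on the
    right.\<close>
  define j0 where "j0 i = (2 * R + 4) * (i + 1)" for i
  have j0m: "j0 i + R + 2 \<le> m" if "i < K" for i
  proof -
    have "(2 * R + 4) * (i + 1) \<le> (2 * R + 4) * K" using that by (intro mult_le_mono2) simp
    then show ?thesis using K by (simp add: j0_def)
  qed
  have "\<exists>j. j0 i \<le> j + R \<and> j \<le> j0 i + R \<and> q * l j \<le> l (j - 1) \<and> q * l j \<le> l (j + 1)" if i: "i < K" for i
  proof -
    have "l (j0 i) \<le> 1"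
      using dle[of "j0 i + 1" m] dle[of 0 "j0 i"] j0m[OF i] d by (simp add: l_def)
    moreover have "q ^ R < l j" if "j \<le> j0 i + R" for j using l_lower[of j] that j0m[OF i] by simp
    moreover have "R < j0 i" by (simp add: j0_def)
    ultimately show ?thesis
      using window_contains_good_index[OF q, of R "j0 i" l] by blast
  qed
  then have "\<forall>i. \<exists>j. i < K \<longrightarrow> j0 i \<le> j + R \<and> j \<le> j0 i + R \<and> q * l j \<le> l (j - 1) \<and> q * l j \<le> l (j + 1)"
    by blast
  from choice[OF this] obtain g where g: "\<And>i. i < K \<Longrightarrow> j0 i \<le> g i + R \<and> g i \<le> j0 i + R \<and>
      q * l (g i) \<le> l (g i - 1) \<and> q * l (g i) \<le> l (g i + 1)"
    by blast
  have g1: "1 \<le> g i" "g i + 2 \<le> m" if "i < K" for i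
    using g[OF that] j0m[OF that] by (auto simp: j0_def)
  show ?thesis
  proof (rule eigenvalue_count_ge_bumps[OF \<nu>, of _ K "\<lambda>i. d (g i - 1)" "\<lambda>i. d (g i)"
        "\<lambda>i. d (g i + 1)" "\<lambda>i. d (g i + 2)"])
    show "2 * x / q > 0" using x q by simp
    show "0 \<le> d (g i - 1) \<and> d (g i - 1) < d (g i) \<and> d (g i) < d (g i + 1) \<and>
        d (g i + 1) < d (g i + 2) \<and> d (g i + 2) \<le> 1" if "i < K" for i
    proof -
      have *: "g i - 1 < m" "g i < m" "g i + 1 < m" "g i - 1 + 1 = g i" using g1[OF that] by auto
      show ?thesis
        using d(1)[OF *(1)] d(1)[OF *(2)] d(1)[OF *(3)] dle[of 0 "g i - 1"] dle[of "g i + 2" m]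
          g1[OF that] d(2,3) * by (simp add: numeral_2_eq_2)
    qed
    show "d (g i + 2) \<le> d (g j - 1)" if "i < j" "j < K" for i j
    proof -
      have "(2 * R + 4) * (i + 1 + 1) \<le> (2 * R + 4) * (j + 1)" using that by (intro mult_le_mono2) simp
      then have "j0 i + 2 * R + 4 \<le> j0 j" by (simp add: j0_def algebra_simps)
      then show ?thesis using g[of i] g[of j] g1[OF that(2)] that by (intro dle) auto
    qed
    show "1 / (d (g i) - d (g i - 1)) + 1 / (d (g i + 2) - d (g i + 1)) \<le>
        2 * x / q * measure \<nu> {d (g i)<..d (g i + 1)}" if i: "i < K" for i
    proof -
      define L where "L = l (g i)"
      have L: "L > 0" using d(1)[of "g i"] g1[OF i] by (simp add: L_def l_def)
      have qL: "q * L > 0" using q L by simp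
      have "q * L \<le> d (g i) - d (g i - 1)" "q * L \<le> d (g i + 2) - d (g i + 1)"
        using g[OF i] g1[OF i] by (simp_all add: L_def l_def)
      then have "1 / (d (g i) - d (g i - 1)) \<le> 1 / (q * L)" "1 / (d (g i + 2) - d (g i + 1)) \<le> 1 / (q * L)"
        using qL by (intro frac_le; simp)+
      \<comment> \<open>Each flank costs at most \<open>1 / (q * L)\<close>, which heaviness bounds
        by \<open>Z\<close>; the two flanks give the factor 2 in \<open>2 * x / q\<close>.\<close>
      moreover define Z where "Z = x / q * measure \<nu> {d (g i)<..d (g i + 1)}"
      have "1 / (q * L) \<le> Z"
        unfolding Z_def
      proof -
        have "g i < m" using g1[OF i] by simp
        then have "x * (1 / x) \<le> x * (measure \<nu> {d (g i)<..d (g i + 1)} * L)"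
          using heavy[of "g i"] x unfolding L_def l_def by (intro mult_left_mono) auto
        then have "1 / (q * L) \<le> x * (measure \<nu> {d (g i)<..d (g i + 1)} * L) / (q * L)"
          using qL x by (intro divide_right_mono) auto
        also have "\<dots> = x / q * measure \<nu> {d (g i)<..d (g i + 1)}" using L q by simp
        finally show "1 / (q * L) \<le> x / q * measure \<nu> {d (g i)<..d (g i + 1)}" .
      qed
      ultimately have "1 / (d (g i) - d (g i - 1)) + 1 / (d (g i + 2) - d (g i + 1)) \<le> Z + Z"
        by (meson add_mono order_trans)
      then show ?thesis by (simp add: Z_def)
    qed
  qed
qed

section \<open>Grids that avoid atoms, and minimal partitions\<close>

lemma nonatoms_between:
  assumes "nonzero_finite_borel \<nu>" "a < b"
  obtains t where "a < t" "t < b" "measure \<nu> {t} = 0"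
proof -
  interpret finite_measure \<nu> by (rule nzfb_finite[OF assms(1)])
  have "uncountable ({a<..<b} - {t. measure \<nu> {t} \<noteq> 0})"
    using countable_support assms(2) by (simp add: uncountable_minus_countable uncountable_open_interval)
  then have "{a<..<b} - {t. measure \<nu> {t} \<noteq> 0} \<noteq> {}" by (metis countable_empty)
  then show thesis using that by auto
qed

lemma nzfb_measure_outside:
  assumes "nonzero_finite_borel \<nu>" "t \<notin> {0<..<1}"
  shows "measure \<nu> {t} = 0"
proof -
  have "emeasure \<nu> {t} \<le> emeasure \<nu> (- {0<..<1})"
    using assms nzfb_sets[OF assms(1)] by (intro emeasure_mono) auto
  then show ?thesis using assms(1) by (simp add: nonzero_finite_borel_def measure_def)
qed

lemma exists_fine_grid:
  assumes \<nu>: "nonzero_finite_borel \<nu>" and \<delta>: "\<delta> > 0"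
  obtains n c where "adapted_grid \<nu> n c" "\<And>k. k \<in> {1..<n} \<Longrightarrow> c (k + 1) - c k < \<delta>"
proof -
  obtain N where N: "real N > 2 / \<delta>" using reals_Archimedean2 by blast
  define n where "n = N + 2"
  define h where "h = 1 / real (n - 1)"
  have h: "h > 0" "real (n - 1) * h = 1" by (simp_all add: h_def n_def)
  have "2 * h < \<delta>"
  proof -
    have "2 / \<delta> < real (n - 1)" using N by (simp add: n_def)
    then show ?thesis using \<delta> by (simp add: h_def n_def field_simps)
  qed
  \<comment> \<open>These intervals are disjoint, so consecutive points differ by more than
    \<open>h / 2\<close> and by less than \<open>3 / 2 * h\<close>. The endpoints 0 and 1 fit in as
    \<open>(1 - 1) * h\<close> and \<open>(n - 1) * h\<close>.\<close>
  have "\<exists>t. (real k - 3/2) * h < t \<and> t < (real k - 1) * h \<and> measure \<nu> {t} = 0" for k :: nat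
    using nonatoms_between[OF \<nu>, of "(real k - 3/2) * h" "(real k - 1) * h"] h(1) by auto
  then obtain t where t: "\<And>k::nat. (real k - 3/2) * h < t k" "\<And>k. t k < (real k - 1) * h"
      "\<And>k. measure \<nu> {t k} = 0"
    by metis
  define c where "c k = (if k = 1 then 0 else if k = n then 1 else t k)" for k
  have lo: "(real k - 3/2) * h < c k" and hi: "c k \<le> (real k - 1) * h" if "1 \<le> k" "k \<le> n" for k
    using t(1)[of k] t(2)[of k] h that by (auto simp: c_def n_def field_simps less_imp_le of_nat_diff)
  have c0: "measure \<nu> {c k} = 0" for k
    using t(3) nzfb_measure_outside[OF \<nu>, of 0] nzfb_measure_outside[OF \<nu>, of 1] by (auto simp: c_def)
  have inc: "c k < c (k + 1)" "c (k + 1) - c k < \<delta>" if k: "k \<in> {1..<n}" for k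
  proof -
    have "c k \<le> (real k - 1) * h" "(real k - 3/2) * h < c k" using hi[of k] lo[of k] k by auto
    moreover have "(real (k + 1) - 3/2) * h < c (k + 1)" "c (k + 1) \<le> (real (k + 1) - 1) * h"
      using lo[of "k + 1"] hi[of "k + 1"] k by auto
    ultimately show "c k < c (k + 1)" "c (k + 1) - c k < \<delta>"
      using h(1) \<open>2 * h < \<delta>\<close> by (simp_all add: algebra_simps)
  qed
  have "adapted_grid \<nu> n c"
    using inc(1) c0 by (auto simp: adapted_grid_def n_def c_def)
  then show thesis using inc(2) by (rule that)
qed

text \<open>Extended naturals are well-ordered, so the infimum is attained once a fine grid shows
  that an admissible partition exists. Attainment matters because the last conclusion is a property
  of a minimiser.\<close>

lemma N_R_finite:
  assumes \<nu>: "nonzero_finite_borel \<nu>" and x: "x > 0"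
  obtains n c where "N_R \<nu> x = enat (n - 1)" "adapted_grid \<nu> n c"
    "\<forall>k\<in>{1..<n}. measure \<nu> {c k<..c (k + 1)} * (c (k + 1) - c k) < 1 / x"
    "\<forall>k\<in>{1..<n - 1}. 1 / x \<le> measure \<nu> {c k<..c (k + 2)} * (c (k + 2) - c k)"
proof -
  interpret finite_measure \<nu> by (rule nzfb_finite[OF \<nu>])
  define M where "M = measure \<nu> (space \<nu>)"
  define S where "S = {P \<in> nu_partitions \<nu>. \<forall>C\<in>P. measure \<nu> C * measure lborel C < 1 / x}"
  have SI: "cells n c \<in> S"
    if "adapted_grid \<nu> n c" "\<And>k. k \<in> {1..<n} \<Longrightarrow> measure \<nu> {c k<..c (k + 1)} * (c (k + 1) - c k) < 1 / x" for n c
    using that cell_small_iff[OF that(1), of x] by (auto simp: S_def nu_partitions_eq)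
  \<comment> \<open>Cells below this length are light whatever share of the mass they carry; the
    added 1 keeps the estimate strict.\<close>
  have "1 / (x * (M + 1)) > 0" using x by (simp add: M_def add_nonneg_pos)
  then obtain n c where c: "adapted_grid \<nu> n c" "\<And>k. k \<in> {1..<n} \<Longrightarrow> c (k + 1) - c k < 1 / (x * (M + 1))"
    using exists_fine_grid[OF \<nu>] by blast
  have "measure \<nu> {c k<..c (k + 1)} * (c (k + 1) - c k) < 1 / x" if k: "k \<in> {1..<n}" for k
  proof -
    have "0 < c (k + 1) - c k" using adapted_grid_less[OF c(1), of k "k + 1"] k by simp
    then have "measure \<nu> {c k<..c (k + 1)} * (c (k + 1) - c k) \<le> M * (c (k + 1) - c k)"
      unfolding M_def by (intro mult_right_mono bounded_measure) auto
    also have "\<dots> < (M + 1) * (c (k + 1) - c k)" using \<open>0 < c (k + 1) - c k\<close> by simp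
    also have "\<dots> \<le> (M + 1) * (1 / (x * (M + 1)))"
      using c(2)[OF k] by (intro mult_left_mono) (auto simp: M_def)
    also have "\<dots> = 1 / x"
    proof -
      have "M \<ge> 0" by (simp add: M_def)
      then have "M + 1 \<noteq> 0" by linarith
      then show ?thesis by simp
    qed
    finally show ?thesis .
  qed
  then have "cells n c \<in> S" using c(1) by (intro SI)
  then have "(INF P\<in>S. enat (card P)) \<in> (\<lambda>P. enat (card P)) ` S"
    by (intro wellorder_InfI) blast
  then obtain P where P: "P \<in> S" "N_R \<nu> x = enat (card P)"
    by (auto simp: N_R_def S_def)
  have min: "card P \<le> card Q" if "Q \<in> S" for Q
  proof -
    have "N_R \<nu> x \<le> enat (card Q)" unfolding N_R_def using that by (intro INF_lower) (simp add: S_def)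
    then show ?thesis using P by simp
  qed
  obtain n c where Pc: "P = cells n c" and grid: "adapted_grid \<nu> n c"
    using P(1) by (auto simp: S_def nu_partitions_eq)
  have small: "measure \<nu> {c k<..c (k + 1)} * (c (k + 1) - c k) < 1 / x" if "k \<in> {1..<n}" for k
    using P(1) cell_small_iff[OF grid, of x] that unfolding Pc S_def by blast
  \<comment> \<open>Otherwise two adjacent cells could be merged, contradicting the minimality of \<open>P\<close>.\<close>
  have "1 / x \<le> measure \<nu> {c k<..c (k + 2)} * (c (k + 2) - c k)" if k: "k \<in> {1..<n - 1}" for k
  proof (rule ccontr)
    assume merge: "\<not> ?thesis"
    \<comment> \<open>Deletes the interior point \<open>c (k + 1)\<close>.\<close>
    define c' where "c' i = (if i \<le> k then c i else c (i + 1))" for i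
    have "adapted_grid \<nu> (n - 1) c'"
      unfolding adapted_grid_def
    proof (intro conjI ballI)
      show "c' 1 = 0" "c' (n - 1) = 1" "2 \<le> n - 1"
        using k grid by (auto simp: c'_def adapted_grid_def)
      show "measure \<nu> {c' i} = 0" if "i \<in> {1..n - 1}" for i
        using that k grid by (auto simp: c'_def adapted_grid_def)
      show "c' i < c' (i + 1)" if "i \<in> {1..<n - 1}" for i
        using that k adapted_grid_less[OF grid, of i "i + 1"] adapted_grid_less[OF grid, of "i + 1" "i + 2"]
          adapted_grid_less[OF grid, of i "i + 2"] by (auto simp: c'_def)
    qed
    moreover have "measure \<nu> {c' i<..c' (i + 1)} * (c' (i + 1) - c' i) < 1 / x" if i: "i \<in> {1..<n - 1}" for i
    proof (cases i k rule: linorder_cases)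
      case less
      then have "i \<in> {1..<n}" using i by auto
      then show ?thesis using small[of i] less by (simp add: c'_def)
    next
      case equal
      then show ?thesis using merge by (simp add: c'_def not_le)
    next
      case greater
      then have "i + 1 \<in> {1..<n}" using i by auto
      then show ?thesis using small[of "i + 1"] greater by (simp add: c'_def)
    qed
    ultimately have "cells (n - 1) c' \<in> S" "card (cells (n - 1) c') = n - 1 - 1"
      by (blast intro: SI card_cells)+
    then have "n - 1 \<le> n - 1 - 1" using min[of "cells (n - 1) c'"] card_cells[OF grid] by (simp add: Pc)
    then show False using k by auto
  qed
  then show thesis
    using that[of n c] grid small P(2) by (simp add: Pc card_cells[OF grid])
qed

lemma N_R_le_eigenvalue_count:
  assumes \<nu>: "nonzero_finite_borel \<nu>" and x: "x > 0" and q: "q > 0"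
    and qR: "q ^ R * (x * measure \<nu> (space \<nu>)) < 1"
  obtains K where "N_R \<nu> x \<le> enat (2 * (2 * R + 4) * (K + 2) + 1)" "enat K \<le> eigenvalue_count \<nu> (2 * x / q)"
proof -
  obtain n c where N: "N_R \<nu> x = enat (n - 1)" and grid: "adapted_grid \<nu> n c"
    and "\<forall>k\<in>{1..<n}. measure \<nu> {c k<..c (k + 1)} * (c (k + 1) - c k) < 1 / x"
    and heavy: "\<forall>k\<in>{1..<n - 1}. 1 / x \<le> measure \<nu> {c k<..c (k + 2)} * (c (k + 2) - c k)"
    by (rule N_R_finite[OF \<nu> x])
  \<comment> \<open>Pairs of adjacent cells form \<open>m\<close> heavy blocks, and \<open>K\<close>
    windows of length \<open>L\<close> fit after \<open>R + 2\<close> blocks are reserved. Inverting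
    both integer divisions gives the bound on \<open>N_R\<close>.\<close>
  define m where "m = (n - 1) div 2"
  define L where "L = 2 * R + 4"
  define K where "K = (m - (R + 2)) div L"
  have n: "n \<ge> 2" "c 1 = 0" "c n = 1" using grid by (simp_all add: adapted_grid_def)
  have nm: "n - 1 \<le> 2 * m + 1" "2 * m + 1 \<le> n" using n(1) by (auto simp: m_def)
  have L: "L > 0" "R + 2 \<le> L" by (simp_all add: L_def)
  have "m - (R + 2) < L * (K + 1)"
    using L(1) dividend_less_times_div[of L "m - (R + 2)"] by (simp add: K_def)
  then have "m \<le> L * (K + 2)" using L(2) by (simp add: algebra_simps)
  then have "n - 1 \<le> 2 * L * (K + 2) + 1" using nm(1) by simp
  then have le: "N_R \<nu> x \<le> enat (2 * (2 * R + 4) * (K + 2) + 1)" by (simp add: N L_def)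
  show thesis
  proof (cases "K = 0")
    case True
    \<comment> \<open>Covers \<open>m < R + 2\<close>, which the truncated subtraction in
      \<open>K\<close> hides; the claim about the count is then trivial.\<close>
    show thesis by (rule that[OF le]) (simp add: True zero_enat_def[symmetric])
  next
    case False
    have LK: "L * K \<le> m - (R + 2)" by (simp add: K_def)
    moreover have "L * K > 0" using False L by simp
    ultimately have "L * K + R + 2 \<le> m" by linarith
    \<comment> \<open>Every second grid point, starting at \<open>c 1 = 0\<close>; an odd last cell
      is dropped.\<close>
    define d where "d j = c (2 * j + 1)" for j
    have "enat K \<le> eigenvalue_count \<nu> (2 * x / q)"
    proof (rule eigenvalue_count_ge_blocks[OF \<nu> x q qR, of m d])
      show "d j < d (j + 1)" if "j < m" for j
        unfolding d_def using that nm by (intro adapted_grid_less[OF grid]) auto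
      show "0 \<le> d 0" using n by (simp add: d_def)
      show "d m \<le> 1" unfolding d_def n(3)[symmetric] using nm by (intro adapted_grid_le[OF grid]) auto
      show "1 / x \<le> measure \<nu> {d j<..d (j + 1)} * (d (j + 1) - d j)" if "j < m" for j
        using heavy[rule_format, of "2 * j + 1"] that nm by (simp add: d_def)
      show "(2 * R + 4) * K + R + 2 \<le> m" using \<open>L * K + R + 2 \<le> m\<close> by (simp add: L_def)
    qed
    then show thesis by (rule that[OF le])
  qed
qed

text \<open>A single bump whose plateau has positive mass. It keeps the logarithm away from
  \<open>eln 0\<close> and so makes the upper spectral dimension non-negative.\<close>

lemma eigenvalue_count_eventually_pos:
  assumes \<nu>: "nonzero_finite_borel \<nu>"
  obtains y where "y > 0" "\<And>z. z \<ge> y \<Longrightarrow> 1 \<le> eigenvalue_count \<nu> z"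
proof -
  interpret finite_measure \<nu> by (rule nzfb_finite[OF \<nu>])
  have "\<exists>k::nat. measure \<nu> {1 / real (k + 3)<..1 - 1 / real (k + 3)} > 0"
  proof (rule ccontr)
    assume "\<not> ?thesis"
    then have "measure \<nu> {1 / real (k + 3)<..1 - 1 / real (k + 3)} = 0" for k :: nat
      using measure_nonneg[of \<nu>] by (meson antisym not_less)
    then have "{1 / real (k + 3)<..1 - 1 / real (k + 3)} \<in> null_sets \<nu>" for k :: nat
      by (intro null_setsI) (simp_all add: emeasure_eq_measure nzfb_sets[OF \<nu>])
    then have "(\<Union>k::nat. {1 / real (k + 3)<..1 - 1 / real (k + 3)}) \<in> null_sets \<nu>"
      by (intro null_sets_UN) auto
    moreover have "{0<..<1} \<subseteq> (\<Union>k::nat. {1 / real (k + 3)<..1 - 1 / real (k + 3)})"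
    proof
      fix t :: real assume t: "t \<in> {0<..<1}"
      obtain k :: nat where "real k > max (1 / t) (1 / (1 - t))" using reals_Archimedean2 by blast
      then have k: "1 / t < real (k + 3)" "1 / (1 - t) < real (k + 3)" by auto
      have "1 / real (k + 3) < t" "1 / real (k + 3) < 1 - t"
        using k t by (simp_all add: field_simps)
      then show "t \<in> (\<Union>k::nat. {1 / real (k + 3)<..1 - 1 / real (k + 3)})"
        by (intro UN_I[of k]) auto
    qed
    ultimately have "{0<..<1} \<in> null_sets \<nu>"
      using nzfb_sets[OF \<nu>] by (auto intro: null_sets_subset)
    then show False using \<nu> by (simp add: nonzero_finite_borel_def null_sets_def)
  qed
  then obtain k :: nat where k: "measure \<nu> {1 / real (k + 3)<..1 - 1 / real (k + 3)} > 0" by blast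
  define a where "a = 1 / real (k + 3)"
  have a: "0 < a" "a < 1/2" by (simp_all add: a_def field_simps)
  define m where "m = measure \<nu> {a<..1 - a}"
  have m: "m > 0" using k by (simp add: m_def a_def)
  \<comment> \<open>Chosen so that the energy \<open>2 / a\<close> of the bump equals
    \<open>y * m\<close>.\<close>
  define y where "y = 2 / (a * m)"
  have y: "y > 0" using a m by (simp add: y_def)
  have "1 \<le> eigenvalue_count \<nu> z" if z: "z \<ge> y" for z
  proof -
    have "1 / a + 1 / a = y * m" using a m by (simp add: y_def field_simps)
    also have "\<dots> \<le> z * m" using z m by (intro mult_right_mono) auto
    finally have "enat 1 \<le> eigenvalue_count \<nu> z"
      using z y a by (intro eigenvalue_count_ge_bumps[OF \<nu>, of z 1 "\<lambda>_. 0" "\<lambda>_. a" "\<lambda>_. 1 - a" "\<lambda>_. 1"])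
        (auto simp: m_def)
    then show ?thesis by (simp add: one_enat_def)
  qed
  then show thesis using that y by blast
qed

section \<open>Families of disjoint intervals\<close>

text \<open>The homothety moves \<open>t\<close> to a point between \<open>t\<close> and the
  midpoint. Endpoints need not belong to \<open>C\<close>, so a point of \<open>C\<close> beyond the
  image comes from strict inequality with \<open>Sup C\<close> or \<open>Inf C\<close>.\<close>

lemma shrink_subset:
  assumes C: "is_interval C" "C \<noteq> {}" "C \<subseteq> {0..1::real}" and m: "m > 1"
  shows "shrink m C \<subseteq> C"
proof
  fix w assume "w \<in> shrink m C"
  define z where "z = (Inf C + Sup C) / 2"
  obtain t where t: "t \<in> C" "w = z + (t - z) / m"
    using \<open>w \<in> shrink m C\<close> by (auto simp: shrink_def Let_def z_def)
  have bdd: "bdd_above C" "bdd_below C" using C(3) by (auto intro: bdd_above_mono bdd_below_mono)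
  have t_bounds: "Inf C \<le> t" "t \<le> Sup C" using t(1) bdd by (auto intro: cInf_lower cSup_upper)
  have iv: "u \<in> C" if "p \<in> C" "q \<in> C" "p \<le> u" "u \<le> q" for p q u
    using C(1) that unfolding is_interval_1 by blast
  show "w \<in> C"
  proof (cases t z rule: linorder_cases)
    case equal
    then show ?thesis using t by simp
  next
    case less
    have "(z - t) / m \<le> (z - t) / 1"
      using less m by (intro divide_left_mono) auto
    moreover have "0 \<le> (z - t) / m" using less m by simp
    moreover have "w = z - (z - t) / m" by (simp add: t(2) diff_divide_distrib)
    ultimately have w: "t \<le> w" "w \<le> z" by simp_all
    have "z < Sup C" using less t_bounds by (simp add: z_def)
    then have "w < Sup C" using w by simp
    then obtain s where "s \<in> C" "w < s" using less_cSup_iff[OF C(2) bdd(1)] by auto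
    then show ?thesis using iv[of t s w] t(1) w(1) by simp
  next
    case greater
    have "(t - z) / m \<le> (t - z) / 1"
      using greater m by (intro divide_left_mono) auto
    moreover have "0 \<le> (t - z) / m" using greater m by simp
    ultimately have w: "w \<le> t" "z \<le> w" by (simp_all add: t(2))
    have "Inf C < z" using greater t_bounds by (simp add: z_def)
    then have "Inf C < w" using w by simp
    then obtain s where "s \<in> C" "s < w" using cInf_less_iff[OF C(2) bdd(2)] by auto
    then show ?thesis using iv[of s t w] t(1) w(1) by simp
  qed
qed

text \<open>A non-measurable set has measure 0 by convention, which spares a proof that
  \<open>shrink m C\<close> is Borel.\<close>

lemma measure_lborel_mono_Ioc:
  assumes "A \<subseteq> {a<..b::real}"
  shows "measure lborel A \<le> measure lborel {a<..b}"
proof (cases "A \<in> sets lborel")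
  case True
  have "emeasure lborel {a<..b} < top" by (cases "a \<le> b") auto
  then show ?thesis using assms True by (intro measure_mono_fmeasurable) (auto simp: fmeasurable_def)
qed (simp add: measure_notin_sets)

text \<open>A heavy interval cannot lie inside a light cell, so it contains a grid point, and
  disjoint intervals contain different ones. There is one more grid point than cells; the argument
  \<open>x * (m - 1) / 4\<close> makes the two thresholds equal.\<close>

lemma N_L_le_N_R:
  assumes \<nu>: "nonzero_finite_borel \<nu>" and m: "m > 1" and x: "x > 0"
  shows "N_L \<nu> m x \<le> N_R \<nu> (x * (m - 1) / 4) + 1"
proof -
  interpret finite_measure \<nu> by (rule nzfb_finite[OF \<nu>])
  define y where "y = x * (m - 1) / 4"
  have y: "y > 0" "1 / y = 4 / (x * (m - 1))" using x m by (simp_all add: y_def)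
  obtain n c where N: "N_R \<nu> y = enat (n - 1)" and grid: "adapted_grid \<nu> n c"
    and small: "\<forall>k\<in>{1..<n}. measure \<nu> {c k<..c (k + 1)} * (c (k + 1) - c k) < 1 / y"
    and "\<forall>k\<in>{1..<n - 1}. 1 / y \<le> measure \<nu> {c k<..c (k + 2)} * (c (k + 2) - c k)"
    by (rule N_R_finite[OF \<nu> y(1)])
  have n: "n \<ge> 2" "c 1 = 0" "c n = 1" using grid by (simp_all add: adapted_grid_def)
  have "N_L \<nu> m x \<le> enat n"
    unfolding N_L_def
  proof (rule SUP_least)
    fix P assume "P \<in> {P \<in> interval_families \<nu>.
      \<forall>C\<in>P. 4 / (x * (m - 1)) \<le> measure \<nu> (shrink m C) * measure lborel (shrink m C)}"
    then have fam: "P \<in> interval_families \<nu>"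
      and heavy: "\<And>C. C \<in> P \<Longrightarrow> 1 / y \<le> measure \<nu> (shrink m C) * measure lborel (shrink m C)"
      by (auto simp: y(2))
    have hit: "\<exists>k\<in>{1..n}. c k \<in> C" if C: "C \<in> P" for C
    proof (rule ccontr)
      assume no: "\<not> ?thesis"
      have Ci: "is_interval C" "C \<noteq> {}" "C \<subseteq> {0..1}" using fam C by (auto simp: interval_families_def)
      have iv: "u \<in> C" if "p \<in> C" "q \<in> C" "p \<le> u" "u \<le> q" for p q u
        using Ci(1) that unfolding is_interval_1 by blast
      obtain t where t: "t \<in> C" using Ci(2) by auto
      have "0 \<notin> C" using no n by force
      then have "t \<in> {0<..1}" using t Ci(3) by (cases "t = 0") auto
      then obtain k where k: "k \<in> {1..<n}" "t \<in> {c k<..c (k + 1)}" by (rule adapted_grid_cell[OF grid])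
      have nk: "c k \<notin> C" "c (k + 1) \<notin> C" using no k(1) by auto
      have "C \<subseteq> {c k<..c (k + 1)}"
      proof
        fix s assume s: "s \<in> C"
        have "c k < s" using iv[OF s t, of "c k"] nk(1) k(2) by (force simp: not_less)
        moreover have "s < c (k + 1)" using iv[OF t s, of "c (k + 1)"] nk(2) k(2) by (force simp: not_less)
        ultimately show "s \<in> {c k<..c (k + 1)}" by simp
      qed
      then have sub: "shrink m C \<subseteq> {c k<..c (k + 1)}"
        using shrink_subset[OF Ci m] by blast
      have "measure \<nu> (shrink m C) * measure lborel (shrink m C) \<le>
          measure \<nu> {c k<..c (k + 1)} * measure lborel {c k<..c (k + 1)}"
        using sub nzfb_sets[OF \<nu>] by (intro mult_mono finite_measure_mono measure_lborel_mono_Ioc) auto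
      also have "\<dots> = measure \<nu> {c k<..c (k + 1)} * (c (k + 1) - c k)"
        using k(2) by simp
      also have "\<dots> < 1 / y" using small k(1) by blast
      finally show False using heavy[OF C] by simp
    qed
    then have "\<forall>C. \<exists>k. C \<in> P \<longrightarrow> k \<in> {1..n} \<and> c k \<in> C" by blast
    from choice[OF this] obtain f where f: "\<And>C. C \<in> P \<Longrightarrow> f C \<in> {1..n} \<and> c (f C) \<in> C" by blast
    have "inj_on f P"
    proof (rule inj_onI)
      fix C D assume "C \<in> P" "D \<in> P" "f C = f D"
      then have "c (f C) \<in> C \<inter> D" using f by force
      then show "C = D"
        using fam \<open>C \<in> P\<close> \<open>D \<in> P\<close> unfolding interval_families_def disjoint_def by blast
    qed
    then have "card P \<le> card {1..n}" using f by (intro card_inj_on_le) auto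
    then show "enat (card P) \<le> enat n" by simp
  qed
  also have "enat n = N_R \<nu> y + 1" using n(1) by (simp add: N one_enat_def)
  finally show ?thesis by (simp add: y_def)
qed

text \<open>
  The endpoints of an interval admissible for one measure may be atoms of the other. Cutting equal
  amounts off both ends keeps the midpoint, and a slightly smaller ratio compensates for the loss.
\<close>

lemma trim_interval:
  assumes \<nu>: "nonzero_finite_borel \<nu>" and m: "1 < m'" "m' < m"
    and C: "is_interval C" "C \<noteq> {}" "C \<subseteq> {0..1::real}" "measure lborel (shrink m C) > 0"
  obtains p q where "p < q" "{p..q} \<subseteq> C" "measure \<nu> {p} = 0" "measure \<nu> {q} = 0"
    "shrink m C \<subseteq> shrink m' {p..q}" "shrink m' {p..q} \<in> sets borel" "bounded (shrink m' {p..q})"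
proof -
  interpret finite_measure \<nu> by (rule nzfb_finite[OF \<nu>])
  define a where "a = Inf C"
  define b where "b = Sup C"
  define z where "z = (a + b) / 2"
  define r where "r = (b - a) / 2"
  have bdd: "bdd_above C" "bdd_below C" using C(3) by (auto intro: bdd_above_mono bdd_below_mono)
  have ab: "a \<le> t" "t \<le> b" if "t \<in> C" for t
    using that bdd by (auto simp: a_def b_def intro: cInf_lower cSup_upper)
  have "a < b"
  proof (rule ccontr)
    assume "\<not> a < b"
    then have "C \<subseteq> {a}" using ab by force
    then have "shrink m C \<subseteq> {z + (a - z) / m}" by (auto simp: shrink_def Let_def a_def b_def z_def)
    then have "shrink m C = {} \<or> shrink m C = {z + (a - z) / m}" by blast
    then show False using C(4) by auto
  qed
  then have r: "r > 0" by (simp add: r_def)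
  \<comment> \<open>The largest cut \<open>t\<close> with \<open>r / m \<le> (r - t) / m'\<close>;
    it is positive because \<open>m' < m\<close>.\<close>
  define e where "e = r * (1 - m' / m)"
  have e: "0 < e" "e < r" using r m by (simp_all add: e_def mult_less_cancel_left1)
  define A where "A = {t. measure \<nu> {t} \<noteq> 0}"
  \<comment> \<open>The same cut is made at both ends, so it must avoid the distances of atoms from
    either end.\<close>
  have "countable ((\<lambda>t. t - a) ` A \<union> (\<lambda>t. b - t) ` A)"
    using countable_support by (simp add: A_def)
  then have "uncountable ({0<..<e} - ((\<lambda>t. t - a) ` A \<union> (\<lambda>t. b - t) ` A))"
    using e(1) by (simp add: uncountable_minus_countable uncountable_open_interval)
  then have "{0<..<e} - ((\<lambda>t. t - a) ` A \<union> (\<lambda>t. b - t) ` A) \<noteq> {}" by (metis countable_empty)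
  then obtain t where "t \<in> {0<..<e} - ((\<lambda>t. t - a) ` A \<union> (\<lambda>t. b - t) ` A)" by blast
  then have t: "0 < t" "t < e" "t \<notin> (\<lambda>t. t - a) ` A" "t \<notin> (\<lambda>t. b - t) ` A" by simp_all
  have na: "a + t \<notin> A" "b - t \<notin> A"
    using t(3,4) by (auto intro: image_eqI[of _ _ "a + t"] image_eqI[of _ _ "b - t"])
  have pq: "a + t < b - t" using t e by (simp add: r_def)
  have S: "shrink m' {a + t..b - t} = {z - (r - t) / m'..z + (r - t) / m'}"
  proof -
    have mid: "(Inf {a + t..b - t} + Sup {a + t..b - t}) / 2 = z" using pq by (simp add: z_def)
    have "shrink m' {a + t..b - t} = (\<lambda>s. z + (s - z) / m') ` {a + t..b - t}"
      unfolding shrink_def Let_def mid ..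
    also have "\<dots> = {z - (r - t) / m'..z + (r - t) / m'}"
    proof (intro set_eqI iffI)
      fix w assume "w \<in> (\<lambda>s. z + (s - z) / m') ` {a + t..b - t}"
      then obtain s where s: "a + t \<le> s" "s \<le> b - t" "w = z + (s - z) / m'" by auto
      have "- (r - t) \<le> s - z" "s - z \<le> r - t" using s by (simp_all add: z_def r_def field_simps)
      then have "- (r - t) / m' \<le> (s - z) / m'" "(s - z) / m' \<le> (r - t) / m'"
        using m by (intro divide_right_mono; simp)+
      then show "w \<in> {z - (r - t) / m'..z + (r - t) / m'}" unfolding s(3) minus_divide_left[symmetric] by simp
    next
      fix w assume w: "w \<in> {z - (r - t) / m'..z + (r - t) / m'}"
      define s where "s = z + m' * (w - z)"
      have "m' * (w - z) \<le> m' * ((r - t) / m')" "m' * (- ((r - t) / m')) \<le> m' * (w - z)"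
        using w m by (intro mult_left_mono; simp)+
      then have "m' * (w - z) \<le> r - t" "- (r - t) \<le> m' * (w - z)" using m by simp_all
      then have "s \<in> {a + t..b - t}" by (simp add: s_def z_def r_def field_simps)
      moreover have "w = z + (s - z) / m'" using m by (simp add: s_def)
      ultimately show "w \<in> (\<lambda>s. z + (s - z) / m') ` {a + t..b - t}" by blast
    qed
    finally show ?thesis .
  qed
  have rm: "r / m \<le> (r - t) / m'"
  proof -
    have "m' * (r / m) = r - e" using m by (simp add: e_def field_simps)
    then have "m' * (r / m) \<le> r - t" using t by simp
    then show ?thesis using m by (simp add: pos_le_divide_eq mult.commute)
  qed
  have "shrink m C \<subseteq> {z - (r - t) / m'..z + (r - t) / m'}"
  proof
    fix w assume "w \<in> shrink m C"
    then obtain s where s: "s \<in> C" "w = z + (s - z) / m"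
      by (auto simp: shrink_def Let_def a_def b_def z_def)
    have "- r \<le> s - z" "s - z \<le> r" using ab[OF s(1)] by (simp_all add: z_def r_def field_simps)
    then have "- r / m \<le> (s - z) / m" "(s - z) / m \<le> r / m"
      using m by (intro divide_right_mono; simp)+
    then show "w \<in> {z - (r - t) / m'..z + (r - t) / m'}" using rm by (simp add: s(2))
  qed
  moreover have "{a + t..b - t} \<subseteq> C"
  proof
    fix w assume "w \<in> {a + t..b - t}"
    then have "Inf C < w" "w < Sup C" using t(1) by (auto simp: a_def b_def)
    then obtain u v where "u \<in> C" "u < w" "v \<in> C" "w < v"
      using cInf_less_iff[OF C(2) bdd(2)] less_cSup_iff[OF C(2) bdd(1)] by auto
    then show "w \<in> C" using C(1) unfolding is_interval_1 by (meson less_imp_le)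
  qed
  ultimately show thesis
    using na pq by (intro that[of "a + t" "b - t"]) (simp_all add: S A_def)
qed

text \<open>Trimmed intervals stay disjoint and non-empty, and their smaller ratio makes the
  shrunken copies contain the old ones. The new ratio halves \<open>m - 1\<close>, which doubling
  \<open>x\<close> compensates exactly.\<close>

lemma N_L_sum_measure_ge:
  assumes \<nu>: "nonzero_finite_borel \<nu>1" "nonzero_finite_borel \<nu>2" and m: "m > 1" and x: "x > 0"
  shows "N_L \<nu>1 m x \<le> N_L (sum_measure \<nu>1 \<nu>2) ((1 + m) / 2) (2 * x)"
  unfolding N_L_def[of \<nu>1]
proof (rule SUP_least)
  define \<nu> where "\<nu> = sum_measure \<nu>1 \<nu>2"
  define m' where "m' = (1 + m) / 2"
  have \<nu>': "nonzero_finite_borel \<nu>" unfolding \<nu>_def by (rule nzfb_sum_measure[OF \<nu>])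
  have m': "1 < m'" "m' < m" using m by (simp_all add: m'_def)
  interpret finite_measure \<nu>1 by (rule nzfb_finite[OF \<nu>(1)])
  fix P assume "P \<in> {P \<in> interval_families \<nu>1.
      \<forall>C\<in>P. 4 / (x * (m - 1)) \<le> measure \<nu>1 (shrink m C) * measure lborel (shrink m C)}"
  then have fam: "P \<in> interval_families \<nu>1"
    and heavy: "\<And>C. C \<in> P \<Longrightarrow> 4 / (x * (m - 1)) \<le> measure \<nu>1 (shrink m C) * measure lborel (shrink m C)"
    by auto
  have "\<exists>p q. p < q \<and> {p..q} \<subseteq> C \<and> measure \<nu> {p} = 0 \<and> measure \<nu> {q} = 0 \<and>
      4 / (x * (m - 1)) \<le> measure \<nu> (shrink m' {p..q}) * measure lborel (shrink m' {p..q})" if C: "C \<in> P" for C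
  proof -
    have Ci: "is_interval C" "C \<noteq> {}" "C \<subseteq> {0..1}" using fam C by (auto simp: interval_families_def)
    have "4 / (x * (m - 1)) > 0" using x m by simp
    then have "measure \<nu>1 (shrink m C) * measure lborel (shrink m C) > 0"
      using heavy[OF C] by (rule less_le_trans)
    then have "measure lborel (shrink m C) \<noteq> 0" by auto
    then have "measure lborel (shrink m C) > 0" by (simp add: zero_less_measure_iff)
    then obtain p q where pq: "p < q" "{p..q} \<subseteq> C" "measure \<nu> {p} = 0" "measure \<nu> {q} = 0"
      "shrink m C \<subseteq> shrink m' {p..q}" "shrink m' {p..q} \<in> sets borel" "bounded (shrink m' {p..q})"
      using trim_interval[OF \<nu>' m' Ci] by blast
    have "measure \<nu>1 (shrink m C) \<le> measure \<nu>1 (shrink m' {p..q})"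
      using pq(5,6) nzfb_sets[OF \<nu>(1)] by (intro finite_measure_mono) auto
    also have "\<dots> \<le> measure \<nu> (shrink m' {p..q})"
      unfolding \<nu>_def by (simp add: measure_sum_measure[OF \<nu> pq(6)])
    finally have 1: "measure \<nu>1 (shrink m C) \<le> measure \<nu> (shrink m' {p..q})" .
    have 2: "measure lborel (shrink m C) \<le> measure lborel (shrink m' {p..q})"
    proof (cases "shrink m C \<in> sets lborel")
      case True
      have "shrink m' {p..q} \<in> fmeasurable lborel"
        using pq(6,7) emeasure_bounded_finite[of "shrink m' {p..q}"] by (simp add: fmeasurable_def)
      then show ?thesis using pq(5) True by (intro measure_mono_fmeasurable)
    qed (simp add: measure_notin_sets)
    have "4 / (x * (m - 1)) \<le> measure \<nu> (shrink m' {p..q}) * measure lborel (shrink m' {p..q})"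
      using heavy[OF C] mult_mono[OF 1 2] by simp
    then show ?thesis using pq by blast
  qed
  then have "\<forall>C. \<exists>pq. C \<in> P \<longrightarrow> fst pq < snd pq \<and> {fst pq..snd pq} \<subseteq> C \<and> measure \<nu> {fst pq} = 0 \<and> measure \<nu> {snd pq} = 0 \<and>
      4 / (x * (m - 1)) \<le> measure \<nu> (shrink m' {fst pq..snd pq}) * measure lborel (shrink m' {fst pq..snd pq})"
    by simp
  from choice[OF this] obtain g where g: "\<And>C. C \<in> P \<Longrightarrow> fst (g C) < snd (g C) \<and> {fst (g C)..snd (g C)} \<subseteq> C \<and>
      measure \<nu> {fst (g C)} = 0 \<and> measure \<nu> {snd (g C)} = 0 \<and>
      4 / (x * (m - 1)) \<le> measure \<nu> (shrink m' {fst (g C)..snd (g C)}) * measure lborel (shrink m' {fst (g C)..snd (g C)})"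
    by blast
  define T where "T C = {fst (g C)..snd (g C)}" for C
  have T: "is_interval (T C)" "T C \<noteq> {}" "T C \<subseteq> C" "measure \<nu> {Inf (T C)} = 0" "measure \<nu> {Sup (T C)} = 0"
      "4 / (x * (m - 1)) \<le> measure \<nu> (shrink m' (T C)) * measure lborel (shrink m' (T C))" if "C \<in> P" for C
    using g[OF that] by (auto simp: T_def is_interval_cc)
  have disj: "C = D" if "C \<in> P" "D \<in> P" "C \<inter> D \<noteq> {}" for C D
    using fam that unfolding interval_families_def disjoint_def by blast
  have "inj_on T P"
    using T(2,3) disj by (intro inj_onI) blast
  then have card: "card (T ` P) = card P" by (rule card_image)
  have "T ` P \<in> interval_families \<nu>"
    unfolding interval_families_def
  proof (intro CollectI conjI ballI)
    show "finite (T ` P)" using fam by (simp add: interval_families_def)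
    show "disjoint (T ` P)"
    proof (rule disjointI)
      fix A B assume "A \<in> T ` P" "B \<in> T ` P" "A \<noteq> B"
      then show "A \<inter> B = {}" using T(3) disj by blast
    qed
    fix A assume "A \<in> T ` P"
    then obtain C where C: "C \<in> P" "A = T C" by auto
    moreover have "C \<subseteq> {0..1}" using fam C(1) by (auto simp: interval_families_def)
    ultimately show "is_interval A" "A \<noteq> {}" "A \<subseteq> {0..1}" "measure \<nu> {Inf A} = 0" "measure \<nu> {Sup A} = 0"
      using T[OF C(1)] by simp_all
  qed
  have "m' - 1 = (m - 1) / 2" by (simp add: m'_def)
  then have "2 * x * (m' - 1) = x * (m - 1)" by simp
  have "\<forall>A\<in>T ` P. 4 / (2 * x * (m' - 1)) \<le> measure \<nu> (shrink m' A) * measure lborel (shrink m' A)"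
    unfolding \<open>2 * x * (m' - 1) = x * (m - 1)\<close> using T(6) by blast
  with \<open>T ` P \<in> interval_families \<nu>\<close> have "enat (card (T ` P)) \<le> N_L \<nu> m' (2 * x)"
    unfolding N_L_def by (intro SUP_upper) simp
  then show "enat (card P) \<le> N_L (sum_measure \<nu>1 \<nu>2) ((1 + m) / 2) (2 * x)"
    by (simp add: card \<nu>_def m'_def)
qed

section \<open>Exponents\<close>

lemma eln_enat: "k > 0 \<Longrightarrow> eln (enat k) = ereal (ln (real k))"
  by (simp add: eln_def)

lemma eln_mono: "n \<le> m \<Longrightarrow> eln n \<le> eln m"
  by (cases n; cases m) (auto simp: eln_def)

lemma eventually_ln_pos: "\<forall>\<^sub>F x in at_top. 0 < ln (x::real)"
  using eventually_gt_at_top[of 1] by eventually_elim simp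

lemma exponent_quotient_mono:
  assumes "\<forall>\<^sub>F x in at_top. N x \<le> N' x"
  shows "\<forall>\<^sub>F x in at_top. eln (N x) / ereal (ln x) \<le> eln (N' x) / ereal (ln x)"
  using assms eventually_ln_pos
  by eventually_elim (auto intro: ereal_divide_right_mono eln_mono)

lemma upper_exponent_mono:
  "\<forall>\<^sub>F x in at_top. N x \<le> N' x \<Longrightarrow> upper_exponent N \<le> upper_exponent N'"
  unfolding upper_exponent_def by (intro Limsup_mono exponent_quotient_mono)

lemma lower_exponent_mono:
  "\<forall>\<^sub>F x in at_top. N x \<le> N' x \<Longrightarrow> lower_exponent N \<le> lower_exponent N'"
  unfolding lower_exponent_def by (intro Liminf_mono exponent_quotient_mono)

lemma lower_le_upper_exponent: "lower_exponent N \<le> upper_exponent N"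
  unfolding lower_exponent_def upper_exponent_def by (rule Liminf_le_Limsup) simp

lemma upper_exponent_nonneg:
  assumes "\<forall>\<^sub>F x in at_top. 1 \<le> N x"
  shows "0 \<le> upper_exponent N"
proof -
  have "\<forall>\<^sub>F x in at_top. 0 \<le> eln (N x) / ereal (ln x)"
    using assms eventually_ln_pos
  proof eventually_elim
    case (elim x)
    have "eln 1 = 0" by (simp add: eln_def one_enat_def zero_ereal_def)
    then have "0 \<le> eln (N x)" using eln_mono[OF elim(1)] by simp
    from ereal_divide_right_mono[OF this, of "ereal (ln x)"] elim(2) show ?case by simp
  qed
  then have "Limsup at_top (\<lambda>x::real. 0) \<le> upper_exponent N"
    unfolding upper_exponent_def by (rule Limsup_mono)
  then show ?thesis by (simp add: Limsup_const)
qed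

text \<open>Strict inequality removes any constant from the power bound and also forces the count to
  be eventually finite.\<close>

lemma upper_exponent_lessD:
  assumes "upper_exponent N < ereal u"
  shows "\<forall>\<^sub>F x in at_top. \<exists>k. N x = enat k \<and> real k \<le> x powr u"
proof -
  have "\<forall>\<^sub>F x in at_top. eln (N x) / ereal (ln x) < ereal u"
    using assms unfolding upper_exponent_def by (rule Limsup_lessD)
  then show ?thesis
    using eventually_gt_at_top[of 1]
  proof eventually_elim
    case (elim x)
    then have l: "ln x > 0" by simp
    show ?case
    proof (cases "N x")
      case (enat k)
      have "real k \<le> x powr u"
      proof (cases "k = 0")
        case False
        then have "ln (real k) / ln x < u" using elim enat by (simp add: eln_enat)
        then have "ln (real k) < u * ln x" using l by (simp add: pos_divide_less_eq)
        then have "exp (ln (real k)) < exp (u * ln x)" by simp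
        then show ?thesis using False elim by (simp add: powr_def)
      qed simp
      then show ?thesis using enat by simp
    next
      case infinity
      then show ?thesis using elim l by (simp add: eln_def)
    qed
  qed
qed

lemma ln_affine_quotient_tendsto: "((\<lambda>x. (c + v * ln x) / ln x) \<longlongrightarrow> v) at_top" for c v :: real
proof -
  have "((\<lambda>x. c / ln x + v) \<longlongrightarrow> 0 + v) at_top"
    by (intro tendsto_add tendsto_const real_tendsto_divide_at_top[OF tendsto_const ln_at_top])
  moreover have "\<forall>\<^sub>F x in at_top. c / ln x + v = (c + v * ln x) / ln x"
    using eventually_ln_pos by eventually_elim (simp add: field_simps)
  ultimately show ?thesis by (simp add: filterlim_cong[OF refl refl])
qed

text \<open>The constant contributes \<open>ln C / ln x\<close>, which tends to 0, so it may depend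
  on \<open>v\<close>.\<close>

lemma upper_exponent_leI:
  assumes "\<And>v. s < ereal v \<Longrightarrow>
    \<exists>C>0. \<forall>\<^sub>F x in at_top. \<exists>k. N x = enat k \<and> real k \<le> C * x powr v"
  shows "upper_exponent N \<le> s"
proof (rule dense_ge)
  fix z assume "s < z"
  then obtain v where v: "s < ereal v" "ereal v < z" using ereal_dense2 by blast
  obtain C where C: "C > 0" "\<forall>\<^sub>F x in at_top. \<exists>k. N x = enat k \<and> real k \<le> C * x powr v"
    using assms[OF v(1)] by blast
  have "\<forall>\<^sub>F x in at_top. eln (N x) / ereal (ln x) \<le> ereal ((ln C + v * ln x) / ln x)"
    using C(2) eventually_gt_at_top[of 1]
  proof eventually_elim
    case (elim x)
    then have l: "ln x > 0" by simp
    obtain k where k: "N x = enat k" "real k \<le> C * x powr v" using elim by blast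
    show ?case
    proof (cases "k = 0")
      case True
      then show ?thesis using k l by (simp add: eln_def)
    next
      case False
      then have "ln (real k) \<le> ln (C * x powr v)" using k(2) C(1) elim by simp
      also have "\<dots> = ln C + v * ln x" using C(1) elim by (simp add: ln_mult ln_powr)
      finally show ?thesis using False k(1) l by (simp add: eln_enat divide_right_mono)
    qed
  qed
  then have "upper_exponent N \<le> Limsup at_top (\<lambda>x. ereal ((ln C + v * ln x) / ln x))"
    unfolding upper_exponent_def by (rule Limsup_mono)
  also have "\<dots> = ereal v"
    by (intro lim_imp_Limsup tendsto_ereal ln_affine_quotient_tendsto) simp
  finally show "upper_exponent N \<le> z" using v(2) by simp
qed

text \<open>Rescaling the argument changes \<open>ln x\<close> by a constant, which the quotient
  forgets.\<close>

lemma lower_exponent_dilate: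
  assumes le: "\<forall>\<^sub>F x in at_top. N x \<le> N' (c * x)" and c: "c > 0"
  shows "lower_exponent N \<le> lower_exponent N'"
proof (rule dense_le)
  fix z assume "z < lower_exponent N"
  then obtain u where u: "z < ereal u" "ereal u < lower_exponent N" using ereal_dense2 by blast
  have "\<forall>\<^sub>F x in at_top. ereal u < eln (N x) / ereal (ln x)"
    using u(2) unfolding lower_exponent_def by (rule less_LiminfD)
  then have "\<forall>\<^sub>F x in at_top. ereal (u * ln x) \<le> eln (N' (c * x))"
    using le eventually_gt_at_top[of 1]
  proof eventually_elim
    case (elim x)
    then have l: "ln x > 0" by simp
    have "ereal u < eln (N' (c * x)) / ereal (ln x)"
      using elim(1) ereal_divide_right_mono[OF eln_mono[OF elim(2)], of "ereal (ln x)"] l by simp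
    then show ?case
      using l by (cases "eln (N' (c * x))") (auto simp: pos_less_divide_eq)
  qed
  moreover have "filterlim (\<lambda>x. 1 / c * x) at_top at_top"
    using c by (intro filterlim_tendsto_pos_mult_at_top[OF tendsto_const _ filterlim_ident]) simp
  ultimately have "\<forall>\<^sub>F x in at_top. ereal (u * ln (1 / c * x)) \<le> eln (N' (c * (1 / c * x)))"
    by (rule eventually_compose_filterlim)
  then have "\<forall>\<^sub>F x in at_top. ereal ((u * ln (1 / c) + u * ln x) / ln x) \<le> eln (N' x) / ereal (ln x)"
    using eventually_gt_at_top[of 1]
  proof eventually_elim
    case (elim x)
    then have l: "ln x > 0" by simp
    have "ln (1 / c * x) = ln (1 / c) + ln x" using c elim by (simp add: ln_mult ln_div)
    then have "ereal (u * ln (1 / c) + u * ln x) \<le> eln (N' x)"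
      using elim(1) c by (simp add: distrib_left)
    then have "ereal (u * ln (1 / c) + u * ln x) / ereal (ln x) \<le> eln (N' x) / ereal (ln x)"
      using l by (intro ereal_divide_right_mono) auto
    then show ?case using l by simp
  qed
  then have "Liminf at_top (\<lambda>x. ereal ((u * ln (1 / c) + u * ln x) / ln x)) \<le> lower_exponent N'"
    unfolding lower_exponent_def by (rule Liminf_mono)
  moreover have "Liminf at_top (\<lambda>x. ereal ((u * ln (1 / c) + u * ln x) / ln x)) = ereal u"
    by (intro lim_imp_Liminf tendsto_ereal ln_affine_quotient_tendsto) simp
  ultimately show "z \<le> lower_exponent N'" using u(1) by simp
qed

section \<open>Spectral dimension, partition entropy and regularity\<close>

lemma upper_spectral_dim_nonneg:
  assumes "nonzero_finite_borel \<nu>"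
  shows "0 \<le> upper_spectral_dim \<nu>"
  unfolding upper_spectral_dim_def
proof (rule upper_exponent_nonneg)
  obtain y where "\<And>z. z \<ge> y \<Longrightarrow> 1 \<le> eigenvalue_count \<nu> z"
    using eigenvalue_count_eventually_pos[OF assms] by blast
  then show "\<forall>\<^sub>F x in at_top. 1 \<le> eigenvalue_count \<nu> x"
    by (intro eventually_mono[OF eventually_ge_at_top[of y]])
qed

text \<open>With \<open>q = x powr - e\<close> the number \<open>R\<close> depends on
  \<open>e\<close> alone, so the block argument loses a constant factor in the count and a factor
  \<open>x powr e\<close> in its argument; the latter raises the exponent from \<open>u\<close> to
  \<open>v\<close>.\<close>

lemma upper_spectral_dim_eq_upper_h:
  assumes \<nu>: "nonzero_finite_borel \<nu>"
  shows "upper_spectral_dim \<nu> = upper_h \<nu>"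
proof (rule antisym)
  show "upper_spectral_dim \<nu> \<le> upper_h \<nu>"
    unfolding upper_spectral_dim_def upper_h_def
    by (rule upper_exponent_mono, rule eventually_mono[OF eventually_gt_at_top[of 0]])
      (rule eigenvalue_count_le_N_R[OF \<nu>])
  show "upper_h \<nu> \<le> upper_spectral_dim \<nu>"
    unfolding upper_h_def
  proof (rule upper_exponent_leI)
    fix v assume "upper_spectral_dim \<nu> < ereal v"
    then obtain u where u: "upper_spectral_dim \<nu> < ereal u" "u < v"
      using ereal_dense2 by (metis less_ereal.simps(1))
    have u0: "u > 0" using u(1) upper_spectral_dim_nonneg[OF \<nu>] by (metis ereal_less(2) le_less_trans)
    \<comment> \<open>Spends the distance between \<open>u\<close> and \<open>v\<close>. Then
      \<open>R > 2 / e\<close> gives \<open>q ^ R \<le> x powr - 2\<close>, enough once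
      \<open>x\<close> exceeds the total mass.\<close>
    define e where "e = v / u - 1"
    have e: "e > 0" "(1 + e) * u = v" using u u0 by (simp_all add: e_def field_simps)
    obtain R :: nat where R: "real R > 2 / e" using reals_Archimedean2 by blast
    define M where "M = measure \<nu> (space \<nu>)"
    define L where "L = 2 * (2 * R + 4)"
    have fl: "filterlim (\<lambda>x. 2 * x powr (1 + e)) at_top at_top"
    proof (rule filterlim_at_top_mono)
      show "filterlim (\<lambda>x::real. x) at_top at_top" by (rule filterlim_ident)
      show "\<forall>\<^sub>F x in at_top. x \<le> 2 * x powr (1 + e)"
        using eventually_ge_at_top[of 1]
      proof eventually_elim
        case (elim x)
        have "x powr 1 \<le> x powr (1 + e)" using elim e(1) by (intro powr_mono) auto
        then show ?case using elim by simp
      qed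
    qed
    have "\<forall>\<^sub>F z in at_top. \<exists>k. eigenvalue_count \<nu> z = enat k \<and> real k \<le> z powr u"
      using u(1) unfolding upper_spectral_dim_def by (rule upper_exponent_lessD)
    then have "\<forall>\<^sub>F x in at_top. \<exists>k. eigenvalue_count \<nu> (2 * x powr (1 + e)) = enat k \<and>
        real k \<le> (2 * x powr (1 + e)) powr u"
      using fl by (rule eventually_compose_filterlim)
    then have "\<forall>\<^sub>F x in at_top. \<exists>k. N_R \<nu> x = enat k \<and> real k \<le> (real L * (2 powr u + 2) + 1) * x powr v"
      using eventually_gt_at_top[of "max 1 M"]
    proof eventually_elim
      case (elim x)
      then have x: "x > 1" "x > M" by auto
      define q where "q = x powr - e"
      have q: "q > 0" using x by (simp add: q_def)
      have "q ^ R * (x * M) < 1"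
      proof -
        have "2 < e * real R" using R e(1) by (simp add: field_simps)
        then have "q ^ R \<le> x powr - 2"
          using x by (simp add: q_def powr_realpow[symmetric] powr_powr)
        then have "q ^ R * (x * M) \<le> x powr - 2 * (x * M)"
          using x by (intro mult_right_mono) (auto simp: M_def)
        also have "\<dots> < x powr - 2 * (x * x)" using x by simp
        also have "\<dots> = 1" using x by (simp add: powr_minus field_simps power2_eq_square)
        finally show ?thesis .
      qed
      then obtain K where K: "N_R \<nu> x \<le> enat (2 * (2 * R + 4) * (K + 2) + 1)"
          "enat K \<le> eigenvalue_count \<nu> (2 * x / q)"
        using N_R_le_eigenvalue_count[OF \<nu> _ q, of x R] x by (auto simp: M_def)
      have "2 * x / q = 2 * x powr (1 + e)"
        using x by (simp add: q_def powr_minus powr_add field_simps)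
      then obtain k where k: "eigenvalue_count \<nu> (2 * x / q) = enat k" "real k \<le> (2 * x powr (1 + e)) powr u"
        using elim(1) by auto
      have "(2 * x powr (1 + e)) powr u = 2 powr u * x powr v"
        using x by (simp add: powr_mult powr_powr e(2))
      then have Kle: "real K \<le> 2 powr u * x powr v" using K(2) k by simp
      obtain n where n: "N_R \<nu> x = enat n" "n \<le> L * (K + 2) + 1"
        using K(1) by (cases "N_R \<nu> x") (auto simp: L_def)
      \<comment> \<open>Allows \<open>x powr v\<close> to absorb additive constants;
        \<open>v\<close> is positive because the spectral dimension is non-negative.\<close>
      have xv: "1 \<le> x powr v" using x u u0 by (simp add: ge_one_powr_ge_zero)
      have "real n \<le> real L * (real K + 2) + 1"
        using n(2) by (metis of_nat_1 of_nat_add of_nat_le_iff of_nat_mult of_nat_numeral)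
      also have "\<dots> \<le> real L * (2 powr u * x powr v + 2 * x powr v) + x powr v"
        using Kle xv by (intro add_mono mult_left_mono) auto
      also have "\<dots> = (real L * (2 powr u + 2) + 1) * x powr v" by (simp add: algebra_simps)
      finally show ?case using n(1) by blast
    qed
    moreover have "real L * (2 powr u + 2) + 1 > 0" by (simp add: add_nonneg_pos)
    ultimately show "\<exists>C>0. \<forall>\<^sub>F x in at_top. \<exists>k. N_R \<nu> x = enat k \<and> real k \<le> C * x powr v" by blast
  qed
qed

lemma upper_spectral_dim_sum_measure:
  assumes \<nu>: "nonzero_finite_borel \<nu>1" "nonzero_finite_borel \<nu>2"
  shows "upper_spectral_dim (sum_measure \<nu>1 \<nu>2) = max (upper_spectral_dim \<nu>1) (upper_spectral_dim \<nu>2)"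
proof (rule antisym)
  show "max (upper_spectral_dim \<nu>1) (upper_spectral_dim \<nu>2) \<le> upper_spectral_dim (sum_measure \<nu>1 \<nu>2)"
    unfolding upper_spectral_dim_def
    by (intro max.boundedI upper_exponent_mono; rule eventually_mono[OF eventually_ge_at_top[of 0]])
      (rule eigenvalue_count_sum_ge[OF \<nu>], assumption)+
  show "upper_spectral_dim (sum_measure \<nu>1 \<nu>2) \<le> max (upper_spectral_dim \<nu>1) (upper_spectral_dim \<nu>2)"
    unfolding upper_spectral_dim_def[of "sum_measure \<nu>1 \<nu>2"]
  proof (rule upper_exponent_leI)
    fix v assume "max (upper_spectral_dim \<nu>1) (upper_spectral_dim \<nu>2) < ereal v"
    then have v: "upper_exponent (eigenvalue_count \<nu>1) < ereal v" "upper_exponent (eigenvalue_count \<nu>2) < ereal v"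
      by (simp_all add: upper_spectral_dim_def)
    have fl: "filterlim (\<lambda>x::real. 2 * x) at_top at_top"
      by (intro filterlim_tendsto_pos_mult_at_top[OF tendsto_const _ filterlim_ident]) simp
    have "\<forall>\<^sub>F x in at_top. \<exists>k. eigenvalue_count (sum_measure \<nu>1 \<nu>2) x = enat k \<and> real k \<le> (2 * 2 powr v) * x powr v"
      using eventually_compose_filterlim[OF upper_exponent_lessD[OF v(1)] fl]
        eventually_compose_filterlim[OF upper_exponent_lessD[OF v(2)] fl] eventually_gt_at_top[of 0]
    proof eventually_elim
      case (elim x)
      then obtain k1 k2 where k: "eigenvalue_count \<nu>1 (2 * x) = enat k1" "real k1 \<le> (2 * x) powr v"
          "eigenvalue_count \<nu>2 (2 * x) = enat k2" "real k2 \<le> (2 * x) powr v"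
        by blast
      have le: "eigenvalue_count (sum_measure \<nu>1 \<nu>2) x \<le> enat (k1 + k2)"
        using eigenvalue_count_sum_le[OF \<nu>, of x] by (simp add: k)
      then obtain k where k': "eigenvalue_count (sum_measure \<nu>1 \<nu>2) x = enat k" "k \<le> k1 + k2"
        by (cases "eigenvalue_count (sum_measure \<nu>1 \<nu>2) x") auto
      have "real k \<le> real k1 + real k2" using k'(2) by simp
      also have "\<dots> \<le> (2 * 2 powr v) * x powr v" using k elim(3) by (simp add: powr_mult)
      finally show ?case using k'(1) by blast
    qed
    then show "\<exists>C>0. \<forall>\<^sub>F x in at_top. \<exists>k. eigenvalue_count (sum_measure \<nu>1 \<nu>2) x = enat k \<and> real k \<le> C * x powr v"
      by (intro exI[of _ "2 * 2 powr v"]) simp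
  qed
qed

text \<open>The half of regularity that every measure satisfies. Non-negativity of
  \<open>upper_h\<close> makes \<open>v\<close> positive, so the additive 1 in
  \<open>N_L_le_N_R\<close> is absorbed.\<close>

lemma lower_h_le_upper_h:
  assumes \<nu>: "nonzero_finite_borel \<nu>" and m: "m > 1"
  shows "lower_h \<nu> m \<le> upper_h \<nu>"
proof -
  have "upper_exponent (N_L \<nu> m) \<le> upper_h \<nu>"
  proof (rule upper_exponent_leI)
    fix v assume v: "upper_h \<nu> < ereal v"
    have "0 \<le> upper_h \<nu>"
      using upper_spectral_dim_nonneg[OF \<nu>] upper_spectral_dim_eq_upper_h[OF \<nu>] by simp
    from le_less_trans[OF this v] have v0: "v > 0" by simp
    define c where "c = (m - 1) / 4"
    have c: "c > 0" using m by (simp add: c_def)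
    have fl: "filterlim (\<lambda>x::real. c * x) at_top at_top"
      using c by (intro filterlim_tendsto_pos_mult_at_top[OF tendsto_const _ filterlim_ident]) simp
    have "\<forall>\<^sub>F x in at_top. \<exists>k. N_L \<nu> m x = enat k \<and> real k \<le> (c powr v + 1) * x powr v"
      using eventually_compose_filterlim[OF upper_exponent_lessD[OF v[unfolded upper_h_def]] fl]
        eventually_gt_at_top[of 1]
    proof eventually_elim
      case (elim x)
      then obtain k where k: "N_R \<nu> (c * x) = enat k" "real k \<le> (c * x) powr v" by blast
      have "N_R \<nu> (x * (m - 1) / 4) = N_R \<nu> (c * x)" by (rule arg_cong) (simp add: c_def)
      then have "N_L \<nu> m x \<le> N_R \<nu> (c * x) + 1"
        using N_L_le_N_R[OF \<nu> m, of x] elim(2) by (simp only:)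
      then have "N_L \<nu> m x \<le> enat (k + 1)" by (simp add: k(1) one_enat_def)
      then obtain l where l: "N_L \<nu> m x = enat l" "l \<le> k + 1" by (cases "N_L \<nu> m x") auto
      have "real l \<le> real k + 1" using l(2) by simp
      also have "\<dots> \<le> c powr v * x powr v + x powr v"
        using k(2) c elim(2) v0 by (intro add_mono) (auto simp: powr_mult ge_one_powr_ge_zero)
      finally show ?case using l(1) by (simp add: algebra_simps)
    qed
    moreover have "c powr v + 1 > 0" by (simp add: add_nonneg_pos)
    ultimately show "\<exists>C>0. \<forall>\<^sub>F x in at_top. \<exists>k. N_L \<nu> m x = enat k \<and> real k \<le> C * x powr v" by blast
  qed
  then show ?thesis
    using lower_le_upper_exponent[of "N_L \<nu> m"] by (simp add: lower_h_def)
qed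

lemma lower_h_sum_measure_ge:
  assumes "nonzero_finite_borel \<nu>1" "nonzero_finite_borel \<nu>2" "m > 1"
  shows "lower_h \<nu>1 m \<le> lower_h (sum_measure \<nu>1 \<nu>2) ((1 + m) / 2)"
  unfolding lower_h_def
proof (rule lower_exponent_dilate[where c = 2])
  show "\<forall>\<^sub>F x in at_top. N_L \<nu>1 m x \<le> N_L (sum_measure \<nu>1 \<nu>2) ((1 + m) / 2) (2 * x)"
    using eventually_gt_at_top[of 0]
    by eventually_elim (rule N_L_sum_measure_ge[OF assms])
qed simp

theorem corollary1p12:
  fixes \<nu>1 \<nu>2 :: "real measure"
  assumes "nonzero_finite_borel \<nu>1" and "nonzero_finite_borel \<nu>2"
  shows "upper_spectral_dim (sum_measure \<nu>1 \<nu>2) =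
           max (upper_spectral_dim \<nu>1) (upper_spectral_dim \<nu>2) \<and>
         (lower_spectral_dim \<nu>1 = upper_spectral_dim \<nu>1 \<and>
          upper_spectral_dim \<nu>1 \<ge> upper_spectral_dim \<nu>2 \<longrightarrow>
            has_spectral_dim (sum_measure \<nu>1 \<nu>2) (upper_spectral_dim \<nu>1)) \<and>
         (lower_spectral_dim \<nu>1 = upper_spectral_dim \<nu>1 \<and>
          upper_spectral_dim \<nu>1 \<ge> upper_spectral_dim \<nu>2 \<and> regular_measure \<nu>1 \<longrightarrow>
            regular_measure (sum_measure \<nu>1 \<nu>2))"
proof (intro conjI impI)
  let ?\<nu> = "sum_measure \<nu>1 \<nu>2"
  have \<nu>: "nonzero_finite_borel ?\<nu>" by (rule nzfb_sum_measure[OF assms])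
  show upper: "upper_spectral_dim ?\<nu> = max (upper_spectral_dim \<nu>1) (upper_spectral_dim \<nu>2)"
    by (rule upper_spectral_dim_sum_measure[OF assms])
  show "has_spectral_dim ?\<nu> (upper_spectral_dim \<nu>1)"
    if "lower_spectral_dim \<nu>1 = upper_spectral_dim \<nu>1 \<and> upper_spectral_dim \<nu>1 \<ge> upper_spectral_dim \<nu>2"
  proof -
    \<comment> \<open>Squeezes the lower dimension of the sum between that of \<open>\<nu>1\<close>
      and the maximum formula.\<close>
    have "lower_spectral_dim \<nu>1 \<le> lower_spectral_dim ?\<nu>"
      unfolding lower_spectral_dim_def
      by (rule lower_exponent_mono, rule eventually_mono[OF eventually_ge_at_top[of 0]])
        (rule eigenvalue_count_sum_ge(1)[OF assms])
    moreover have "lower_spectral_dim ?\<nu> \<le> upper_spectral_dim ?\<nu>"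
      unfolding lower_spectral_dim_def upper_spectral_dim_def by (rule lower_le_upper_exponent)
    ultimately show ?thesis
      using that upper by (auto simp: has_spectral_dim_def max_def intro: antisym)
  qed
  show "regular_measure ?\<nu>"
    if reg: "lower_spectral_dim \<nu>1 = upper_spectral_dim \<nu>1 \<and>
      upper_spectral_dim \<nu>1 \<ge> upper_spectral_dim \<nu>2 \<and> regular_measure \<nu>1"
    unfolding regular_measure_def
  proof (rule antisym)
    show "(SUP m\<in>{1<..}. lower_h ?\<nu> m) \<le> upper_h ?\<nu>"
      by (intro SUP_least lower_h_le_upper_h[OF \<nu>]) simp
    \<comment> \<open>Partition counts of the sum are not compared with those of
      \<open>\<nu>1\<close>; the equality passes through spectral dimensions.\<close>
    have "upper_h ?\<nu> = upper_h \<nu>1"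
      unfolding upper_spectral_dim_eq_upper_h[OF \<nu>, symmetric] upper_spectral_dim_eq_upper_h[OF assms(1), symmetric] upper
      using reg by (simp add: max_absorb1)
    also have "\<dots> = (SUP m\<in>{1<..}. lower_h \<nu>1 m)" using reg by (simp add: regular_measure_def)
    \<comment> \<open>The comparison moves \<open>m\<close> to \<open>(1 + m) / 2\<close>, again
      above 1, so it is used as an inequality of suprema.\<close>
    also have "\<dots> \<le> (SUP m\<in>{1<..}. lower_h ?\<nu> m)"
    proof (rule SUP_mono)
      fix m :: real assume "m \<in> {1<..}"
      then show "\<exists>m'\<in>{1<..}. lower_h \<nu>1 m \<le> lower_h ?\<nu> m'"
        by (intro bexI[of _ "(1 + m) / 2"] lower_h_sum_measure_ge[OF assms]) auto
    qed
    finally show "upper_h ?\<nu> \<le> (SUP m\<in>{1<..}. lower_h ?\<nu> m)" .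
  qed
qed

end
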